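(* Let $(X,d,m)$ be a homogeneous ultrametric measure space, $L$ a homogeneous hierarchical Laplacian on it, $\mathcal{H}$ a horocycle, $\sigma:\mathcal{H}\to\mathbb{R}$ a function, $V=\sum_{B\in\mathcal{H}}\sigma(B)1_B$, and $H=L+V$. The subspaces $\mathcal{L}_+$, $\mathcal{L}_B$ ($B\in\mathcal{H}$) and $\mathcal{L}_-$ of $L^2(X,m)$ are invariant subspaces for both operators $H$ and $L$. Let $H_+,H_B,H_-$ (respectively $L_+,L_B,L_-$) be the restrictions of $H$ (respectively $L$) to $\mathcal{L}_+,\mathcal{L}_B,\mathcal{L}_-$. Then: (i) $H=H_+\oplus H_-$; (ii) $H_B=L_B+\sigma(B)$ for every $B\in\mathcal{H}$; (iii) $H_-=\bigoplus_{B\in\mathcal{H}}\big(L_B+\sigma(B)\big)$.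
   Context: Homogeneous ultrametric measure space: $(X,d)$ is a non-compact ultrametric space ($d(x,y)\le\max\{d(x,z),d(z,y)\}$) in which every closed ball $B_r(x)=\{y:d(x,y)\le r\}$ is compact and whose isometry group acts transitively; $m$ is a Radon measure on $X$ with full support, invariant under all isometries, normalized so that $m(B)=\mathrm{diam}(B)$ for every ball $B$ of positive diameter. $\mathcal{B}$ is the family of all distinct balls $B_r(x)$ with $r>0$, and $\mathcal{B}(x)$ the family of those containing $x$. $\mathcal{D}$ is the set of locally constant functions with compact support. Homogeneous hierarchical Laplacian: let $C:\mathcal{B}\to(0,\infty)$ satisfy $C(A)=C(B)$ whenever $A,B$ have the same diameter, and $\lambda(B):=\sum_{T\in\mathcal{B},\,B\subseteq T}C(T)<\infty$ for all $B$. For $f\in\mathcal{D}$, $$Lf(x)=\sum_{B\in\mathcal{B}(x)}C(B)\Big(f(x)-\frac1{m(B)}\int_B f\,dm\Big).$$ $L$ and $H=L+V$ are essentially self-adjoint on $\mathcal{D}$ in $L^2(X,m)$; the same letters denote their closures. A horocycle $\mathcal{H}\subset\mathcal{B}$ is the family of all balls of $\mathcal{B}$ having one fixed common diameter; it is a partition of $X$. For $T\in\mathcal{B}$ let $T'$ denote the smallest ball of $\mathcal{B}$ strictly containing $T$, and $f_T=\frac{1_T}{m(T)}-\frac{1_{T'}}{m(T')}$. With closed linear spans in $L^2(X,m)$: $\mathcal{L}_+=\mathrm{span}\{1_B:B\in\mathcal{H}\}$; $\mathcal{L}_B=\mathrm{span}\{f_T:T\in\mathcal{B},\ T\subsetneq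 B\}$ for $B\in\mathcal{H}$; $\mathcal{L}_-=L^2(X,m)\ominus\mathcal{L}_+=\bigoplus_{B\in\mathcal{H}}\mathcal{L}_B$. The restriction of an operator $A$ to a subspace $\mathcal{M}$ has domain $\mathrm{dom}(A)\cap\mathcal{M}$; $\mathcal M$ is invariant if $A$ maps $\mathrm{dom}(A)\cap\mathcal{M}$ into $\mathcal{M}$. *)

theory Defs
  imports "HOL-Analysis.Analysis"
begin

section \<open>The Hilbert space of square-integrable functions\<close>

text \<open>
  Elements of \<open>L\<^sup>2(X,m)\<close> are represented by measurable square-integrable functions
  \<open>X \<Rightarrow> complex\<close>. Subspaces and graphs of operators below are defined by means of
  \<open>L\<^sup>2\<close>-convergence; they are therefore unions of classes modulo almost everywhere equality,
  so equality of such sets is equality in the quotient.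
\<close>

definition L2 :: "'a measure \<Rightarrow> ('a \<Rightarrow> complex) set" where
  "L2 m = {f \<in> borel_measurable m. integrable m (\<lambda>x. (cmod (f x))\<^sup>2)}"

definition L2_norm :: "'a measure \<Rightarrow> ('a \<Rightarrow> complex) \<Rightarrow> real" where
  "L2_norm m f = sqrt (LINT x|m. (cmod (f x))\<^sup>2)"

definition L2_inner :: "'a measure \<Rightarrow> ('a \<Rightarrow> complex) \<Rightarrow> ('a \<Rightarrow> complex) \<Rightarrow> complex" where
  "L2_inner m f g = (LINT x|m. f x * cnj (g x))"

definition L2_tendsto ::
  "'a measure \<Rightarrow> ('i \<Rightarrow> 'a \<Rightarrow> complex) \<Rightarrow> ('a \<Rightarrow> complex) \<Rightarrow> 'i filter \<Rightarrow> bool" where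
  "L2_tendsto m u f F \<longleftrightarrow> f \<in> L2 m \<and> (\<forall>\<^sub>F i in F. u i \<in> L2 m) \<and>
     ((\<lambda>i. L2_norm m (\<lambda>x. u i x - f x)) \<longlongrightarrow> 0) F"

text \<open>Unconditional convergence of a series, as in \<^const>\<open>has_sum\<close>.\<close>

definition L2_has_sum ::
  "'a measure \<Rightarrow> ('i \<Rightarrow> 'a \<Rightarrow> complex) \<Rightarrow> 'i set \<Rightarrow> ('a \<Rightarrow> complex) \<Rightarrow> bool" where
  "L2_has_sum m u I f \<longleftrightarrow> L2_tendsto m (\<lambda>F x. \<Sum>i\<in>F. u i x) f (finite_subsets_at_top I)"

definition complex_span :: "('a \<Rightarrow> complex) set \<Rightarrow> ('a \<Rightarrow> complex) set" where
  "complex_span S = {\<lambda>x. \<Sum>s\<in>F. c s * s x | F c. finite F \<and> F \<subseteq> S}"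

definition closed_span :: "'a measure \<Rightarrow> ('a \<Rightarrow> complex) set \<Rightarrow> ('a \<Rightarrow> complex) set" where
  "closed_span m S =
     {f. \<exists>u :: nat \<Rightarrow> 'a \<Rightarrow> complex. (\<forall>n. u n \<in> complex_span S) \<and> L2_tendsto m u f sequentially}"

definition orth_complement :: "'a measure \<Rightarrow> ('a \<Rightarrow> complex) set \<Rightarrow> ('a \<Rightarrow> complex) set" where
  "orth_complement m M = {f \<in> L2 m. \<forall>g\<in>M. L2_inner m f g = 0}"

definition L2_direct_sum ::
  "'a measure \<Rightarrow> ('a \<Rightarrow> complex) set \<Rightarrow> 'i set \<Rightarrow> ('i \<Rightarrow> ('a \<Rightarrow> complex) set) \<Rightarrow> bool" where
  "L2_direct_sum m M I N \<longleftrightarrow>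
     (\<forall>i\<in>I. \<forall>j\<in>I. i \<noteq> j \<longrightarrow> (\<forall>f\<in>N i. \<forall>g\<in>N j. L2_inner m f g = 0)) \<and>
     M = {f. \<exists>u. (\<forall>i\<in>I. u i \<in> N i) \<and> L2_has_sum m u I f}"


section \<open>Unbounded operators as graphs\<close>

type_synonym 'a operator = "(('a \<Rightarrow> complex) \<times> ('a \<Rightarrow> complex)) set"

definition op_closure :: "'a measure \<Rightarrow> 'a operator \<Rightarrow> 'a operator" where
  "op_closure m A = {(f, g). \<exists>(u :: nat \<Rightarrow> 'a \<Rightarrow> complex) v. (\<forall>n. (u n, v n) \<in> A) \<and>
     L2_tendsto m u f sequentially \<and> L2_tendsto m v g sequentially}"

definition op_restrict :: "'a operator \<Rightarrow> ('a \<Rightarrow> complex) set \<Rightarrow> 'a operator" where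
  "op_restrict A M = {(f, g) \<in> A. f \<in> M}"

definition invariant_subspace :: "'a operator \<Rightarrow> ('a \<Rightarrow> complex) set \<Rightarrow> bool" where
  "invariant_subspace A M \<longleftrightarrow> (\<forall>(f, g) \<in> A. f \<in> M \<longrightarrow> g \<in> M)"

definition op_add_scalar :: "'a operator \<Rightarrow> complex \<Rightarrow> 'a operator" where
  "op_add_scalar A c = {(f, \<lambda>x. g x + c * f x) | f g. (f, g) \<in> A}"

text \<open>
  The operator \<open>A\<close> in the space \<open>M\<close> is the orthogonal direct sum of the operators
  \<open>B i\<close> in the spaces \<open>N i\<close>. By orthogonality, convergence of the two series says
  that the squared norms of the \<open>u i\<close> and of their images \<open>v i\<close> are summable.
\<close>

definition op_direct_sum ::
  "'a measure \<Rightarrow> ('a \<Rightarrow> complex) set \<Rightarrow> 'a operator \<Rightarrow>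
   'i set \<Rightarrow> ('i \<Rightarrow> ('a \<Rightarrow> complex) set) \<Rightarrow> ('i \<Rightarrow> 'a operator) \<Rightarrow> bool" where
  "op_direct_sum m M A I N B \<longleftrightarrow>
     L2_direct_sum m M I N \<and> (\<forall>i\<in>I. B i \<subseteq> N i \<times> N i) \<and>
     A = {(f, g). \<exists>u v. (\<forall>i\<in>I. (u i, v i) \<in> B i) \<and> L2_has_sum m u I f \<and> L2_has_sum m v I g}"


section \<open>Homogeneous ultrametric measure spaces\<close>

definition isometries :: "('a::metric_space \<Rightarrow> 'a) set" where
  "isometries = {g. bij g \<and> (\<forall>x y. dist (g x) (g y) = dist x y)}"

definition balls :: "'a::metric_space set set" where
  "balls = {cball x r | x r. r > 0}"

definition radon_measure :: "'a::metric_space measure \<Rightarrow> bool" where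
  "radon_measure m \<longleftrightarrow> sets m = sets borel \<and>
     (\<forall>K. compact K \<longrightarrow> emeasure m K < \<infinity>) \<and>
     (\<forall>A\<in>sets m. emeasure m A = (INF U\<in>{U. open U \<and> A \<subseteq> U}. emeasure m U)) \<and>
     (\<forall>U. open U \<longrightarrow> emeasure m U = (SUP K\<in>{K. compact K \<and> K \<subseteq> U}. emeasure m K))"

locale homogeneous_ultrametric_measure_space =
  fixes m :: "'a::metric_space measure"
  assumes ultrametric: "dist x y \<le> max (dist x z) (dist z (y::'a))"
    and noncompact: "\<not> compact (UNIV :: 'a set)"
    and compact_cball: "compact (cball (x::'a) r)"
    and transitive: "\<exists>g\<in>isometries. g x = (y::'a)"
    and radon: "radon_measure m"
    and full_support: "open U \<Longrightarrow> U \<noteq> {} \<Longrightarrow> emeasure m U > 0"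
    and invariant: "g \<in> isometries \<Longrightarrow> A \<in> sets m \<Longrightarrow> emeasure m (g ` A) = emeasure m A"
    and normalized: "B \<in> balls \<Longrightarrow> diameter B > 0 \<Longrightarrow> emeasure m B = ennreal (diameter B)"

definition horocycle :: "'a::metric_space set set \<Rightarrow> bool" where
  "horocycle \<H> \<longleftrightarrow> \<H> \<noteq> {} \<and> (\<exists>d. \<H> = {B\<in>balls. diameter B = d})"

definition test_functions :: "('a::metric_space \<Rightarrow> complex) set" where
  "test_functions = {f. (\<forall>x. \<exists>U. open U \<and> x \<in> U \<and> f constant_on U) \<and>
     compact (closure {x. f x \<noteq> 0})}"


section \<open>The hierarchical Laplacian and Schroedinger operator\<close>

text \<open>The weights are positive, so summability expresses finiteness of \<open>\<lambda>(B)\<close>.\<close>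

definition homogeneous_weights :: "('a::metric_space set \<Rightarrow> real) \<Rightarrow> bool" where
  "homogeneous_weights C \<longleftrightarrow> (\<forall>B\<in>balls. C B > 0) \<and>
     (\<forall>A\<in>balls. \<forall>B\<in>balls. diameter A = diameter B \<longrightarrow> C A = C B) \<and>
     (\<forall>B\<in>balls. C summable_on {T\<in>balls. B \<subseteq> T})"

definition laplacian_fun ::
  "'a::metric_space measure \<Rightarrow> ('a set \<Rightarrow> real) \<Rightarrow> ('a \<Rightarrow> complex) \<Rightarrow> 'a \<Rightarrow> complex" where
  "laplacian_fun m C f x = (\<Sum>\<^sub>\<infinity>B\<in>{B\<in>balls. x \<in> B}.
     of_real (C B) * (f x - (LINT y:B|m. f y) / of_real (measure m B)))"

definition potential :: "'a set set \<Rightarrow> ('a set \<Rightarrow> real) \<Rightarrow> 'a \<Rightarrow> real" where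
  "potential \<H> \<sigma> x = (\<Sum>\<^sub>\<infinity>B\<in>\<H>. \<sigma> B * indicator B x)"

definition hierarchical_laplacian ::
  "'a::metric_space measure \<Rightarrow> ('a set \<Rightarrow> real) \<Rightarrow> 'a operator" where
  "hierarchical_laplacian m C = op_closure m {(f, laplacian_fun m C f) | f. f \<in> test_functions}"

definition hierarchical_schroedinger ::
  "'a::metric_space measure \<Rightarrow> ('a set \<Rightarrow> real) \<Rightarrow> ('a \<Rightarrow> real) \<Rightarrow> 'a operator" where
  "hierarchical_schroedinger m C V = op_closure m
     {(f, \<lambda>x. laplacian_fun m C f x + of_real (V x) * f x) | f. f \<in> test_functions}"


section \<open>Subspaces attached to a horocycle\<close>

definition parent_ball :: "'a::metric_space set \<Rightarrow> 'a set" where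
  "parent_ball T = (THE S. S \<in> balls \<and> T \<subset> S \<and> (\<forall>U\<in>balls. T \<subset> U \<longrightarrow> S \<subseteq> U))"

definition f_ball :: "'a::metric_space measure \<Rightarrow> 'a set \<Rightarrow> 'a \<Rightarrow> complex" where
  "f_ball m T x = indicator T x / of_real (measure m T)
     - indicator (parent_ball T) x / of_real (measure m (parent_ball T))"

definition L_plus :: "'a::metric_space measure \<Rightarrow> 'a set set \<Rightarrow> ('a \<Rightarrow> complex) set" where
  "L_plus m \<H> = closed_span m {indicator B | B. B \<in> \<H>}"

definition L_ball :: "'a::metric_space measure \<Rightarrow> 'a set \<Rightarrow> ('a \<Rightarrow> complex) set" where
  "L_ball m B = closed_span m {f_ball m T | T. T \<in> balls \<and> T \<subset> B}"

definition L_minus :: "'a::metric_space measure \<Rightarrow> 'a set set \<Rightarrow> ('a \<Rightarrow> complex) set" where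
  "L_minus m \<H> = orth_complement m (L_plus m \<H>)"

end

theory Submission
  imports Defs
begin

text \<open>
  All balls of the horocycle have one common radius \<open>r\<close>. Two kinds of bounded maps carry the proof:
  averaging over the balls of radius \<open>r\<close>, written \<open>P = ball_avg m r\<close>, and for every ball \<open>B\<close> of the
  horocycle the map \<open>Q\<^sub>B f = 1\<^sub>B (f - P f)\<close>, written \<open>fluctuation m r B\<close>. The subspace \<open>L_plus\<close> is the
  range of \<open>P\<close>, \<open>L_minus\<close> is its kernel and \<open>L_ball m B\<close> is the range of \<open>Q\<^sub>B\<close>
  (\<open>L_plus_iff\<close>, \<open>L_minus_iff\<close>, \<open>L_ball_iff\<close>). The inclusions of these ranges in the closed spans
  hold because test functions are dense in \<open>L\<^sup>2\<close> and because \<open>P u\<close> and \<open>Q\<^sub>B u\<close> lie in the algebraic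
  spans when \<open>u\<close> is a test function.

  By homogeneity the Laplacian is \<open>L u = \<Sum>\<^sub>\<rho> C\<^sub>\<rho> (u - A\<^sub>\<rho> u)\<close>, where \<open>\<rho>\<close> runs through the diameters
  of balls, \<open>A\<^sub>\<rho>\<close> averages over balls of radius \<open>\<rho>\<close> and the coefficient \<open>C\<^sub>\<rho>\<close> is the same at all points.
  The averaging maps commute with each other, and the potential is constant on the balls of radius \<open>r\<close>.
  Therefore \<open>P\<close> and \<open>Q\<^sub>B\<close> map test functions to test functions and commute with \<open>L + V\<close> there
  (\<open>ball_avg_schroedinger\<close>, \<open>fluctuation_schroedinger\<close>). A bounded map that commutes with an
  operator commutes with its closure, so \<open>(f, g) \<in> H\<close> implies \<open>(P f, P g) \<in> H\<close> and
  \<open>(Q\<^sub>B f, Q\<^sub>B g) \<in> H\<close>.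

  Invariance requires in addition that the closure be single-valued: if \<open>f = Q\<^sub>B f\<close>, then both
  \<open>(f, g)\<close> and \<open>(f, Q\<^sub>B g)\<close> lie in \<open>H\<close>, and one needs \<open>g = Q\<^sub>B g\<close>. This is
  \<open>schroedinger_op_single_valued\<close>. Since \<open>f\<^sub>T\<close> is an eigenfunction of \<open>L\<close> and \<open>V\<close> is bounded on every
  ball, pairing \<open>(L + V) u\<close> with \<open>f\<^sub>T\<close> is bounded by a multiple of the norm of \<open>u\<close>. So if
  \<open>(0, g) \<in> H\<close>, then \<open>g\<close> is orthogonal to every \<open>f\<^sub>T\<close>, that is, \<open>g\<close> has the same mean on a ball
  and on its parent. The means over growing balls tend to zero because the measure of the
  balls tends to infinity; hence all means vanish and \<open>g = 0\<close>.

  Statement (i) is now the decomposition of a pair \<open>(f, g) \<in> H\<close> into \<open>(P f, P g)\<close> and the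
  remainder. For (ii), on functions vanishing outside \<open>B\<close> the operators with potentials \<open>\<sigma>\<close> and
  \<open>0\<close> differ by the scalar \<open>\<sigma> B\<close>, and this survives the closure (\<open>schroedinger_op_shift\<close>).
  For (iii), \<open>f = \<Sum>\<^sub>B Q\<^sub>B f\<close> unconditionally for \<open>f\<close> in \<open>L_minus\<close> (\<open>fluctuation_has_sum\<close>);
  conversely a sum of pairs in \<open>H\<close> that converges in both components lies in \<open>H\<close>, which is closed.
\<close>

section \<open>Square-integrable functions\<close>

lemma L2I: "f \<in> borel_measurable m \<Longrightarrow> integrable m (\<lambda>x. (cmod (f x))\<^sup>2) \<Longrightarrow> f \<in> L2 m"
  by (simp add: L2_def)

lemma L2_measurable [measurable_dest]: "f \<in> L2 m \<Longrightarrow> f \<in> borel_measurable m"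
  by (simp add: L2_def)

lemma L2_integrable_square: "f \<in> L2 m \<Longrightarrow> integrable m (\<lambda>x. (cmod (f x))\<^sup>2)"
  by (simp add: L2_def)

lemma L2_bound:
  assumes "f \<in> L2 m" "g \<in> borel_measurable m" "\<And>x. cmod (g x) \<le> c * cmod (f x)"
  shows "g \<in> L2 m"
proof (rule L2I)
  have [measurable]: "g \<in> borel_measurable m" by fact
  show "integrable m (\<lambda>x. (cmod (g x))\<^sup>2)"
  proof (rule Bochner_Integration.integrable_bound)
    show "integrable m (\<lambda>x. c\<^sup>2 * (cmod (f x))\<^sup>2)"
      using assms(1) by (simp add: L2_integrable_square)
    show "AE x in m. norm ((cmod (g x))\<^sup>2) \<le> norm (c\<^sup>2 * (cmod (f x))\<^sup>2)"
      using power_mono[OF assms(3) norm_ge_zero, of _ 2] by (simp add: power_mult_distrib)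
  qed measurable
qed fact

lemma L2_zero [simp]: "(\<lambda>x. 0) \<in> L2 m"
  by (simp add: L2_def)

lemma L2_scale: "f \<in> L2 m \<Longrightarrow> (\<lambda>x. c * f x) \<in> L2 m"
  by (rule L2_bound[where f = f and c = "cmod c"]) (auto simp: norm_mult L2_def)

lemma L2_add:
  assumes "f \<in> L2 m" "g \<in> L2 m"
  shows "(\<lambda>x. f x + g x) \<in> L2 m"
proof (rule L2I)
  have [measurable]: "f \<in> borel_measurable m" "g \<in> borel_measurable m"
    using assms by (auto simp: L2_def)
  show "(\<lambda>x. f x + g x) \<in> borel_measurable m" by measurable
  show "integrable m (\<lambda>x. (cmod (f x + g x))\<^sup>2)"
  proof (rule Bochner_Integration.integrable_bound)
    show "integrable m (\<lambda>x. 2 * (cmod (f x))\<^sup>2 + 2 * (cmod (g x))\<^sup>2)"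
      using assms by (simp add: L2_integrable_square)
    have "(cmod (f x + g x))\<^sup>2 \<le> 2 * (cmod (f x))\<^sup>2 + 2 * (cmod (g x))\<^sup>2" for x
    proof -
      have "(cmod (f x + g x))\<^sup>2 \<le> (cmod (f x) + cmod (g x))\<^sup>2"
        by (intro power_mono norm_triangle_ineq norm_ge_zero)
      also have "\<dots> \<le> 2 * (cmod (f x))\<^sup>2 + 2 * (cmod (g x))\<^sup>2"
        using sum_squares_bound[of "cmod (f x)" "cmod (g x)"] by (simp add: power2_sum)
      finally show ?thesis .
    qed
    then show "AE x in m. norm ((cmod (f x + g x))\<^sup>2)
        \<le> norm (2 * (cmod (f x))\<^sup>2 + 2 * (cmod (g x))\<^sup>2)"
      by simp
  qed measurable
qed

lemma L2_diff: "f \<in> L2 m \<Longrightarrow> g \<in> L2 m \<Longrightarrow> (\<lambda>x. f x - g x) \<in> L2 m"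
  using L2_add[of f m "\<lambda>x. (-1) * g x"] L2_scale[of g m "-1"] by simp

lemma L2_sum: "(\<And>i. i \<in> F \<Longrightarrow> u i \<in> L2 m) \<Longrightarrow> (\<lambda>x. \<Sum>i\<in>F. u i x) \<in> L2 m"
  by (induction F rule: infinite_finite_induct) (auto intro: L2_add)

lemma L2_indicator_mult:
  assumes "f \<in> L2 m" "A \<in> sets m"
  shows "(\<lambda>x. indicator A x * f x) \<in> L2 m"
proof (rule L2_bound[OF assms(1), where c = 1])
  show "(\<lambda>x. indicator A x * f x) \<in> borel_measurable m"
    using assms by (auto simp: L2_def)
qed (auto simp: indicator_def)

lemma L2_indicator:
  assumes "A \<in> sets m" "emeasure m A < \<infinity>"
  shows "(indicator A :: 'a \<Rightarrow> complex) \<in> L2 m"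
proof (rule L2I)
  have "(cmod (indicator A x))\<^sup>2 = (indicator A x :: real)" for x :: 'a
    by (auto simp: indicator_def)
  then show "integrable m (\<lambda>x. (cmod (indicator A x))\<^sup>2)"
    using assms by (simp add: integrable_real_indicator)
qed (use assms in auto)

lemma L2_AE_cong:
  assumes "f \<in> L2 m" "g \<in> borel_measurable m" "AE x in m. f x = g x"
  shows "g \<in> L2 m"
proof (rule L2I)
  have [measurable]: "f \<in> borel_measurable m" "g \<in> borel_measurable m"
    using assms by (auto simp: L2_def)
  show "integrable m (\<lambda>x. (cmod (g x))\<^sup>2)"
    by (subst integrable_cong_AE[where g = "\<lambda>x. (cmod (f x))\<^sup>2"])
      (use assms in \<open>auto simp: L2_integrable_square\<close>)
qed fact

lemma L2_norm_nonneg [simp]: "0 \<le> L2_norm m f"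
  by (simp add: L2_norm_def)

lemma L2_norm_power2: "(L2_norm m f)\<^sup>2 = (LINT x|m. (cmod (f x))\<^sup>2)"
  by (simp add: L2_norm_def)

lemma L2_norm_zero [simp]: "L2_norm m (\<lambda>x. 0) = 0"
  by (simp add: L2_norm_def)

lemma L2_norm_scale: "L2_norm m (\<lambda>x. c * f x) = cmod c * L2_norm m f"
  by (simp add: L2_norm_def norm_mult power_mult_distrib real_sqrt_mult)

lemma L2_norm_minus_commute: "L2_norm m (\<lambda>x. f x - g x) = L2_norm m (\<lambda>x. g x - f x)"
  by (simp add: L2_norm_def norm_minus_commute)

lemma L2_norm_eq_0_iff:
  assumes "f \<in> L2 m"
  shows "L2_norm m f = 0 \<longleftrightarrow> (AE x in m. f x = 0)"
  using integral_nonneg_eq_0_iff_AE[OF L2_integrable_square[OF assms]]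
  by (simp add: L2_norm_def)

lemma L2_norm_mono:
  assumes "g \<in> L2 m" "f \<in> borel_measurable m" "\<And>x. cmod (f x) \<le> cmod (g x)"
  shows "L2_norm m f \<le> L2_norm m g"
proof -
  have f: "f \<in> L2 m" using L2_bound[of g m f 1] assms by simp
  show ?thesis
    unfolding L2_norm_def
    by (intro real_sqrt_le_mono integral_mono L2_integrable_square f assms power_mono) auto
qed

text \<open>The discriminant of the nonnegative polynomial \<open>t \<mapsto> \<integral> (t a - b)\<^sup>2\<close>.\<close>

lemma integral_Cauchy_Schwarz:
  fixes a b :: "'a \<Rightarrow> real"
  assumes a: "integrable m (\<lambda>x. (a x)\<^sup>2)" and b: "integrable m (\<lambda>x. (b x)\<^sup>2)"
    and ab: "integrable m (\<lambda>x. a x * b x)"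
  shows "(LINT x|m. a x * b x)\<^sup>2 \<le> (LINT x|m. (a x)\<^sup>2) * (LINT x|m. (b x)\<^sup>2)"
proof -
  define A B C where "A = (LINT x|m. (a x)\<^sup>2)" and "B = (LINT x|m. (b x)\<^sup>2)"
    and "C = (LINT x|m. a x * b x)"
  have pos: "0 \<le> t\<^sup>2 * A - 2 * t * C + B" for t
  proof -
    have "0 \<le> (LINT x|m. (t * a x - b x)\<^sup>2)" by simp
    also have "(\<lambda>x. (t * a x - b x)\<^sup>2) = (\<lambda>x. t\<^sup>2 * (a x)\<^sup>2 - 2 * t * (a x * b x) + (b x)\<^sup>2)"
      by (auto simp: power2_eq_square algebra_simps)
    also have "(LINT x|m. t\<^sup>2 * (a x)\<^sup>2 - 2 * t * (a x * b x) + (b x)\<^sup>2) = t\<^sup>2 * A - 2 * t * C + B"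
      using a b ab by (simp add: A_def B_def C_def)
    finally show ?thesis .
  qed
  have "C\<^sup>2 \<le> A * B"
  proof (cases "A = 0")
    case True
    have "C = 0"
    proof (rule ccontr)
      assume "C \<noteq> 0"
      then show False using pos[of "(B + 1) / (2 * C)"] True by simp
    qed
    then show ?thesis using True by simp
  next
    case False
    moreover have "0 \<le> A" by (simp add: A_def)
    ultimately have "0 < A" by simp
    with pos[of "C / A"] show ?thesis by (simp add: field_simps power2_eq_square)
  qed
  then show ?thesis by (simp add: A_def B_def C_def)
qed

lemma L2_integrable_norm_mult:
  assumes "f \<in> L2 m" "g \<in> L2 m"
  shows "integrable m (\<lambda>x. cmod (f x) * cmod (g x))"
proof (rule Bochner_Integration.integrable_bound)
  have [measurable]: "f \<in> borel_measurable m" "g \<in> borel_measurable m"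
    using assms by (auto simp: L2_def)
  show "integrable m (\<lambda>x. (cmod (f x))\<^sup>2 + (cmod (g x))\<^sup>2)"
    using assms by (simp add: L2_integrable_square)
  have "cmod (f x) * cmod (g x) \<le> (cmod (f x))\<^sup>2 + (cmod (g x))\<^sup>2" for x
  proof -
    have "0 \<le> cmod (f x) * cmod (g x)" by simp
    with sum_squares_bound[of "cmod (f x)" "cmod (g x)"] show ?thesis by linarith
  qed
  then show "AE x in m. norm (cmod (f x) * cmod (g x)) \<le> norm ((cmod (f x))\<^sup>2 + (cmod (g x))\<^sup>2)"
    by simp
  show "(\<lambda>x. cmod (f x) * cmod (g x)) \<in> borel_measurable m" by measurable
qed

lemma L2_integral_norm_mult_le:
  assumes "f \<in> L2 m" "g \<in> L2 m"
  shows "(LINT x|m. cmod (f x) * cmod (g x)) \<le> L2_norm m f * L2_norm m g"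
proof (rule power2_le_imp_le)
  show "(LINT x|m. cmod (f x) * cmod (g x))\<^sup>2 \<le> (L2_norm m f * L2_norm m g)\<^sup>2"
    unfolding power_mult_distrib L2_norm_power2
    by (intro integral_Cauchy_Schwarz L2_integrable_square L2_integrable_norm_mult assms)
qed simp

lemma L2_integrable_inner:
  assumes "f \<in> L2 m" "g \<in> L2 m"
  shows "integrable m (\<lambda>x. f x * cnj (g x))"
proof (rule Bochner_Integration.integrable_bound[OF L2_integrable_norm_mult[OF assms]])
  show "(\<lambda>x. f x * cnj (g x)) \<in> borel_measurable m"
    using assms by (auto simp: L2_def intro!: borel_measurable_times
      borel_measurable_continuous_on[of cnj] continuous_intros)
qed (auto simp: norm_mult)

lemma L2_Cauchy_Schwarz:
  assumes "f \<in> L2 m" "g \<in> L2 m"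
  shows "cmod (L2_inner m f g) \<le> L2_norm m f * L2_norm m g"
proof -
  have "cmod (L2_inner m f g) \<le> (LINT x|m. cmod (f x * cnj (g x)))"
    unfolding L2_inner_def by (rule integral_norm_bound)
  also have "\<dots> = (LINT x|m. cmod (f x) * cmod (g x))" by (simp add: norm_mult)
  finally show ?thesis using L2_integral_norm_mult_le[OF assms] by simp
qed

lemma L2_norm_triangle:
  assumes "f \<in> L2 m" "g \<in> L2 m"
  shows "L2_norm m (\<lambda>x. f x + g x) \<le> L2_norm m f + L2_norm m g"
proof (rule power2_le_imp_le)
  have "(LINT x|m. (cmod (f x + g x))\<^sup>2)
      \<le> (LINT x|m. (cmod (f x))\<^sup>2 + 2 * (cmod (f x) * cmod (g x)) + (cmod (g x))\<^sup>2)"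
  proof (intro integral_mono)
    fix x
    have "(cmod (f x + g x))\<^sup>2 \<le> (cmod (f x) + cmod (g x))\<^sup>2"
      by (intro power_mono norm_triangle_ineq norm_ge_zero)
    then show "(cmod (f x + g x))\<^sup>2 \<le> (cmod (f x))\<^sup>2 + 2 * (cmod (f x) * cmod (g x)) + (cmod (g x))\<^sup>2"
      by (simp add: power2_sum)
  qed (use assms in \<open>simp_all add: L2_integrable_square L2_integrable_norm_mult L2_add\<close>)
  also have "\<dots> = (L2_norm m f)\<^sup>2 + 2 * (LINT x|m. cmod (f x) * cmod (g x)) + (L2_norm m g)\<^sup>2"
    using assms by (simp add: L2_integrable_square L2_integrable_norm_mult L2_norm_power2)
  also have "\<dots> \<le> (L2_norm m f + L2_norm m g)\<^sup>2"
    using L2_integral_norm_mult_le[OF assms] by (simp add: power2_sum)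
  finally show "(L2_norm m (\<lambda>x. f x + g x))\<^sup>2 \<le> (L2_norm m f + L2_norm m g)\<^sup>2"
    by (simp add: L2_norm_power2)
qed simp

lemma L2_norm_triangle_diff:
  assumes "f \<in> L2 m" "g \<in> L2 m" "h \<in> L2 m"
  shows "L2_norm m (\<lambda>x. f x - h x) \<le> L2_norm m (\<lambda>x. f x - g x) + L2_norm m (\<lambda>x. g x - h x)"
  using L2_norm_triangle[OF L2_diff[OF assms(1,2)] L2_diff[OF assms(2,3)]] by simp

lemma L2_norm_comb_le:
  assumes "f \<in> L2 m" "f' \<in> L2 m" "g \<in> L2 m" "g' \<in> L2 m"
  shows "L2_norm m (\<lambda>x. (f x + c * g x) - (f' x + c * g' x))
    \<le> L2_norm m (\<lambda>x. f x - f' x) + cmod c * L2_norm m (\<lambda>x. g x - g' x)"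
proof -
  have "(\<lambda>x. (f x + c * g x) - (f' x + c * g' x)) = (\<lambda>x. (f x - f' x) + c * (g x - g' x))"
    by (auto simp: algebra_simps)
  then show ?thesis
    using L2_norm_triangle[OF L2_diff[OF assms(1,2)] L2_scale[OF L2_diff[OF assms(3,4)], of c]]
    by (simp add: L2_norm_scale)
qed

lemma L2_inner_diff_left:
  assumes "f \<in> L2 m" "g \<in> L2 m" "h \<in> L2 m"
  shows "L2_inner m (\<lambda>x. f x - g x) h = L2_inner m f h - L2_inner m g h"
  using assms unfolding L2_inner_def
  by (simp add: left_diff_distrib L2_integrable_inner)

lemma L2_inner_comb_right:
  assumes "f \<in> L2 m" "u \<in> L2 m" "v \<in> L2 m"
  shows "L2_inner m f (\<lambda>x. u x + c * v x) = L2_inner m f u + cnj c * L2_inner m f v"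
proof -
  have "L2_inner m f (\<lambda>x. u x + c * v x) = (LINT x|m. f x * cnj (u x) + cnj c * (f x * cnj (v x)))"
    unfolding L2_inner_def by (simp add: algebra_simps)
  also have "\<dots> = L2_inner m f u + cnj c * L2_inner m f v"
    unfolding L2_inner_def
    by (subst Bochner_Integration.integral_add) (simp_all add: assms L2_integrable_inner)
  finally show ?thesis .
qed

lemma L2_inner_commute: "L2_inner m g f = cnj (L2_inner m f g)"
  unfolding L2_inner_def by (subst Bochner_Integration.integral_cnj[symmetric]) (simp add: mult.commute)

lemma L2_inner_self: "L2_inner m f f = of_real ((L2_norm m f)\<^sup>2)"
  unfolding L2_inner_def L2_norm_power2
  by (simp only: complex_norm_square[symmetric] integral_complex_of_real)

section \<open>Closures in the square norm\<close>

text \<open>The \<open>\<epsilon>\<close>-form of \<open>closed_span\<close>: the sequence is replaced by a single approximation.\<close>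

definition L2_closure :: "'a measure \<Rightarrow> ('a \<Rightarrow> complex) set \<Rightarrow> ('a \<Rightarrow> complex) set" where
  "L2_closure m S =
     {f \<in> L2 m. \<forall>\<epsilon>>0. \<exists>u\<in>S. u \<in> L2 m \<and> L2_norm m (\<lambda>x. u x - f x) < \<epsilon>}"

lemma L2_closureE:
  assumes "f \<in> L2_closure m S" "\<epsilon> > 0"
  obtains u where "u \<in> S" "u \<in> L2 m" "L2_norm m (\<lambda>x. u x - f x) < \<epsilon>"
  using assms unfolding L2_closure_def by blast

lemma L2_tendsto_approx:
  assumes "L2_tendsto m u f F" "\<epsilon> > 0"
  shows "\<forall>\<^sub>F i in F. u i \<in> L2 m \<and> L2_norm m (\<lambda>x. u i x - f x) < \<epsilon>"
proof -
  have "((\<lambda>i. L2_norm m (\<lambda>x. u i x - f x)) \<longlongrightarrow> 0) F" "\<forall>\<^sub>F i in F. u i \<in> L2 m"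
    using assms by (auto simp: L2_tendsto_def)
  then show ?thesis
    using order_tendstoD(2)[of "\<lambda>i. L2_norm m (\<lambda>x. u i x - f x)" 0 F \<epsilon>] assms(2)
    by (simp add: eventually_conj)
qed

lemma L2_tendstoI:
  assumes "f \<in> L2 m" "\<And>\<epsilon>. \<epsilon> > 0 \<Longrightarrow> \<forall>\<^sub>F i in F. u i \<in> L2 m \<and> L2_norm m (\<lambda>x. u i x - f x) < \<epsilon>"
  shows "L2_tendsto m u f F"
  unfolding L2_tendsto_def
proof (intro conjI)
  show "\<forall>\<^sub>F i in F. u i \<in> L2 m" using assms(2)[of 1] by (auto elim: eventually_mono)
  show "((\<lambda>i. L2_norm m (\<lambda>x. u i x - f x)) \<longlongrightarrow> 0) F"
  proof (rule tendstoI)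
    fix e :: real assume "e > 0"
    from assms(2)[OF this] show "\<forall>\<^sub>F i in F. dist (L2_norm m (\<lambda>x. u i x - f x)) 0 < e"
      by (auto elim: eventually_mono)
  qed
qed fact

lemma L2_tendsto_inverse_SucI:
  assumes "f \<in> L2 m" "\<And>n. u n \<in> L2 m" "\<And>n. L2_norm m (\<lambda>x. u n x - f x) < inverse (real (Suc n))"
  shows "L2_tendsto m u f sequentially"
  unfolding L2_tendsto_def
proof (intro conjI)
  show "(\<lambda>n. L2_norm m (\<lambda>x. u n x - f x)) \<longlonglongrightarrow> 0"
    by (rule tendsto_sandwich[OF _ _ tendsto_const LIMSEQ_inverse_real_of_nat])
      (auto intro!: always_eventually less_imp_le assms(3) simp del: of_nat_Suc)
qed (use assms in auto)

lemma closed_span_eq: "closed_span m S = L2_closure m (complex_span S)"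
proof (intro subset_antisym subsetI)
  fix f assume "f \<in> closed_span m S"
  then obtain u where u: "\<And>n::nat. u n \<in> complex_span S" "L2_tendsto m u f sequentially"
    by (auto simp: closed_span_def)
  show "f \<in> L2_closure m (complex_span S)"
    unfolding L2_closure_def
  proof (intro CollectI conjI allI impI)
    show "f \<in> L2 m" using u by (simp add: L2_tendsto_def)
    fix \<epsilon> :: real assume "\<epsilon> > 0"
    from L2_tendsto_approx[OF u(2) this] show "\<exists>v\<in>complex_span S. v \<in> L2 m \<and> L2_norm m (\<lambda>x. v x - f x) < \<epsilon>"
      using u(1) by (auto dest!: eventually_happens)
  qed
next
  fix f assume f: "f \<in> L2_closure m (complex_span S)"
  have "\<forall>n. \<exists>v. v \<in> complex_span S \<and> v \<in> L2 m \<and> L2_norm m (\<lambda>x. v x - f x) < inverse (real (Suc n))"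
    using L2_closureE[OF f, of "inverse (real (Suc n))" for n] by (metis inverse_Suc)
  then obtain u where u: "\<And>n. u n \<in> complex_span S" "\<And>n. u n \<in> L2 m"
      "\<And>n. L2_norm m (\<lambda>x. u n x - f x) < inverse (real (Suc n))"
    by metis
  have "L2_tendsto m u f sequentially"
    using f u by (intro L2_tendsto_inverse_SucI) (auto simp: L2_closure_def)
  with u(1) show "f \<in> closed_span m S" by (auto simp: closed_span_def)
qed

text \<open>Unlike sequences, this form passes to closures of closures without a diagonal argument.\<close>

lemma op_closure_iff:
  "(f, g) \<in> op_closure m A \<longleftrightarrow> f \<in> L2 m \<and> g \<in> L2 m \<and>
     (\<forall>\<epsilon>>0. \<exists>u v. (u, v) \<in> A \<and> u \<in> L2 m \<and> v \<in> L2 m \<and>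
        L2_norm m (\<lambda>x. u x - f x) < \<epsilon> \<and> L2_norm m (\<lambda>x. v x - g x) < \<epsilon>)" (is "?L \<longleftrightarrow> ?R")
proof
  assume ?L
  then obtain u v where uv: "\<And>n::nat. (u n, v n) \<in> A" "L2_tendsto m u f sequentially"
      "L2_tendsto m v g sequentially"
    by (auto simp: op_closure_def)
  show ?R
  proof (intro conjI allI impI)
    show "f \<in> L2 m" "g \<in> L2 m" using uv by (auto simp: L2_tendsto_def)
    fix \<epsilon> :: real assume "\<epsilon> > 0"
    from L2_tendsto_approx[OF uv(2) this] L2_tendsto_approx[OF uv(3) this]
    have "\<forall>\<^sub>F n in sequentially. (u n \<in> L2 m \<and> L2_norm m (\<lambda>x. u n x - f x) < \<epsilon>) \<and>
        (v n \<in> L2 m \<and> L2_norm m (\<lambda>x. v n x - g x) < \<epsilon>)"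
      by (rule eventually_conj)
    then obtain n where "(u n \<in> L2 m \<and> L2_norm m (\<lambda>x. u n x - f x) < \<epsilon>) \<and>
        (v n \<in> L2 m \<and> L2_norm m (\<lambda>x. v n x - g x) < \<epsilon>)"
      by (auto dest!: eventually_happens)
    with uv(1) show "\<exists>u v. (u, v) \<in> A \<and> u \<in> L2 m \<and> v \<in> L2 m \<and>
        L2_norm m (\<lambda>x. u x - f x) < \<epsilon> \<and> L2_norm m (\<lambda>x. v x - g x) < \<epsilon>"
      by blast
  qed
next
  assume R: ?R
  have "\<exists>u v. (u, v) \<in> A \<and> u \<in> L2 m \<and> v \<in> L2 m \<and>
        L2_norm m (\<lambda>x. u x - f x) < inverse (real (Suc n)) \<and>
        L2_norm m (\<lambda>x. v x - g x) < inverse (real (Suc n))" for n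
    using R inverse_Suc[of n] by blast
  from choice[OF allI[OF this]] obtain u where "\<forall>n. \<exists>v. (u n, v) \<in> A \<and> u n \<in> L2 m \<and> v \<in> L2 m \<and>
        L2_norm m (\<lambda>x. u n x - f x) < inverse (real (Suc n)) \<and>
        L2_norm m (\<lambda>x. v x - g x) < inverse (real (Suc n))" ..
  from choice[OF this] obtain v where uv: "\<forall>n. (u n, v n) \<in> A \<and> u n \<in> L2 m \<and> v n \<in> L2 m \<and>
        L2_norm m (\<lambda>x. u n x - f x) < inverse (real (Suc n)) \<and>
        L2_norm m (\<lambda>x. v n x - g x) < inverse (real (Suc n))" ..
  have "L2_tendsto m u f sequentially" "L2_tendsto m v g sequentially"
    using R uv by (auto intro!: L2_tendsto_inverse_SucI simp del: of_nat_Suc)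
  with uv show ?L by (auto simp: op_closure_def)
qed

lemma op_closure_L2: "(f, g) \<in> op_closure m A \<Longrightarrow> f \<in> L2 m \<and> g \<in> L2 m"
  by (simp add: op_closure_iff)

lemma op_closureE:
  assumes "(f, g) \<in> op_closure m A" "\<epsilon> > 0"
  obtains u v where "(u, v) \<in> A" "u \<in> L2 m" "v \<in> L2 m"
    "L2_norm m (\<lambda>x. u x - f x) < \<epsilon>" "L2_norm m (\<lambda>x. v x - g x) < \<epsilon>"
  using assms unfolding op_closure_iff by blast

lemma op_closure_closed:
  assumes "f \<in> L2 m" "g \<in> L2 m"
    and "\<And>\<epsilon>. \<epsilon> > 0 \<Longrightarrow> \<exists>u v. (u, v) \<in> op_closure m A \<and>
        L2_norm m (\<lambda>x. u x - f x) < \<epsilon> \<and> L2_norm m (\<lambda>x. v x - g x) < \<epsilon>"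
  shows "(f, g) \<in> op_closure m A"
  unfolding op_closure_iff
proof (intro conjI allI impI assms(1,2))
  fix \<epsilon> :: real assume "\<epsilon> > 0"
  then have e: "\<epsilon> / 2 > 0" by simp
  from assms(3)[OF e] obtain u v where uv: "(u, v) \<in> op_closure m A"
      "L2_norm m (\<lambda>x. u x - f x) < \<epsilon> / 2" "L2_norm m (\<lambda>x. v x - g x) < \<epsilon> / 2"
    by blast
  from op_closureE[OF uv(1) e] obtain u' v' where uv': "(u', v') \<in> A" "u' \<in> L2 m" "v' \<in> L2 m"
    "L2_norm m (\<lambda>x. u' x - u x) < \<epsilon> / 2" "L2_norm m (\<lambda>x. v' x - v x) < \<epsilon> / 2" by blast
  have "L2_norm m (\<lambda>x. u' x - f x) < \<epsilon>" "L2_norm m (\<lambda>x. v' x - g x) < \<epsilon>"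
    using L2_norm_triangle_diff[of u' m u f] L2_norm_triangle_diff[of v' m v g]
      uv uv' op_closure_L2[OF uv(1)] assms(1,2) by auto
  with uv' show "\<exists>u v. (u, v) \<in> A \<and> u \<in> L2 m \<and> v \<in> L2 m \<and>
        L2_norm m (\<lambda>x. u x - f x) < \<epsilon> \<and> L2_norm m (\<lambda>x. v x - g x) < \<epsilon>" by blast
qed

text \<open>The linear combinations are approximated within \<open>\<delta> + \<bar>c\<bar> \<delta> = \<epsilon>\<close>.\<close>

lemma op_closure_comb:
  assumes A: "\<And>u v u' v'. (u, v) \<in> A \<Longrightarrow> (u', v') \<in> A \<Longrightarrow>
      ((\<lambda>x. u x + c * u' x), (\<lambda>x. v x + c * v' x)) \<in> A"
    and fg: "(f, g) \<in> op_closure m A" "(f', g') \<in> op_closure m A"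
  shows "((\<lambda>x. f x + c * f' x), (\<lambda>x. g x + c * g' x)) \<in> op_closure m A"
  unfolding op_closure_iff
proof (intro conjI allI impI)
  have L2: "f \<in> L2 m" "g \<in> L2 m" "f' \<in> L2 m" "g' \<in> L2 m"
    using fg op_closure_L2 by blast+
  then show "(\<lambda>x. f x + c * f' x) \<in> L2 m" "(\<lambda>x. g x + c * g' x) \<in> L2 m"
    by (auto intro: L2_add L2_scale)
  fix \<epsilon> :: real assume "\<epsilon> > 0"
  define \<delta> where "\<delta> = \<epsilon> / (1 + cmod c)"
  have pos: "0 < 1 + cmod c" by (rule add_pos_nonneg) simp_all
  then have \<delta>: "\<delta> > 0" and "\<delta> * (1 + cmod c) = \<epsilon>"
    using \<open>\<epsilon> > 0\<close> by (simp_all add: \<delta>_def)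
  then have \<delta>\<epsilon>: "\<delta> + cmod c * \<delta> = \<epsilon>"
    by (simp add: algebra_simps)
  from op_closureE[OF fg(1) \<delta>] obtain u v where uv: "(u, v) \<in> A" "u \<in> L2 m" "v \<in> L2 m"
    "L2_norm m (\<lambda>x. u x - f x) < \<delta>" "L2_norm m (\<lambda>x. v x - g x) < \<delta>" by blast
  from op_closureE[OF fg(2) \<delta>] obtain u' v' where uv': "(u', v') \<in> A" "u' \<in> L2 m" "v' \<in> L2 m"
    "L2_norm m (\<lambda>x. u' x - f' x) < \<delta>" "L2_norm m (\<lambda>x. v' x - g' x) < \<delta>" by blast
  have less: "a + cmod c * b < \<epsilon>" if "a < \<delta>" "b < \<delta>" for a b
    using that mult_left_mono[of b \<delta> "cmod c"] \<delta>\<epsilon> by simp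
  have "L2_norm m (\<lambda>x. (u x + c * u' x) - (f x + c * f' x)) < \<epsilon>"
    using L2_norm_comb_le[of u m f u' f' c] less[OF uv(4) uv'(4)] uv uv' L2 by simp
  moreover have "L2_norm m (\<lambda>x. (v x + c * v' x) - (g x + c * g' x)) < \<epsilon>"
    using L2_norm_comb_le[of v m g v' g' c] less[OF uv(5) uv'(5)] uv uv' L2 by simp
  ultimately show "\<exists>u v. (u, v) \<in> A \<and> u \<in> L2 m \<and> v \<in> L2 m \<and>
      L2_norm m (\<lambda>x. u x - (f x + c * f' x)) < \<epsilon> \<and> L2_norm m (\<lambda>x. v x - (g x + c * g' x)) < \<epsilon>"
    using uv uv' by (intro exI conjI) (rule A[OF uv(1) uv'(1)] L2_add L2_scale | assumption)+
qed

lemma op_closure_AE_cong: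
  assumes fg: "(f, g) \<in> op_closure m A"
    and f': "f' \<in> borel_measurable m" "AE x in m. f x = f' x"
    and g': "g' \<in> borel_measurable m" "AE x in m. g x = g' x"
  shows "(f', g') \<in> op_closure m A"
proof (rule op_closure_closed)
  have L2: "f \<in> L2 m" "g \<in> L2 m" using op_closure_L2[OF fg] by auto
  show L2': "f' \<in> L2 m" "g' \<in> L2 m"
    using L2 f' g' by (auto intro: L2_AE_cong)
  have "L2_norm m (\<lambda>x. f x - f' x) = 0" "L2_norm m (\<lambda>x. g x - g' x) = 0"
    using L2 L2' f' g' by (simp_all add: L2_norm_eq_0_iff L2_diff)
  with fg show "\<exists>u v. (u, v) \<in> op_closure m A \<and>
      L2_norm m (\<lambda>x. u x - f' x) < \<epsilon> \<and> L2_norm m (\<lambda>x. v x - g' x) < \<epsilon>" if "\<epsilon> > 0" for \<epsilon>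
    using that by (intro exI[of _ f] exI[of _ g]) simp
qed

lemma op_closure_add_scalar:
  assumes fg: "(f, g) \<in> op_closure m A"
    and A: "\<And>u v. (u, v) \<in> A \<Longrightarrow> (u, \<lambda>x. v x + c * u x) \<in> A'"
  shows "(f, \<lambda>x. g x + c * f x) \<in> op_closure m A'"
  unfolding op_closure_iff
proof (intro conjI allI impI)
  have L2: "f \<in> L2 m" "g \<in> L2 m" using op_closure_L2[OF fg] by auto
  then show "f \<in> L2 m" "(\<lambda>x. g x + c * f x) \<in> L2 m" by (auto intro: L2_add L2_scale)
  fix \<epsilon> :: real assume "\<epsilon> > 0"
  define \<delta> where "\<delta> = \<epsilon> / (1 + cmod c)"
  have pos: "0 < 1 + cmod c" by (rule add_pos_nonneg) simp_all
  then have \<delta>: "\<delta> > 0" and "\<delta> * (1 + cmod c) = \<epsilon>"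
    using \<open>\<epsilon> > 0\<close> by (simp_all add: \<delta>_def)
  then have \<delta>\<epsilon>: "\<delta> + cmod c * \<delta> = \<epsilon>"
    by (simp add: algebra_simps)
  have "0 \<le> cmod c * \<delta>" using \<delta> by simp
  with \<delta>\<epsilon> have "\<delta> \<le> \<epsilon>" by linarith
  from op_closureE[OF fg \<delta>] obtain u v where uv: "(u, v) \<in> A" "u \<in> L2 m" "v \<in> L2 m"
    "L2_norm m (\<lambda>x. u x - f x) < \<delta>" "L2_norm m (\<lambda>x. v x - g x) < \<delta>" by blast
  have "L2_norm m (\<lambda>x. (v x + c * u x) - (g x + c * f x)) < \<epsilon>"
    using L2_norm_comb_le[OF uv(3) L2(2) uv(2) L2(1), of c] uv(4,5) \<delta>\<epsilon>
      mult_left_mono[of "L2_norm m (\<lambda>x. u x - f x)" \<delta> "cmod c"] by simp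
  moreover have "L2_norm m (\<lambda>x. u x - f x) < \<epsilon>" using uv(4) \<open>\<delta> \<le> \<epsilon>\<close> by simp
  ultimately show "\<exists>u v. (u, v) \<in> A' \<and> u \<in> L2 m \<and> v \<in> L2 m \<and>
      L2_norm m (\<lambda>x. u x - f x) < \<epsilon> \<and> L2_norm m (\<lambda>x. v x - (g x + c * f x)) < \<epsilon>"
    using A[OF uv(1)] uv(2) L2_add[OF uv(3) L2_scale[OF uv(2), of c]]
    by (intro exI conjI)
qed

text \<open>A set of functions is viewed as the graph of the identity on it, so that its closure inherits
  the closure properties of graphs.\<close>

lemma L2_closure_iff_op_closure: "f \<in> L2_closure m S \<longleftrightarrow> (f, f) \<in> op_closure m (Id_on S)"
  unfolding L2_closure_def op_closure_iff Id_on_def by auto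

lemma L2_closure_comb:
  assumes "\<And>u u'. u \<in> S \<Longrightarrow> u' \<in> S \<Longrightarrow> (\<lambda>x. u x + c * u' x) \<in> S"
    and "f \<in> L2_closure m S" "f' \<in> L2_closure m S"
  shows "(\<lambda>x. f x + c * f' x) \<in> L2_closure m S"
  using assms(2,3) unfolding L2_closure_iff_op_closure
  by (rule op_closure_comb[rotated]) (use assms(1) in auto)

lemma L2_closure_closed:
  assumes "f \<in> L2 m"
    and "\<And>\<epsilon>. \<epsilon> > 0 \<Longrightarrow> \<exists>u\<in>L2_closure m S. L2_norm m (\<lambda>x. u x - f x) < \<epsilon>"
  shows "f \<in> L2_closure m S"
  unfolding L2_closure_iff_op_closure
  by (rule op_closure_closed[OF assms(1,1)]) (use assms(2) L2_closure_iff_op_closure in blast)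

lemma L2_closure_AE_cong:
  assumes "f \<in> L2_closure m S" "g \<in> L2 m" "AE x in m. f x = g x"
  shows "g \<in> L2_closure m S"
  using assms op_closure_AE_cong unfolding L2_closure_iff_op_closure by (blast dest: L2_measurable)

lemma L2_closure_incl: "u \<in> S \<Longrightarrow> u \<in> L2 m \<Longrightarrow> u \<in> L2_closure m S"
  unfolding L2_closure_def by (auto intro!: bexI[of _ u])

lemma complex_span_comb:
  assumes "u \<in> complex_span S" "v \<in> complex_span S"
  shows "(\<lambda>x. u x + c * v x) \<in> complex_span S"
proof -
  obtain F a G b where u: "u = (\<lambda>x. \<Sum>s\<in>F. a s * s x)" "finite F" "F \<subseteq> S"
    and v: "v = (\<lambda>x. \<Sum>s\<in>G. b s * s x)" "finite G" "G \<subseteq> S"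
    using assms unfolding complex_span_def by blast
  define d where "d s = (if s \<in> F then a s else 0) + c * (if s \<in> G then b s else 0)" for s
  have "u x + c * v x = (\<Sum>s\<in>F \<union> G. d s * s x)" for x
  proof -
    have "(\<Sum>s\<in>F \<union> G. d s * s x) = (\<Sum>s\<in>F \<union> G. (if s \<in> F then a s else 0) * s x)
        + c * (\<Sum>s\<in>F \<union> G. (if s \<in> G then b s else 0) * s x)"
      by (simp add: d_def algebra_simps sum.distrib sum_distrib_left)
    also have "(\<Sum>s\<in>F \<union> G. (if s \<in> F then a s else 0) * s x) = u x"
      unfolding u(1) by (rule sum.mono_neutral_cong_right) (use u v in auto)
    also have "(\<Sum>s\<in>F \<union> G. (if s \<in> G then b s else 0) * s x) = v x"
      unfolding v(1) by (rule sum.mono_neutral_cong_right) (use u v in auto)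
    finally show ?thesis by simp
  qed
  then show ?thesis
    using u v unfolding complex_span_def by (intro CollectI exI[of _ "F \<union> G"] exI[of _ d]) auto
qed

lemma complex_span_zero: "(\<lambda>x. 0) \<in> complex_span S"
  unfolding complex_span_def by (intro CollectI exI[of _ "{}"]) simp

lemma complex_span_base: "s \<in> S \<Longrightarrow> s \<in> complex_span S"
  unfolding complex_span_def by (intro CollectI exI[of _ "{s}"] exI[of _ "\<lambda>_. 1"]) auto

lemma complex_span_sum:
  assumes "\<And>i. i \<in> F \<Longrightarrow> u i \<in> complex_span S"
  shows "(\<lambda>x. \<Sum>i\<in>F. c i * u i x) \<in> complex_span S"
  using assms
proof (induction F rule: infinite_finite_induct)
  case (insert i F)
  then show ?case using complex_span_comb[of "\<lambda>x. \<Sum>i\<in>F. c i * u i x" S "u i" "c i"]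
    by (simp add: add.commute)
qed (simp_all add: complex_span_zero)

lemma complex_span_induct [consumes 1, case_names zero base comb]:
  assumes "u \<in> complex_span S" and zero: "P (\<lambda>x. 0)" and base: "\<And>s. s \<in> S \<Longrightarrow> P s"
    and comb: "\<And>u v c. P u \<Longrightarrow> P v \<Longrightarrow> P (\<lambda>x. u x + c * v x)"
  shows "P u"
proof -
  obtain F c where u: "u = (\<lambda>x. \<Sum>s\<in>F. c s * s x)" "finite F" "F \<subseteq> S"
    using assms(1) unfolding complex_span_def by blast
  have "P (\<lambda>x. \<Sum>s\<in>F. c s * s x)"
    using u(2,3)
  proof (induction F)
    case (insert s F)
    have "P (\<lambda>x. (\<Sum>s\<in>F. c s * s x) + c s * s x)"
      by (rule comb) (use insert base in auto)
    then show ?case using insert.hyps by (simp add: add.commute)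
  qed (simp add: zero)
  then show ?thesis by (simp only: u(1))
qed

lemma L2_has_sum_finite_iff:
  assumes "finite I"
  shows "L2_has_sum m u I f \<longleftrightarrow> f \<in> L2 m \<and> (\<lambda>x. \<Sum>i\<in>I. u i x) \<in> L2 m \<and>
    L2_norm m (\<lambda>x. (\<Sum>i\<in>I. u i x) - f x) = 0"
proof -
  have "((\<lambda>F. L2_norm m (\<lambda>x. (\<Sum>i\<in>F. u i x) - f x)) \<longlongrightarrow> 0) (finite_subsets_at_top I)
      \<longleftrightarrow> L2_norm m (\<lambda>x. (\<Sum>i\<in>I. u i x) - f x) = 0" (is "(?g \<longlongrightarrow> 0) _ \<longleftrightarrow> _")
  proof
    assume "(?g \<longlongrightarrow> 0) (finite_subsets_at_top I)"
    from order_tendstoD(2)[OF this] have small: "?g I < \<epsilon>" if "\<epsilon> > 0" for \<epsilon>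
      using that assms by (simp add: eventually_finite_subsets_at_top_finite)
    show "?g I = 0"
    proof (rule ccontr)
      assume "?g I \<noteq> 0"
      then have "?g I > 0" using L2_norm_nonneg[of m "\<lambda>x. (\<Sum>i\<in>I. u i x) - f x"] by linarith
      from small[OF this] show False by simp
    qed
  next
    assume "?g I = 0"
    then show "(?g \<longlongrightarrow> 0) (finite_subsets_at_top I)"
      using assms by (intro tendstoI) (simp add: eventually_finite_subsets_at_top_finite)
  qed
  then show ?thesis
    unfolding L2_has_sum_def L2_tendsto_def using assms
    by (simp add: eventually_finite_subsets_at_top_finite)
qed

section \<open>Bounded operators that commute with an unbounded one\<close>

text \<open>Differences are preserved as functions, not only almost everywhere; maps given by averages over
  sets of positive measure have this property.\<close>

definition L2_operator :: "'a measure \<Rightarrow> (('a \<Rightarrow> complex) \<Rightarrow> 'a \<Rightarrow> complex) \<Rightarrow> bool" where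
  "L2_operator m K \<longleftrightarrow> (\<forall>f\<in>L2 m. K f \<in> L2 m) \<and>
     (\<forall>f\<in>L2 m. \<forall>g\<in>L2 m. K (\<lambda>x. f x - g x) = (\<lambda>x. K f x - K g x)) \<and>
     (\<exists>c. \<forall>f\<in>L2 m. L2_norm m (K f) \<le> c * L2_norm m f)"

lemma L2_operator_L2: "L2_operator m K \<Longrightarrow> f \<in> L2 m \<Longrightarrow> K f \<in> L2 m"
  by (simp add: L2_operator_def)

lemma L2_operator_Lipschitz:
  assumes "L2_operator m K"
  obtains c where "c > 0"
    "\<And>f g. f \<in> L2 m \<Longrightarrow> g \<in> L2 m \<Longrightarrow>
       L2_norm m (\<lambda>x. K f x - K g x) \<le> c * L2_norm m (\<lambda>x. f x - g x)"
proof -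
  from assms obtain c where c: "\<And>f. f \<in> L2 m \<Longrightarrow> L2_norm m (K f) \<le> c * L2_norm m f"
    unfolding L2_operator_def by blast
  show thesis
  proof
    show "max c 1 > 0" by simp
    fix f g assume fg: "f \<in> L2 m" "g \<in> L2 m"
    have "L2_norm m (\<lambda>x. K f x - K g x) = L2_norm m (K (\<lambda>x. f x - g x))"
      using assms fg by (simp add: L2_operator_def)
    also have "\<dots> \<le> c * L2_norm m (\<lambda>x. f x - g x)" by (intro c L2_diff fg)
    also have "\<dots> \<le> max c 1 * L2_norm m (\<lambda>x. f x - g x)" by (intro mult_right_mono) auto
    finally show "L2_norm m (\<lambda>x. K f x - K g x) \<le> max c 1 * L2_norm m (\<lambda>x. f x - g x)" .
  qed
qed

text \<open>Places the closed span of a set of fixed points of \<open>K\<close> inside the fixed space of \<open>K\<close>.\<close>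

lemma L2_operator_fixed_closure:
  assumes K: "L2_operator m K" and f: "f \<in> L2_closure m S"
    and S: "\<And>u. u \<in> S \<Longrightarrow> u \<in> L2 m \<Longrightarrow> AE x in m. u x = K u x"
  shows "AE x in m. f x = K f x"
proof -
  have fL2: "f \<in> L2 m" "K f \<in> L2 m" using f K by (simp_all add: L2_closure_def L2_operator_L2)
  obtain c where c: "c > 0" "\<And>f g. f \<in> L2 m \<Longrightarrow> g \<in> L2 m \<Longrightarrow>
       L2_norm m (\<lambda>x. K f x - K g x) \<le> c * L2_norm m (\<lambda>x. f x - g x)"
    using L2_operator_Lipschitz[OF K] by metis
  have "L2_norm m (\<lambda>x. f x - K f x) \<le> \<epsilon>" if e: "\<epsilon> > 0" for \<epsilon>
  proof -
    have "\<epsilon> / (1 + c) > 0" using e c(1) by simp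
    from L2_closureE[OF f this] obtain u
      where u: "u \<in> S" "u \<in> L2 m" "L2_norm m (\<lambda>x. u x - f x) < \<epsilon> / (1 + c)" by blast
    have Ku: "K u \<in> L2 m" by (rule L2_operator_L2[OF K u(2)])
    have "L2_norm m (\<lambda>x. u x - K u x) = 0"
      using S[OF u(1,2)] by (subst L2_norm_eq_0_iff) (auto intro: L2_diff u Ku)
    then have "L2_norm m (\<lambda>x. f x - K f x) \<le> L2_norm m (\<lambda>x. f x - u x) + L2_norm m (\<lambda>x. K u x - K f x)"
      using L2_norm_triangle_diff[OF fL2(1) u(2) fL2(2)] L2_norm_triangle_diff[OF u(2) Ku fL2(2)]
      by simp
    also have "\<dots> \<le> (1 + c) * L2_norm m (\<lambda>x. u x - f x)"
      using c(2)[OF u(2) fL2(1)] by (simp add: L2_norm_minus_commute[of m f] algebra_simps)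
    also have "\<dots> \<le> \<epsilon>" using u(3) c(1) by (simp add: field_simps)
    finally show ?thesis .
  qed
  then have "L2_norm m (\<lambda>x. f x - K f x) = 0"
    using field_le_epsilon[of "L2_norm m (\<lambda>x. f x - K f x)" 0] by (simp add: antisym)
  then show ?thesis
    by (subst (asm) L2_norm_eq_0_iff) (auto intro: L2_diff fL2)
qed

text \<open>If \<open>K\<close> commutes with an operator on its core, then it commutes with the closure: apply \<open>K\<close> to
  both components of an approximating pair.\<close>

lemma op_closure_commute:
  assumes K: "L2_operator m K" and fg: "(f, g) \<in> op_closure m A"
    and A: "\<And>u v. (u, v) \<in> A \<Longrightarrow> (K u, K v) \<in> A'"
  shows "(K f, K g) \<in> op_closure m A'"
  unfolding op_closure_iff
proof (intro conjI allI impI)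
  have L2: "f \<in> L2 m" "g \<in> L2 m" using op_closure_L2[OF fg] by auto
  then show "K f \<in> L2 m" "K g \<in> L2 m" by (auto intro: L2_operator_L2[OF K])
  fix \<epsilon> :: real assume e: "\<epsilon> > 0"
  obtain c where c: "c > 0" "\<And>f g. f \<in> L2 m \<Longrightarrow> g \<in> L2 m \<Longrightarrow>
       L2_norm m (\<lambda>x. K f x - K g x) \<le> c * L2_norm m (\<lambda>x. f x - g x)"
    using L2_operator_Lipschitz[OF K] by metis
  have "\<epsilon> / c > 0" using e c by simp
  from op_closureE[OF fg this] obtain u v where uv: "(u, v) \<in> A" "u \<in> L2 m" "v \<in> L2 m"
    "L2_norm m (\<lambda>x. u x - f x) < \<epsilon> / c" "L2_norm m (\<lambda>x. v x - g x) < \<epsilon> / c" by blast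
  have "L2_norm m (\<lambda>x. K u x - K f x) < \<epsilon>" "L2_norm m (\<lambda>x. K v x - K g x) < \<epsilon>"
    using c(2)[OF uv(2) L2(1)] c(2)[OF uv(3) L2(2)] uv(4,5) c(1) by (simp_all add: field_simps)
  with A[OF uv(1)] L2_operator_L2[OF K uv(2)] L2_operator_L2[OF K uv(3)]
  show "\<exists>u v. (u, v) \<in> A' \<and> u \<in> L2 m \<and> v \<in> L2 m \<and>
        L2_norm m (\<lambda>x. u x - K f x) < \<epsilon> \<and> L2_norm m (\<lambda>x. v x - K g x) < \<epsilon>"
    by (intro exI conjI)
qed

lemma L2_operator_closure:
  assumes K: "L2_operator m K" and f: "f \<in> L2_closure m S" and S: "\<And>u. u \<in> S \<Longrightarrow> K u \<in> S'"
  shows "K f \<in> L2_closure m S'"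
  using f unfolding L2_closure_iff_op_closure
  by (rule op_closure_commute[OF K]) (use S in auto)

section \<open>Balls in a homogeneous ultrametric space\<close>

text \<open>The index set of the balls containing \<open>x\<close>. By transitivity of the isometry group it is the same at
  every point, so the Laplacian becomes a sum over one fixed set.\<close>

definition radii :: "'a::metric_space \<Rightarrow> real set" where
  "radii x = diameter ` {B\<in>balls. x \<in> B}"

lemma balls_cball: "r > 0 \<Longrightarrow> cball x r \<in> balls"
  unfolding balls_def by blast

context homogeneous_ultrametric_measure_space
begin

lemma cball_subset_cball:
  fixes x y :: 'a
  assumes "y \<in> cball x r" "s \<le> r"
  shows "cball y s \<subseteq> cball x r"
proof
  fix z assume "z \<in> cball y s"
  with assms ultrametric[of x z y] show "z \<in> cball x r" by auto
qed

text \<open>Every point of an ultrametric ball is a centre of it.\<close>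

lemma cball_eq:
  fixes x y :: 'a
  assumes "y \<in> cball x r"
  shows "cball y r = cball x r"
  using cball_subset_cball[OF assms order_refl] cball_subset_cball[of x y r r] assms
  by (auto simp: dist_commute)

lemma cball_disjoint:
  fixes x y :: 'a
  assumes "cball x r \<noteq> cball y r"
  shows "cball x r \<inter> cball y r = {}"
proof (rule ccontr)
  assume "cball x r \<inter> cball y r \<noteq> {}"
  then obtain z where "z \<in> cball x r" "z \<in> cball y r" by blast
  with assms cball_eq[of z x r] cball_eq[of z y r] show False by simp
qed

lemma open_cball_ultrametric:
  fixes x :: 'a
  assumes "r > 0" shows "open (cball x r)"
proof (rule openI)
  fix y assume "y \<in> cball x r"
  then show "\<exists>e>0. ball y e \<subseteq> cball x r"
    using assms cball_eq[of y x r] ball_subset_cball[of y r] by blast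
qed

lemma bounded_ball: "B \<in> balls \<Longrightarrow> bounded (B :: 'a set)"
  by (auto simp: balls_def)

lemma ballE:
  fixes B :: "'a set"
  assumes "B \<in> balls" "x \<in> B"
  obtains r where "r > 0" "B = cball x r"
proof -
  obtain y r where "B = cball y r" "r > 0" using assms(1) by (auto simp: balls_def)
  with cball_eq[of x y r] assms(2) that show thesis by simp
qed

lemma diameter_cball_le:
  fixes x :: 'a
  assumes "r \<ge> 0"
  shows "diameter (cball x r) \<le> r"
proof -
  have "cball x r \<noteq> {}" using assms by simp
  from diameter_compact_attained[OF compact_cball this]
  obtain p q where "p \<in> cball x r" "q \<in> cball x r" "dist p q = diameter (cball x r)" by blast
  then show ?thesis using cball_eq[of p x r] by (metis mem_cball)
qed

text \<open>The diameter is the smallest radius that represents a ball, and it does so around each of its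
  points. A singleton that is a ball has radius \<open>0\<close> in this normal form.\<close>

lemma ball_eq_cball_diameter:
  fixes B :: "'a set"
  assumes "B \<in> balls" "x \<in> B"
  shows "B = cball x (diameter B)"
proof -
  obtain r where r: "r > 0" "B = cball x r" using assms by (rule ballE)
  have "diameter B \<le> r" using r diameter_cball_le by simp
  moreover have "dist x z \<le> diameter B" if "z \<in> B" for z
    by (rule diameter_bounded_bound) (use assms that bounded_ball in auto)
  ultimately show ?thesis using r by auto
qed

lemma ball_eqI:
  fixes A B :: "'a set"
  assumes "A \<in> balls" "B \<in> balls" "x \<in> A" "x \<in> B" "diameter A = diameter B"
  shows "A = B"
proof -
  have "A = cball x (diameter A)" by (rule ball_eq_cball_diameter[OF assms(1,3)])
  also have "\<dots> = B" unfolding assms(5) by (rule ball_eq_cball_diameter[OF assms(2,4), symmetric])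
  finally show ?thesis .
qed

lemma balls_nonempty: "B \<in> balls \<Longrightarrow> B \<noteq> ({} :: 'a set)"
  by (auto simp: balls_def)

lemma balls_compact: "B \<in> balls \<Longrightarrow> compact (B :: 'a set)"
  using compact_cball by (auto simp: balls_def)

lemma isometry_cball:
  fixes x y :: 'a
  obtains g where "g \<in> isometries" "g ` cball x r = cball y r"
proof -
  obtain g where g: "g \<in> isometries" "g x = y" using transitive by blast
  then have "bij g" and d: "\<And>u v. dist (g u) (g v) = dist u v" by (auto simp: isometries_def)
  have "g ` cball x r = cball y r"
  proof (intro subset_antisym subsetI)
    fix z assume "z \<in> g ` cball x r"
    then show "z \<in> cball y r" using d g(2) by (metis imageE mem_cball)
  next
    fix z assume z: "z \<in> cball y r"
    obtain w where "z = g w" using \<open>bij g\<close> by (meson bij_pointE)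
    with z d g(2) show "z \<in> g ` cball x r" by (metis image_eqI mem_cball)
  qed
  with g(1) that show thesis by blast
qed

lemma diameter_cball_eq:
  fixes x y :: 'a
  shows "diameter (cball x r) = diameter (cball y r)"
proof -
  have le: "diameter (cball x r) \<le> diameter (cball y r)" for x y :: 'a
  proof (cases "r < 0")
    case False
    obtain g where g: "g \<in> isometries" "g ` cball x r = cball y r" by (rule isometry_cball)
    from diameter_compact_attained[OF compact_cball, of x r] False
    obtain p q where pq: "p \<in> cball x r" "q \<in> cball x r" "dist p q = diameter (cball x r)" by auto
    have "dist (g p) (g q) \<le> diameter (cball y r)"
      using g(2) pq(1,2) by (intro diameter_bounded_bound) auto
    with g(1) pq(3) show ?thesis by (simp add: isometries_def)
  qed simp
  show ?thesis using le[of x y] le[of y x] by (rule antisym)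
qed

lemma radii_subset: "radii (x :: 'a) \<subseteq> radii (y :: 'a)"
proof
  fix \<rho> assume "\<rho> \<in> radii x"
  then obtain B where B: "B \<in> balls" "x \<in> B" "\<rho> = diameter B" by (auto simp: radii_def)
  obtain r where "r > 0" "B = cball x r" using B(1,2) by (rule ballE)
  then have "\<rho> = diameter (cball y r)" "cball y r \<in> balls" "y \<in> cball y r"
    using B diameter_cball_eq[of x r y] by (auto intro: balls_cball)
  then show "\<rho> \<in> radii y" unfolding radii_def by blast
qed

lemma radii_eq: "radii (x :: 'a) = radii (y :: 'a)"
  using radii_subset[of x y] radii_subset[of y x] by (rule antisym)

lemma radii_cball:
  fixes x y :: 'a
  assumes "\<rho> \<in> radii x"
  shows "cball y \<rho> \<in> balls" "diameter (cball y \<rho>) = \<rho>"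
proof -
  have "\<rho> \<in> radii y" using assms radii_eq[of x y] by simp
  then obtain B where B: "B \<in> balls" "y \<in> B" "\<rho> = diameter B"
    by (auto simp: radii_def)
  have "B = cball y \<rho>" unfolding B(3) by (rule ball_eq_cball_diameter[OF B(1,2)])
  with B(1) B(3)[symmetric] show "cball y \<rho> \<in> balls" "diameter (cball y \<rho>) = \<rho>"
    by (simp_all only:)
qed

lemma diameter_in_radii: "B \<in> balls \<Longrightarrow> x \<in> B \<Longrightarrow> diameter B \<in> radii (y :: 'a)"
  for x :: 'a
  unfolding radii_eq[of y x] by (auto simp: radii_def)

lemma radii_nonneg: "\<rho> \<in> radii (x :: 'a) \<Longrightarrow> 0 \<le> \<rho>"
  using radii_cball(2)[of \<rho> x x] diameter_ge_0[OF bounded_cball[of x \<rho>]] by simp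

lemma bij_betw_radii: "bij_betw (cball x) (radii x) {B\<in>balls. (x :: 'a) \<in> B}"
proof (rule bij_betw_byWitness[where f' = diameter])
  show "\<forall>\<rho>\<in>radii x. diameter (cball x \<rho>) = \<rho>" using radii_cball by blast
  show "\<forall>B\<in>{B\<in>balls. x \<in> B}. cball x (diameter B) = B"
    by (intro ballI ball_eq_cball_diameter[symmetric]) auto
  show "cball x ` radii x \<subseteq> {B\<in>balls. x \<in> B}"
    using radii_cball(1) radii_nonneg by auto
  show "diameter ` {B\<in>balls. x \<in> B} \<subseteq> radii x" by (simp add: radii_def)
qed

lemma finite_cballs_compact:
  assumes "compact (K :: 'a set)" "e > 0"
  shows "finite ((\<lambda>y. cball y e) ` K)"
proof -
  have "K \<subseteq> \<Union> ((\<lambda>y. cball y e) ` K)" using assms(2) by force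
  then obtain D where D: "D \<subseteq> (\<lambda>y. cball y e) ` K" "finite D" "K \<subseteq> \<Union>D"
    using compactE[OF assms(1), of "(\<lambda>y. cball y e) ` K"] open_cball_ultrametric[OF assms(2)]
    by (metis (no_types, lifting) imageE)
  have "(\<lambda>y. cball y e) ` K \<subseteq> D"
  proof
    fix B assume "B \<in> (\<lambda>y. cball y e) ` K"
    then obtain y where y: "y \<in> K" "B = cball y e" by blast
    then obtain A where A: "A \<in> D" "y \<in> A" using D by blast
    then obtain z where "A = cball z e" using D by blast
    with A y cball_eq[of y z e] show "B \<in> D" by simp
  qed
  then show ?thesis using D(2) finite_subset by blast
qed

lemma countable_cballs:
  assumes "e > 0"
  shows "countable (range (\<lambda>y :: 'a. cball y e))"
proof -
  fix x :: 'a
  have "range (\<lambda>y. cball y e) \<subseteq> (\<Union>n::nat. (\<lambda>y. cball y e) ` cball x (real n))"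
  proof
    fix B assume "B \<in> range (\<lambda>y :: 'a. cball y e)"
    then obtain y where y: "B = cball y e" by blast
    obtain n where "dist x y \<le> real n" using real_arch_simple by blast
    then have "B \<in> (\<lambda>y. cball y e) ` cball x (real n)" using y by auto
    then show "B \<in> (\<Union>n::nat. (\<lambda>y. cball y e) ` cball x (real n))" by blast
  qed
  moreover have "countable (\<Union>n::nat. (\<lambda>y. cball y e) ` cball x (real n))"
    using finite_cballs_compact[OF compact_cball assms] by (auto intro: countable_finite)
  ultimately show ?thesis using countable_subset by blast
qed

lemma unbounded:
  fixes x :: 'a
  obtains y where "R < dist x y"
proof -
  have "\<exists>y. R < dist x y"
  proof (rule ccontr)
    assume "\<not> ?thesis"
    then have "UNIV = cball x R" by (auto simp: not_less)
    then show False using noncompact compact_cball by metis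
  qed
  with that show thesis by blast
qed

text \<open>A ball of radius \<open>b\<close> is a finite union of balls of radius \<open>a\<close>, so only finitely many
  balls lie between the two radii: distances can accumulate at \<open>0\<close> only.\<close>

lemma finite_radii:
  fixes x :: 'a
  assumes "a > 0"
  shows "finite {\<rho>\<in>radii x. a \<le> \<rho> \<and> \<rho> \<le> b}"
proof (rule finite_imageD)
  let ?f = "\<lambda>\<rho>. (\<lambda>y. cball y a) ` cball x \<rho>"
  have "?f ` {\<rho>\<in>radii x. a \<le> \<rho> \<and> \<rho> \<le> b} \<subseteq> Pow ((\<lambda>y. cball y a) ` cball x b)"
    by auto
  then show "finite (?f ` {\<rho>\<in>radii x. a \<le> \<rho> \<and> \<rho> \<le> b})"
    by (rule finite_subset) (simp add: finite_cballs_compact compact_cball assms)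
  show "inj_on ?f {\<rho>\<in>radii x. a \<le> \<rho> \<and> \<rho> \<le> b}"
  proof (rule inj_onI)
    fix \<rho> \<rho>' assume \<rho>: "\<rho> \<in> {\<rho>\<in>radii x. a \<le> \<rho> \<and> \<rho> \<le> b}" and \<rho>': "\<rho>' \<in> {\<rho>\<in>radii x. a \<le> \<rho> \<and> \<rho> \<le> b}"
      and eq: "?f \<rho> = ?f \<rho>'"
    have U: "\<Union> (?f s) = cball x s" if "a \<le> s" for s
    proof (intro subset_antisym subsetI)
      fix z assume "z \<in> \<Union> (?f s)"
      then obtain y where "y \<in> cball x s" "z \<in> cball y a" by blast
      then show "z \<in> cball x s" using cball_subset_cball[of y x s a] that by blast
    next
      fix z assume "z \<in> cball x s"
      moreover have "z \<in> cball z a" using assms by simp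
      ultimately show "z \<in> \<Union> (?f s)" by blast
    qed
    have "a \<le> \<rho>" "a \<le> \<rho>'" "\<rho> \<in> radii x" "\<rho>' \<in> radii x" using \<rho> \<rho>' by auto
    have "\<rho> = diameter (cball x \<rho>)" by (rule radii_cball(2)[OF \<open>\<rho> \<in> radii x\<close>, symmetric])
    also have "cball x \<rho> = cball x \<rho>'"
      using U[OF \<open>a \<le> \<rho>\<close>, symmetric] U[OF \<open>a \<le> \<rho>'\<close>] by (simp only: eq)
    also have "diameter \<dots> = \<rho>'" by (rule radii_cball(2)[OF \<open>\<rho>' \<in> radii x\<close>])
    finally show "\<rho> = \<rho>'" .
  qed
qed

lemma finite_balls_between:
  assumes T: "T \<in> (balls :: 'a set set)" and S: "S \<in> (balls :: 'a set set)"
  shows "finite {U\<in>balls. T \<subset> U \<and> U \<subseteq> S}"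
proof -
  obtain x where x: "x \<in> T" using balls_nonempty[OF T] by blast
  obtain s where s: "s > 0" "T = cball x s" using T x by (rule ballE)
  have "finite (cball x ` {\<rho>\<in>radii x. s \<le> \<rho> \<and> \<rho> \<le> diameter S})"
    using finite_radii[OF s(1)] by simp
  moreover have "{U\<in>balls. T \<subset> U \<and> U \<subseteq> S} \<subseteq> cball x ` {\<rho>\<in>radii x. s \<le> \<rho> \<and> \<rho> \<le> diameter S}"
  proof
    fix U assume "U \<in> {U\<in>balls. T \<subset> U \<and> U \<subseteq> S}"
    then have U: "U \<in> balls" "T \<subset> U" "U \<subseteq> S" "x \<in> U" using x by auto
    have eq: "U = cball x (diameter U)" by (rule ball_eq_cball_diameter[OF U(1,4)])
    have "s \<le> diameter U"
    proof (rule ccontr)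
      assume "\<not> ?thesis"
      then have "cball x (diameter U) \<subseteq> T" using s by auto
      then have "U \<subseteq> T" by (subst eq)
      with U(2) show False by auto
    qed
    moreover have "diameter U \<le> diameter S"
      using U(3) S bounded_ball by (auto intro: diameter_subset)
    ultimately show "U \<in> cball x ` {\<rho>\<in>radii x. s \<le> \<rho> \<and> \<rho> \<le> diameter S}"
      using eq diameter_in_radii U by blast
  qed
  ultimately show ?thesis by (rule rev_finite_subset)
qed

lemma balls_comparable:
  fixes A B :: "'a set"
  assumes "A \<in> balls" "B \<in> balls" "x \<in> A" "x \<in> B"
  shows "A \<subseteq> B \<or> B \<subseteq> A"
proof -
  obtain r where r: "A = cball x r" using assms(1,3) by (rule ballE)
  obtain s where s: "B = cball x s" using assms(2,4) by (rule ballE)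
  show ?thesis unfolding r s by (cases "r \<le> s") auto
qed

text \<open>The balls between \<open>T\<close> and a larger ball form a finite chain; its smallest member is the parent.\<close>

lemma parent_ball:
  assumes T: "T \<in> (balls :: 'a set set)"
  shows "parent_ball T \<in> balls" "T \<subset> parent_ball T"
    and "\<And>U. U \<in> balls \<Longrightarrow> T \<subset> U \<Longrightarrow> parent_ball T \<subseteq> U"
proof -
  obtain x where x: "x \<in> T" using balls_nonempty[OF T] by blast
  obtain s where s: "s > 0" "T = cball x s" using T x by (rule ballE)
  obtain y where y: "s < dist x y" by (rule unbounded)
  define S where "S = cball x (dist x y)"
  have S: "S \<in> balls" "T \<subset> S"
  proof -
    show "S \<in> balls" unfolding S_def by (intro balls_cball order.strict_trans[OF s(1) y])
    have "y \<in> S" "y \<notin> T" "T \<subseteq> S" using s y by (auto simp: S_def)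
    then show "T \<subset> S" by blast
  qed
  let ?M = "{U\<in>balls. T \<subset> U \<and> U \<subseteq> S}"
  have "finite ?M" "?M \<noteq> {}" using finite_balls_between[OF T S(1)] S by auto
  from finite_has_minimal[OF this] obtain P where P: "P \<in> ?M" "\<And>U. U \<in> ?M \<Longrightarrow> U \<subseteq> P \<Longrightarrow> P = U"
    by auto
  have least: "P \<subseteq> U" if U: "U \<in> balls" "T \<subset> U" for U
  proof (rule ccontr)
    assume *: "\<not> P \<subseteq> U"
    have "x \<in> P" "x \<in> U" using x P(1) U by auto
    with balls_comparable[of P U x] P(1) U * have UP: "U \<subseteq> P" by blast
    then have "U \<in> ?M" using U P(1) by auto
    then have "P = U" using UP by (rule P(2))
    with * show False by simp
  qed
  have "parent_ball T = P"
    unfolding parent_ball_def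
  proof (rule the_equality)
    show "P \<in> balls \<and> T \<subset> P \<and> (\<forall>U\<in>balls. T \<subset> U \<longrightarrow> P \<subseteq> U)" using P(1) least by auto
    show "Q = P" if Q: "Q \<in> balls \<and> T \<subset> Q \<and> (\<forall>U\<in>balls. T \<subset> U \<longrightarrow> Q \<subseteq> U)" for Q
    proof (rule antisym)
      show "Q \<subseteq> P" using Q P(1) by auto
      show "P \<subseteq> Q" using Q by (intro least) auto
    qed
  qed
  then show "parent_ball T \<in> balls" "T \<subset> parent_ball T"
    "\<And>U. U \<in> balls \<Longrightarrow> T \<subset> U \<Longrightarrow> parent_ball T \<subseteq> U" using P(1) least by simp_all
qed

text \<open>Passing to parents climbs from \<open>T\<close> to \<open>S\<close> in finitely many steps.\<close>

lemma ball_descending_induct [consumes 2, case_names base step]: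
  assumes "T \<in> (balls :: 'a set set)" "T \<subseteq> S"
    and base: "P S"
    and step: "\<And>T. T \<in> balls \<Longrightarrow> T \<subset> S \<Longrightarrow> P (parent_ball T) \<Longrightarrow> P T"
    and S: "S \<in> balls"
  shows "P T"
  using assms(1,2)
proof (induction "card {U\<in>balls. T \<subset> U \<and> U \<subseteq> S}" arbitrary: T rule: less_induct)
  case less
  show ?case
  proof (cases "T = S")
    case False
    let ?P = "parent_ball T"
    have TS: "T \<subset> S" using False less.prems by blast
    have P: "?P \<in> balls" "T \<subset> ?P" "?P \<subseteq> S"
      using parent_ball(1,2)[OF less.prems(1)] parent_ball(3)[OF less.prems(1) S TS] by simp_all
    have "{U\<in>balls. ?P \<subset> U \<and> U \<subseteq> S} \<subseteq> {U\<in>balls. T \<subset> U \<and> U \<subseteq> S}"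
    proof
      fix U assume "U \<in> {U\<in>balls. ?P \<subset> U \<and> U \<subseteq> S}"
      then show "U \<in> {U\<in>balls. T \<subset> U \<and> U \<subseteq> S}" using psubset_trans[OF P(2), of U] by simp
    qed
    moreover have "?P \<in> {U\<in>balls. T \<subset> U \<and> U \<subseteq> S} - {U\<in>balls. ?P \<subset> U \<and> U \<subseteq> S}"
      using P by simp
    ultimately have "{U\<in>balls. ?P \<subset> U \<and> U \<subseteq> S} \<subset> {U\<in>balls. T \<subset> U \<and> U \<subseteq> S}"
      by blast
    then have "card {U\<in>balls. ?P \<subset> U \<and> U \<subseteq> S} < card {U\<in>balls. T \<subset> U \<and> U \<subseteq> S}"
      by (rule psubset_card_mono[OF finite_balls_between[OF less.prems(1) S]])
    then have "P ?P" by (rule less.hyps[OF _ P(1,3)])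
    then show ?thesis by (rule step[OF less.prems(1) TS])
  qed (use base in simp)
qed

section \<open>The measure of balls\<close>

lemma sets_m [measurable_cong]: "sets m = sets borel"
  using radon by (simp add: radon_measure_def)

lemma space_m [simp]: "space m = UNIV"
  using sets_eq_imp_space_eq[OF sets_m] by simp

lemma sets_cball [measurable, simp]: "cball (x :: 'a) r \<in> sets m"
  by (simp add: sets_m)

lemma sets_ball: "B \<in> balls \<Longrightarrow> B \<in> sets m"
  by (auto simp: balls_def)

lemma emeasure_compact_finite: "compact K \<Longrightarrow> emeasure m K < \<infinity>"
  using radon by (simp add: radon_measure_def)

lemma emeasure_cball_finite [simp]: "emeasure m (cball x r) < top" "emeasure m (cball x r) \<noteq> top"
  using emeasure_compact_finite[OF compact_cball, of x r] by auto

lemma measure_ball_pos: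
  assumes "B \<in> balls" shows "measure m B > 0"
proof -
  obtain x r where B: "B = cball x r" "r > 0" using assms by (auto simp: balls_def)
  have "emeasure m B > 0"
    unfolding B by (rule full_support) (use B open_cball_ultrametric in auto)
  then show ?thesis
    using emeasure_cball_finite[of x r] B by (simp add: measure_def enn2real_positive_iff)
qed

lemma measure_cball_pos: "r > 0 \<Longrightarrow> measure m (cball x r) > 0"
  by (intro measure_ball_pos balls_cball)

lemma measure_ball_eq_diameter: "B \<in> balls \<Longrightarrow> diameter B > 0 \<Longrightarrow> measure m B = diameter B"
  by (simp add: normalized measure_def)

end

section \<open>Test functions\<close>

definition const_on_cballs :: "real \<Rightarrow> ('a::metric_space \<Rightarrow> 'b) \<Rightarrow> bool" where
  "const_on_cballs e f \<longleftrightarrow> (\<forall>x y. dist x y \<le> e \<longrightarrow> f x = f y)"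

lemma const_on_cballsD: "const_on_cballs e f \<Longrightarrow> dist x y \<le> e \<Longrightarrow> f x = f y"
  by (simp add: const_on_cballs_def)

lemma const_on_cballs_mono: "const_on_cballs e f \<Longrightarrow> e' \<le> e \<Longrightarrow> const_on_cballs e' f"
  by (force simp: const_on_cballs_def)

lemma const_on_cballs_continuous:
  assumes "const_on_cballs e f" "e > 0"
  shows "continuous_on UNIV f"
proof (rule continuous_on_tendsto_compose[of UNIV "\<lambda>x. x", simplified] | simp add: continuous_on_def)+
  show "\<forall>x. (f \<longlongrightarrow> f x) (at x)"
  proof
    fix x
    have "\<forall>\<^sub>F y in at x. f y = f x"
      unfolding eventually_at
      using assms by (intro exI[of _ e]) (auto simp: const_on_cballs_def)
    then show "(f \<longlongrightarrow> f x) (at x)" by (rule tendsto_eventually)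
  qed
qed

context homogeneous_ultrametric_measure_space
begin

lemma const_on_cballs_measurable:
  fixes f :: "'a \<Rightarrow> complex"
  assumes "const_on_cballs e f" "e > 0"
  shows "f \<in> borel_measurable m"
  unfolding measurable_cong_sets[OF sets_m refl]
  by (intro borel_measurable_continuous_onI const_on_cballs_continuous[OF assms])

lemma const_on_cballs_indicator:
  "const_on_cballs r (indicator (cball (x :: 'a) r) :: 'a \<Rightarrow> complex)"
  unfolding const_on_cballs_def
proof (intro allI impI)
  fix y z :: 'a assume "dist y z \<le> r"
  then have "z \<in> cball y r" "y \<in> cball z r" by (auto simp: dist_commute)
  then have "y \<in> cball x r \<longleftrightarrow> z \<in> cball x r"
    using cball_subset_cball[of y x r r] cball_subset_cball[of z x r r] by blast
  then show "indicator (cball x r) y = (indicator (cball x r) z :: complex)"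
    by (simp only: indicator_def)
qed

lemma test_functionI:
  fixes f :: "'a \<Rightarrow> complex"
  assumes e: "e > 0" "const_on_cballs e f" and K: "compact K" "\<And>x. x \<notin> K \<Longrightarrow> f x = 0"
  shows "f \<in> test_functions"
  unfolding test_functions_def
proof (intro CollectI conjI allI)
  fix x
  have "f constant_on cball x e"
    unfolding constant_on_def using const_on_cballsD[OF e(2), of x] by (metis mem_cball)
  then show "\<exists>U. open U \<and> x \<in> U \<and> f constant_on U"
    using open_cball_ultrametric[OF e(1), of x] e(1) by (intro exI[of _ "cball x e"]) simp
next
  have "closure {x. f x \<noteq> 0} \<subseteq> K"
    using K by (intro closure_minimal compact_imp_closed) auto
  then have "closure {x. f x \<noteq> 0} = K \<inter> closure {x. f x \<noteq> 0}" by blast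
  then show "compact (closure {x. f x \<noteq> 0})"
    using compact_Int_closed[OF K(1), of "closure {x. f x \<noteq> 0}"] by simp
qed

text \<open>The Lebesgue number of the support makes the local constancy uniform.\<close>

lemma test_functionE:
  fixes f :: "'a \<Rightarrow> complex"
  assumes "f \<in> test_functions"
  obtains e K where "e > 0" "const_on_cballs e f" "compact K" "\<And>x. x \<notin> K \<Longrightarrow> f x = 0"
proof -
  define K where "K = closure {x. f x \<noteq> 0}"
  have K: "compact K" using assms by (simp add: test_functions_def K_def)
  have zero: "f x = 0" if "x \<notin> K" for x
    using that closure_subset[of "{x. f x \<noteq> 0}"] by (auto simp: K_def)
  let ?G = "{U. open U \<and> f constant_on U}"
  have "K \<subseteq> \<Union> ?G" using assms by (auto simp: test_functions_def)
  from Heine_Borel_lemma[OF K this] obtain e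
    where e: "e > 0" "\<And>x. x \<in> K \<Longrightarrow> \<exists>G\<in>?G. ball x e \<subseteq> G" by auto
  have const: "f x = f y" if xy: "x \<in> K" "dist x y \<le> e / 2" for x y
  proof -
    obtain G where G: "f constant_on G" "ball x e \<subseteq> G" using e(2)[OF xy(1)] by blast
    have "x \<in> ball x e" "y \<in> ball x e" using xy(2) e(1) by auto
    with G have "x \<in> G" "y \<in> G" by blast+
    with G(1) show ?thesis by (auto simp: constant_on_def)
  qed
  show thesis
  proof
    show "e / 2 > 0" using e by simp
    show "const_on_cballs (e / 2) f"
      unfolding const_on_cballs_def
    proof (intro allI impI)
      fix x y :: 'a assume d: "dist x y \<le> e / 2"
      consider "x \<in> K" | "y \<in> K" | "x \<notin> K" "y \<notin> K" by blast
      then show "f x = f y"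
      proof cases
        case 1
        then show ?thesis using const d by blast
      next
        case 2
        then have "f y = f x" using const[of y x] d by (simp add: dist_commute)
        then show ?thesis by simp
      qed (simp add: zero)
    qed
  qed (use K zero in auto)
qed

lemma test_functions_comb:
  fixes u v :: "'a \<Rightarrow> complex"
  assumes "u \<in> test_functions" "v \<in> test_functions"
  shows "(\<lambda>x. u x + c * v x) \<in> test_functions"
proof -
  obtain e K where u: "e > 0" "const_on_cballs e u" "compact K" "\<And>x. x \<notin> K \<Longrightarrow> u x = 0"
    using assms(1) by (rule test_functionE) blast
  obtain e' K' where v: "e' > 0" "const_on_cballs e' v" "compact K'" "\<And>x. x \<notin> K' \<Longrightarrow> v x = 0"
    using assms(2) by (rule test_functionE) blast
  show ?thesis
  proof (rule test_functionI)
    show "min e e' > 0" using u v by simp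
    show "const_on_cballs (min e e') (\<lambda>x. u x + c * v x)"
      using u(2) v(2) unfolding const_on_cballs_def by (metis min.boundedE)
    show "compact (K \<union> K')" using u v by blast
    show "u x + c * v x = 0" if "x \<notin> K \<union> K'" for x using that u(4) v(4) by simp
  qed
qed

lemma zero_test_function [simp]: "(\<lambda>x :: 'a. 0) \<in> test_functions"
  by (rule test_functionI[where e = 1 and K = "{}"]) (auto simp: const_on_cballs_def)

text \<open>The coefficients may be read off at arbitrary points of the pieces.\<close>

lemma const_on_cballs_decomposition:
  fixes u :: "'a \<Rightarrow> complex"
  assumes e: "e > 0" "const_on_cballs e u" and K: "compact K" "\<And>x. x \<notin> K \<Longrightarrow> u x = 0"
  shows "u x = (\<Sum>T\<in>(\<lambda>y. cball y e) ` K. u (SOME y. y \<in> T) * indicator T x)"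
proof -
  let ?F = "(\<lambda>y. cball y e) ` K" and ?T = "cball x e"
  have fin: "finite ?F" by (rule finite_cballs_compact[OF K(1) e(1)])
  have other: "u (SOME y. y \<in> T) * indicator T x = 0" if T: "T \<in> ?F" "T \<noteq> ?T" for T
  proof -
    obtain y where y: "T = cball y e" using T(1) by blast
    then have "x \<notin> T" using cball_eq[of x y e] T(2) by auto
    then show ?thesis by simp
  qed
  have "x \<in> ?T" using e(1) by simp
  then have "(SOME y. y \<in> ?T) \<in> ?T" by (rule someI)
  then have pick: "u (SOME y. y \<in> ?T) = u x"
    using const_on_cballsD[OF e(2), of x "SOME y. y \<in> ?T"] by simp
  show ?thesis
  proof (cases "?T \<in> ?F")
    case True
    have "(\<Sum>T\<in>?F. u (SOME y. y \<in> T) * indicator T x) = u (SOME y. y \<in> ?T) * indicator ?T x"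
    proof -
      have "(\<Sum>T\<in>?F - {?T}. u (SOME y. y \<in> T) * indicator T x) = 0"
        by (rule sum.neutral) (use other in blast)
      then show ?thesis using sum.remove[OF fin True, of "\<lambda>T. u (SOME y. y \<in> T) * indicator T x"] by simp
    qed
    then show ?thesis using pick e(1) by simp
  next
    case False
    then have "x \<notin> K" by blast
    moreover have "(\<Sum>T\<in>?F. u (SOME y. y \<in> T) * indicator T x) = 0"
      using other False by (intro sum.neutral) metis
    ultimately show ?thesis using K(2) by simp
  qed
qed

lemma indicator_ball_L2: "B \<in> balls \<Longrightarrow> (indicator B :: 'a \<Rightarrow> complex) \<in> L2 m"
  by (intro L2_indicator sets_ball emeasure_compact_finite balls_compact)

lemma test_functions_L2:
  assumes "u \<in> test_functions"
  shows "u \<in> L2 m"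
proof -
  obtain e K where u: "e > 0" "const_on_cballs e u" "compact K" "\<And>x. x \<notin> K \<Longrightarrow> u x = 0"
    using assms by (rule test_functionE) blast
  have "(\<lambda>x. \<Sum>T\<in>(\<lambda>y. cball y e) ` K. u (SOME y. y \<in> T) * indicator T x) \<in> L2 m"
    using u(1) by (intro L2_sum L2_scale indicator_ball_L2) (auto intro: balls_cball)
  moreover have "u = (\<lambda>x. \<Sum>T\<in>(\<lambda>y. cball y e) ` K. u (SOME y. y \<in> T) * indicator T x)"
    by (rule ext) (rule const_on_cballs_decomposition[OF u])
  ultimately show ?thesis by simp
qed

section \<open>Density of the test functions\<close>

lemma emeasure_outer_approx:
  assumes A: "A \<in> sets m" "emeasure m A < \<infinity>" and "\<delta> > 0"
  obtains U where "open U" "A \<subseteq> U" "emeasure m U < \<infinity>" "measure m (U - A) < \<delta>"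
proof -
  have "emeasure m A < emeasure m A + ennreal \<delta>"
    using A(2) assms(3)
    by (simp add: emeasure_eq_ennreal_measure ennreal_plus[symmetric] ennreal_less_iff del: ennreal_plus)
  moreover have "emeasure m A = (INF U\<in>{U. open U \<and> A \<subseteq> U}. emeasure m U)"
    using radon A(1) unfolding radon_measure_def by blast
  ultimately have "(INF U\<in>{U. open U \<and> A \<subseteq> U}. emeasure m U) < emeasure m A + ennreal \<delta>"
    by (simp only:)
  then have "\<exists>U\<in>{U. open U \<and> A \<subseteq> U}. emeasure m U < emeasure m A + ennreal \<delta>"
    by (simp only: INF_less_iff)
  then obtain U where U: "open U" "A \<subseteq> U" "emeasure m U < emeasure m A + ennreal \<delta>" by blast
  have fin: "emeasure m U < \<infinity>" using U(3) A(2) by (simp add: order.strict_trans)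
  have sets: "U \<in> sets m" using U(1) by (simp add: sets_m)
  have "measure m U < measure m A + \<delta>"
    using U(3) fin A(2) assms(3)
    by (simp add: emeasure_eq_ennreal_measure ennreal_plus[symmetric] ennreal_less_iff del: ennreal_plus)
  moreover have "measure m (U - A) = measure m U - measure m A"
    using fin sets A U(2) by (intro measure_Diff) auto
  ultimately show thesis using that U fin by simp
qed

lemma emeasure_inner_approx:
  assumes U: "open U" "emeasure m U < \<infinity>" and "\<delta> > 0"
  obtains K where "compact K" "K \<subseteq> U" "measure m (U - K) < \<delta>"
proof -
  have sets: "U \<in> sets m" using U(1) by (simp add: sets_m)
  have "\<exists>K. compact K \<and> K \<subseteq> U \<and> measure m U < measure m K + \<delta>"
  proof (cases "measure m U < \<delta>")
    case True
    then show ?thesis by (intro exI[of _ "{}"]) simp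
  next
    case False
    have "ennreal (measure m U - \<delta>) < emeasure m U"
      using False assms(3) U(2) by (simp add: emeasure_eq_ennreal_measure ennreal_less_iff)
    moreover have "emeasure m U = (SUP K\<in>{K. compact K \<and> K \<subseteq> U}. emeasure m K)"
      using radon U(1) unfolding radon_measure_def by blast
    ultimately have "ennreal (measure m U - \<delta>) < (SUP K\<in>{K. compact K \<and> K \<subseteq> U}. emeasure m K)"
      by (simp only:)
    then have "\<exists>K\<in>{K. compact K \<and> K \<subseteq> U}. ennreal (measure m U - \<delta>) < emeasure m K"
      by (simp only: less_SUP_iff)
    then obtain K where K: "compact K" "K \<subseteq> U" "ennreal (measure m U - \<delta>) < emeasure m K" by blast
    then have "measure m U - \<delta> < measure m K"
      using emeasure_compact_finite[OF K(1)] False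
      by (simp add: emeasure_eq_ennreal_measure ennreal_less_iff)
    with K show ?thesis by (intro exI[of _ K]) simp
  qed
  then obtain K where K: "compact K" "K \<subseteq> U" "measure m U < measure m K + \<delta>" by blast
  have "measure m (U - K) = measure m U - measure m K"
    using U sets K emeasure_compact_finite[OF K(1)]
    by (intro measure_Diff) (auto simp: sets_m compact_imp_closed)
  with K that show thesis by simp
qed

text \<open>Outer and inner regularity give an open set \<open>U\<close> and a compact set \<open>K\<close> whose measures are close to that
  of \<open>A\<close>. A finite union of balls fits between them, and its indicator is a test function.\<close>

lemma indicator_in_closure_test_functions:
  assumes A: "A \<in> sets m" "emeasure m A < \<infinity>"
  shows "(indicator A :: 'a \<Rightarrow> complex) \<in> L2_closure m test_functions"
  unfolding L2_closure_def
proof (intro CollectI conjI allI impI)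
  show IA: "(indicator A :: 'a \<Rightarrow> complex) \<in> L2 m" by (rule L2_indicator[OF A])
  fix \<epsilon> :: real assume "\<epsilon> > 0"
  then have \<delta>: "\<epsilon>\<^sup>2 / 2 > 0" by simp
  obtain U where U: "open U" "A \<subseteq> U" "emeasure m U < \<infinity>" "measure m (U - A) < \<epsilon>\<^sup>2 / 2"
    using emeasure_outer_approx[OF A \<delta>] by blast
  obtain K where K: "compact K" "K \<subseteq> U" "measure m (U - K) < \<epsilon>\<^sup>2 / 2"
    using emeasure_inner_approx[OF U(1,3) \<delta>] by blast
  \<comment> \<open>A finite union of balls fits between \<open>K\<close> and \<open>U\<close>.\<close>
  obtain r where r: "r > 0" "\<And>x. x \<in> K \<Longrightarrow> \<exists>G\<in>{U}. ball x r \<subseteq> G"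
    using Heine_Borel_lemma[OF K(1), of "{U}"] K(2) U(1) by auto
  define e where "e = r / 2"
  have e: "e > 0" "e < r" using r(1) by (auto simp: e_def)
  define W where "W = (\<Union>y\<in>K. cball y e)"
  have "K \<subseteq> W" using e by (force simp: W_def)
  have "W \<subseteq> U"
    unfolding W_def
  proof (rule UN_least)
    fix y assume "y \<in> K"
    then have "ball y r \<subseteq> U" using r(2) by auto
    then show "cball y e \<subseteq> U" using e(2) by (auto simp: subset_iff)
  qed
  have "compact W"
    unfolding W_def using finite_cballs_compact[OF K(1) e(1)] compact_cball by (intro compact_Union) auto
  have W: "indicator W \<in> test_functions"
  proof (rule test_functionI[OF e(1) _ \<open>compact W\<close>])
    have *: "y \<in> W" if xy: "x \<in> W" "dist x y \<le> e" for x y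
    proof -
      obtain z where z: "z \<in> K" "x \<in> cball z e" using xy(1) by (auto simp: W_def)
      then have "y \<in> cball z e" using cball_subset_cball[of x z e e] xy(2) by auto
      with z show ?thesis by (auto simp: W_def)
    qed
    have "x \<in> W \<longleftrightarrow> y \<in> W" if "dist x y \<le> e" for x y
      using *[of x y] *[of y x] that by (auto simp: dist_commute)
    then show "const_on_cballs e (indicator W :: 'a \<Rightarrow> complex)"
      unfolding const_on_cballs_def by (simp add: indicator_def)
  qed simp
  then have IW: "(indicator W :: 'a \<Rightarrow> complex) \<in> L2 m" by (rule test_functions_L2)
  have fin: "U - A \<in> sets m" "emeasure m (U - A) < \<infinity>" "U - K \<in> sets m" "emeasure m (U - K) < \<infinity>"
  proof -
    have "U \<in> sets m" "K \<in> sets m" using U(1) K(1) by (auto simp: sets_m compact_imp_closed)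
    then show "U - A \<in> sets m" "U - K \<in> sets m" using A(1) by auto
    have "emeasure m (U - A) \<le> emeasure m U" "emeasure m (U - K) \<le> emeasure m U"
      using \<open>U \<in> sets m\<close> by (auto intro: emeasure_mono)
    with U(3) show "emeasure m (U - A) < \<infinity>" "emeasure m (U - K) < \<infinity>" by auto
  qed
  have "(LINT x|m. (cmod (indicator W x - indicator A x))\<^sup>2)
      \<le> (LINT x|m. indicator (U - A) x + indicator (U - K) x)"
  proof (rule integral_mono)
    show "integrable m (\<lambda>x. (cmod (indicator W x - indicator A x))\<^sup>2)"
      by (intro L2_integrable_square L2_diff IW IA)
    show "integrable m (\<lambda>x. indicator (U - A) x + indicator (U - K) x :: real)"
      using fin by (intro Bochner_Integration.integrable_add integrable_real_indicator)
    show "(cmod (indicator W x - indicator A x))\<^sup>2 \<le> indicator (U - A) x + (indicator (U - K) x :: real)" for x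
      using \<open>K \<subseteq> W\<close> \<open>W \<subseteq> U\<close> \<open>A \<subseteq> U\<close> by (auto simp: indicator_def)
  qed
  also have "\<dots> = measure m (U - A) + measure m (U - K)"
    using fin by (subst Bochner_Integration.integral_add) (auto intro: integrable_real_indicator)
  also have "\<dots> < \<epsilon>\<^sup>2" using U(4) K(3) by simp
  finally have "L2_norm m (\<lambda>x. indicator W x - indicator A x) < \<epsilon>"
    using \<open>\<epsilon> > 0\<close> unfolding L2_norm_def by (simp add: real_less_lsqrt)
  with W IW show "\<exists>u\<in>test_functions. u \<in> L2 m \<and> L2_norm m (\<lambda>x. u x - indicator A x) < \<epsilon>" by blast
qed

lemma simple_function_in_closure_test_functions:
  assumes s: "simple_function m s" "s \<in> L2 m"
  shows "s \<in> L2_closure m test_functions"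
proof -
  have fin: "finite (range s)" using s(1) by (simp add: simple_function_def)
  have comp: "(\<lambda>x. c * indicator (s -` {c}) x) \<in> L2_closure m test_functions" for c
  proof (cases "c = 0")
    case True
    then show ?thesis by (simp add: L2_closure_incl)
  next
    case False
    have meas: "s -` {c} \<in> sets m" using simple_functionD(2)[OF s(1), of "{c}"] by simp
    have "integrable m (indicator (s -` {c}) :: 'a \<Rightarrow> real)"
    proof (rule Bochner_Integration.integrable_bound)
      show "integrable m (\<lambda>x. (cmod (s x))\<^sup>2 / (cmod c)\<^sup>2)"
        using s(2) by (intro Bochner_Integration.integrable_divide L2_integrable_square) simp
      show "AE x in m. norm (indicator (s -` {c}) x :: real) \<le> norm ((cmod (s x))\<^sup>2 / (cmod c)\<^sup>2)"
        using False by (intro AE_I2) (auto simp: indicator_def)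
    qed (use meas in auto)
    then have "emeasure m (s -` {c}) < \<infinity>" by (simp add: integrable_indicator_iff)
    from indicator_in_closure_test_functions[OF meas this]
    have "(\<lambda>x. 0 + c * indicator (s -` {c}) x) \<in> L2_closure m test_functions"
      by (intro L2_closure_comb[OF test_functions_comb L2_closure_incl]) simp_all
    then show ?thesis by simp
  qed
  have "(\<lambda>x. \<Sum>c\<in>C. c * indicator (s -` {c}) x) \<in> L2_closure m test_functions" if "finite C" for C
    using that
  proof induction
    case empty
    then show ?case by (simp add: L2_closure_incl)
  next
    case (insert c C)
    have "(\<lambda>x. c * indicator (s -` {c}) x + 1 * (\<Sum>c\<in>C. c * indicator (s -` {c}) x))
        \<in> L2_closure m test_functions"
      by (rule L2_closure_comb[OF test_functions_comb comp insert.IH])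
    then show ?case by (simp only: sum.insert[OF insert.hyps] mult_1)
  qed
  from this[OF fin] have "(\<lambda>x. \<Sum>c\<in>range s. c * indicator (s -` {c}) x) \<in> L2_closure m test_functions" .
  moreover have "(\<Sum>c\<in>range s. c * indicator (s -` {c}) x) = s x" for x
  proof -
    have "(\<Sum>c\<in>range s. c * indicator (s -` {c}) x) = (\<Sum>c\<in>range s. if c = s x then c else 0)"
      by (intro sum.cong) (auto simp: indicator_def)
    also have "\<dots> = s x" by (subst sum.delta[OF fin]) simp
    finally show ?thesis .
  qed
  ultimately show ?thesis by (simp only:)
qed

text \<open>Simple functions dominated by \<open>2 \<bar>f\<bar>\<close> converge to \<open>f\<close> in \<open>L\<^sup>2\<close> by dominated convergence.\<close>

lemma test_functions_dense:
  assumes f: "f \<in> L2 m"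
  shows "f \<in> L2_closure m test_functions"
proof (rule L2_closure_closed[OF f])
  have [measurable]: "f \<in> borel_measurable m" using f by (simp add: L2_def)
  obtain s where s: "\<And>i. simple_function m (s i)" "\<And>x. (\<lambda>i. s i x) \<longlonglongrightarrow> f x"
      "\<And>i x. cmod (s i x) \<le> 2 * cmod (f x)"
    using borel_measurable_implies_sequence_metric[of f m 0] by auto
  have sm [measurable]: "s i \<in> borel_measurable m" for i
    using s(1) by (rule borel_measurable_simple_function)
  have sL2: "s i \<in> L2 m" for i by (rule L2_bound[OF f sm s(3)])
  have "(\<lambda>i. LINT x|m. (cmod (s i x - f x))\<^sup>2) \<longlonglongrightarrow> (LINT x|m. 0)"
  proof (rule integral_dominated_convergence)
    show "integrable m (\<lambda>x. 9 * (cmod (f x))\<^sup>2)" using f by (simp add: L2_integrable_square)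
    show "AE x in m. (\<lambda>i. (cmod (s i x - f x))\<^sup>2) \<longlonglongrightarrow> 0"
    proof (rule AE_I2)
      fix x
      have "(\<lambda>i. (cmod (s i x - f x))\<^sup>2) \<longlonglongrightarrow> (cmod (f x - f x))\<^sup>2"
        by (intro tendsto_intros s(2))
      then show "(\<lambda>i. (cmod (s i x - f x))\<^sup>2) \<longlonglongrightarrow> 0" by simp
    qed
    show "AE x in m. norm ((cmod (s i x - f x))\<^sup>2) \<le> 9 * (cmod (f x))\<^sup>2" for i
    proof (rule AE_I2)
      fix x
      have "cmod (s i x - f x) \<le> 3 * cmod (f x)"
        using norm_triangle_ineq4[of "s i x" "f x"] s(3)[of i x] by simp
      from power_mono[OF this, of 2] show "norm ((cmod (s i x - f x))\<^sup>2) \<le> 9 * (cmod (f x))\<^sup>2"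
        by (simp add: power_mult_distrib)
    qed
  qed simp_all
  then have lim: "(\<lambda>i. L2_norm m (\<lambda>x. s i x - f x)) \<longlonglongrightarrow> 0"
    unfolding L2_norm_def using tendsto_real_sqrt by fastforce
  fix \<epsilon> :: real assume "\<epsilon> > 0"
  from order_tendstoD(2)[OF lim this] obtain i where "L2_norm m (\<lambda>x. s i x - f x) < \<epsilon>"
    by (auto dest: eventually_happens)
  then show "\<exists>u\<in>L2_closure m test_functions. L2_norm m (\<lambda>x. u x - f x) < \<epsilon>"
    using simple_function_in_closure_test_functions[OF s(1) sL2] by blast
qed

end

section \<open>Averaging over balls of a fixed radius\<close>

definition ball_avg :: "'a::metric_space measure \<Rightarrow> real \<Rightarrow> ('a \<Rightarrow> complex) \<Rightarrow> 'a \<Rightarrow> complex" where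
  "ball_avg m r f x = (LINT y:cball x r|m. f y) / of_real (measure m (cball x r))"

text \<open>For a ball \<open>B\<close> of radius \<open>r\<close> this is the orthogonal projection onto the functions that vanish outside \<open>B\<close>
  and have mean zero.\<close>

definition fluctuation ::
  "'a::metric_space measure \<Rightarrow> real \<Rightarrow> 'a set \<Rightarrow> ('a \<Rightarrow> complex) \<Rightarrow> 'a \<Rightarrow> complex" where
  "fluctuation m r B f x = indicator B x * (f x - ball_avg m r f x)"

lemma L2_set_integrable:
  assumes "f \<in> L2 m" "A \<in> sets m" "emeasure m A < \<infinity>"
  shows "set_integrable m A f"
proof -
  have "integrable m (\<lambda>x. f x * cnj (indicator A x))"
    by (rule L2_integrable_inner[OF assms(1) L2_indicator[OF assms(2,3)]])
  moreover have "f x * cnj (indicator A x) = indicator A x *\<^sub>R f x" for x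
    by (simp add: indicator_def)
  ultimately show ?thesis by (simp add: set_integrable_def)
qed

lemma L2_inner_indicator: "L2_inner m f (indicator A) = (LINT x:A|m. f x)"
proof -
  have "f x * cnj (indicator A x) = indicator A x *\<^sub>R f x" for x
    by (simp add: indicator_def)
  then show ?thesis by (simp add: L2_inner_def set_lebesgue_integral_def)
qed

lemma L2_norm_indicator_power2:
  assumes "A \<in> sets m" "emeasure m A < \<infinity>"
  shows "(L2_norm m (indicator A))\<^sup>2 = measure m A"
proof -
  have "(cmod (indicator A x))\<^sup>2 = (indicator A x :: real)" for x
    by (auto simp: indicator_def)
  moreover have "A \<inter> space m = A" using sets.sets_into_space[OF assms(1)] by blast
  ultimately show ?thesis by (simp add: L2_norm_power2)
qed

lemma set_integral_norm_le_L2: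
  assumes "f \<in> L2 m" "A \<in> sets m" "emeasure m A < \<infinity>"
  shows "cmod (LINT x:A|m. f x) \<le> L2_norm m f * sqrt (measure m A)"
proof -
  have "L2_norm m (indicator A) = sqrt (measure m A)"
    using L2_norm_indicator_power2[OF assms(2,3)] by (metis L2_norm_nonneg real_sqrt_unique)
  then show ?thesis
    using L2_Cauchy_Schwarz[OF assms(1) L2_indicator[OF assms(2,3)]] by (simp add: L2_inner_indicator)
qed

context homogeneous_ultrametric_measure_space
begin

lemma const_on_cballs_set_integrable:
  fixes u :: "'a \<Rightarrow> complex"
  assumes u: "const_on_cballs e u" "e > 0" and r: "r > 0"
  shows "set_integrable m (cball x r) u"
proof -
  let ?w = "\<lambda>y. indicator (cball x r) y * u y"
  have "?w \<in> test_functions"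
  proof (rule test_functionI[OF _ _ compact_cball[of x r]])
    show "min e r > 0" using u r by simp
    show "const_on_cballs (min e r) ?w"
      unfolding const_on_cballs_def
    proof (intro allI impI)
      fix y z :: 'a assume "dist y z \<le> min e r"
      then have "u y = u z" "indicator (cball x r) y = (indicator (cball x r) z :: complex)"
        using const_on_cballsD[OF u(1), of y z] const_on_cballsD[OF const_on_cballs_indicator, of y z r x]
        by auto
      then show "?w y = ?w z" by simp
    qed
  qed simp
  then have "?w \<in> L2 m" by (rule test_functions_L2)
  then have "set_integrable m (cball x r) ?w" by (rule L2_set_integrable) simp_all
  moreover have "indicator (cball x r) y *\<^sub>R ?w y = indicator (cball x r) y *\<^sub>R u y" for y
    by (simp add: indicator_def)
  ultimately show ?thesis by (simp add: set_integrable_def)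
qed

lemma L2_set_integrable_cball: "f \<in> L2 m \<Longrightarrow> set_integrable m (cball x r) f"
  by (rule L2_set_integrable) simp_all

lemma ball_avg_cball_eq: "y \<in> cball x r \<Longrightarrow> ball_avg m r f y = ball_avg m r f x"
  by (simp only: ball_avg_def cball_eq)

lemma ball_avg_const_on_cballs: "const_on_cballs r (ball_avg m r f)"
  unfolding const_on_cballs_def by (auto intro: ball_avg_cball_eq[symmetric])

lemma ball_avg_measurable: "r > 0 \<Longrightarrow> ball_avg m r f \<in> borel_measurable m"
  by (rule const_on_cballs_measurable[OF ball_avg_const_on_cballs])

lemma set_integral_const_on:
  fixes c :: complex
  assumes "A \<in> sets m" "emeasure m A < \<infinity>" "\<And>y. y \<in> A \<Longrightarrow> f y = c"
  shows "(LINT y:A|m. f y) = of_real (measure m A) * c"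
proof -
  have "(LINT y:A|m. f y) = (LINT y:A|m. c)"
    by (rule set_lebesgue_integral_cong) (use assms in auto)
  also have "\<dots> = of_real (measure m A) * c"
    using set_integral_const[of A m c] assms by (simp add: scaleR_conv_of_real)
  finally show ?thesis .
qed

lemma ball_avg_of_const:
  assumes "const_on_cballs e u" "\<rho> \<le> e" "cball x \<rho> \<in> balls"
  shows "ball_avg m \<rho> u x = u x"
proof -
  have "(LINT y:cball x \<rho>|m. u y) = of_real (measure m (cball x \<rho>)) * u x"
  proof (rule set_integral_const_on)
    fix y assume "y \<in> cball x \<rho>"
    then show "u y = u x" using const_on_cballsD[OF assms(1), of y x] assms(2) by (simp add: dist_commute)
  qed simp_all
  then show ?thesis
    using measure_ball_pos[OF assms(3)] by (simp add: ball_avg_def)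
qed

text \<open>A ball of radius \<open>r\<close> is a finite disjoint union of balls of radius \<open>s\<close>, and averaging preserves the
  integral over each of them.\<close>

lemma set_integral_ball_avg:
  fixes f :: "'a \<Rightarrow> complex"
  assumes s: "0 < s" "s \<le> r" and f: "set_integrable m (cball x r) f"
  shows "(LINT y:cball x r|m. ball_avg m s f y) = (LINT y:cball x r|m. f y)"
proof -
  let ?F = "(\<lambda>y. cball y s) ` cball x r"
  have fin: "finite ?F" by (rule finite_cballs_compact[OF compact_cball s(1)])
  have U: "cball x r = (\<Union>T\<in>?F. T)"
  proof (intro subset_antisym subsetI)
    fix z assume "z \<in> cball x r"
    moreover have "z \<in> cball z s" using s by simp
    ultimately show "z \<in> (\<Union>T\<in>?F. T)" by blast
  next
    fix z assume "z \<in> (\<Union>T\<in>?F. T)"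
    then obtain y where "y \<in> cball x r" "z \<in> cball y s" by blast
    then show "z \<in> cball x r" using cball_subset_cball[of y x r s] s(2) by blast
  qed
  have disj: "disjoint_family_on (\<lambda>T. T) ?F"
    unfolding disjoint_family_on_def using cball_disjoint by blast
  have f': "set_integrable m T f" if "T \<in> ?F" for T
    by (rule set_integrable_subset[OF f]) (use that U in auto)
  have g': "set_integrable m T (ball_avg m s f)" if "T \<in> ?F" for T
    using that const_on_cballs_set_integrable[OF ball_avg_const_on_cballs s(1) s(1)] by blast
  have piece: "(LINT y:T|m. ball_avg m s f y) = (LINT y:T|m. f y)" if T: "T \<in> ?F" for T
  proof -
    obtain z where z: "T = cball z s" using T by blast
    have "(LINT y:T|m. ball_avg m s f y) = of_real (measure m T) * ball_avg m s f z"
      unfolding z by (rule set_integral_const_on) (auto intro: ball_avg_cball_eq)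
    also have "\<dots> = (LINT y:T|m. f y)"
      using measure_cball_pos[OF s(1), of z] by (simp add: ball_avg_def z)
    finally show ?thesis .
  qed
  have "(LINT y:(\<Union>T\<in>?F. T)|m. ball_avg m s f y) = (\<Sum>T\<in>?F. LINT y:T|m. ball_avg m s f y)"
    by (rule set_integral_finite_Union[OF fin disj g']) auto
  also have "\<dots> = (\<Sum>T\<in>?F. LINT y:T|m. f y)" by (rule sum.cong[OF refl piece])
  also have "\<dots> = (LINT y:(\<Union>T\<in>?F. T)|m. f y)"
    by (rule set_integral_finite_Union[OF fin disj f', symmetric]) auto
  finally show ?thesis by (simp only: U[symmetric])
qed

lemma ball_avg_diff:
  assumes "set_integrable m (cball x r) f" "set_integrable m (cball x r) g"
  shows "ball_avg m r (\<lambda>y. f y - g y) x = ball_avg m r f x - ball_avg m r g x"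
  using assms by (simp add: ball_avg_def diff_divide_distrib)

text \<open>The balls of radius \<open>r\<close> form a countable partition of the space.\<close>

lemma nn_integral_le_by_cballs:
  fixes h k :: "'a \<Rightarrow> ennreal"
  assumes [measurable]: "h \<in> borel_measurable m" "k \<in> borel_measurable m" and r: "r > 0"
    and le: "\<And>x. (\<integral>\<^sup>+y. h y * indicator (cball x r) y \<partial>m) \<le> (\<integral>\<^sup>+y. k y * indicator (cball x r) y \<partial>m)"
  shows "(\<integral>\<^sup>+y. h y \<partial>m) \<le> (\<integral>\<^sup>+y. k y \<partial>m)"
proof -
  let ?I = "range (\<lambda>y :: 'a. cball y r)"
  \<comment> \<open>The total mass of a density is the sum of its masses over the partition.\<close>
  have U: "(\<Union>T\<in>?I. T) = UNIV" using r by force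
  have disj: "disjoint_family_on (\<lambda>T. T) ?I"
    unfolding disjoint_family_on_def using cball_disjoint by blast
  have total: "(\<integral>\<^sup>+y. g y \<partial>m) = (\<integral>\<^sup>+T. (\<integral>\<^sup>+y. g y * indicator T y \<partial>m) \<partial>count_space ?I)"
    if [measurable]: "g \<in> borel_measurable m" for g
  proof -
    have "(\<integral>\<^sup>+y. g y \<partial>m) = emeasure (density m g) (\<Union>T\<in>?I. T)"
      unfolding U by (subst emeasure_density) (auto simp: sets_m)
    also have "\<dots> = (\<integral>\<^sup>+T. emeasure (density m g) T \<partial>count_space ?I)"
      by (rule emeasure_UN_countable[OF _ countable_cballs[OF r] disj]) auto
    also have "\<dots> = (\<integral>\<^sup>+T. (\<integral>\<^sup>+y. g y * indicator T y \<partial>m) \<partial>count_space ?I)"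
      by (intro nn_integral_cong emeasure_density) auto
    finally show ?thesis .
  qed
  show ?thesis
    unfolding total[OF assms(1)] total[OF assms(2)]
    by (rule nn_integral_mono) (use le in auto)
qed

lemma cmod_ball_avg_power2_le:
  assumes f: "f \<in> L2 m" and r: "r > 0"
  shows "measure m (cball x r) * (cmod (ball_avg m r f x))\<^sup>2
    \<le> (L2_norm m (\<lambda>y. indicator (cball x r) y * f y))\<^sup>2"
proof -
  let ?B = "cball x r" and ?\<mu> = "measure m (cball x r)"
  let ?g = "\<lambda>y. indicator ?B y * f y"
  have \<mu>: "?\<mu> > 0" by (rule measure_cball_pos[OF r])
  have g: "?g \<in> L2 m" by (rule L2_indicator_mult[OF f]) simp
  have "(LINT y:?B|m. f y) = (LINT y:?B|m. ?g y)"
    by (rule set_lebesgue_integral_cong) auto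
  then have "cmod (LINT y:?B|m. f y) \<le> L2_norm m ?g * sqrt ?\<mu>"
    using set_integral_norm_le_L2[OF g, of ?B] by simp
  then have "(cmod (LINT y:?B|m. f y))\<^sup>2 \<le> (L2_norm m ?g * sqrt ?\<mu>)\<^sup>2"
    by (intro power_mono) auto
  also have "\<dots> = (L2_norm m ?g)\<^sup>2 * ?\<mu>" using \<mu> by (simp add: power_mult_distrib)
  finally have "(cmod (LINT y:?B|m. f y))\<^sup>2 / ?\<mu> \<le> (L2_norm m ?g)\<^sup>2"
    using \<mu> by (simp add: field_simps)
  moreover have "?\<mu> * (cmod (ball_avg m r f x))\<^sup>2 = (cmod (LINT y:?B|m. f y))\<^sup>2 / ?\<mu>"
    using \<mu> by (simp add: ball_avg_def norm_divide power_divide power2_eq_square)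
  ultimately show ?thesis by simp
qed

lemma ball_avg_L2_nn_integral_le:
  assumes f: "f \<in> L2 m" and r: "r > 0"
  shows "(\<integral>\<^sup>+y. ennreal ((cmod (ball_avg m r f y))\<^sup>2) \<partial>m) \<le> (\<integral>\<^sup>+y. ennreal ((cmod (f y))\<^sup>2) \<partial>m)"
proof (rule nn_integral_le_by_cballs[OF _ _ r])
  have [measurable]: "f \<in> borel_measurable m" "ball_avg m r f \<in> borel_measurable m"
    using f ball_avg_measurable[OF r] by (auto simp: L2_def)
  show "(\<lambda>y. ennreal ((cmod (ball_avg m r f y))\<^sup>2)) \<in> borel_measurable m"
    "(\<lambda>y. ennreal ((cmod (f y))\<^sup>2)) \<in> borel_measurable m" by measurable
  fix x
  let ?B = "cball x r" and ?g = "\<lambda>y. indicator (cball x r) y * f y"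
  have g: "?g \<in> L2 m" by (rule L2_indicator_mult[OF f]) simp
  have "(\<integral>\<^sup>+y. ennreal ((cmod (ball_avg m r f y))\<^sup>2) * indicator ?B y \<partial>m)
      = (\<integral>\<^sup>+y. ennreal ((cmod (ball_avg m r f x))\<^sup>2) * indicator ?B y \<partial>m)"
  proof (rule nn_integral_cong)
    fix y
    show "ennreal ((cmod (ball_avg m r f y))\<^sup>2) * indicator ?B y
        = ennreal ((cmod (ball_avg m r f x))\<^sup>2) * indicator ?B y"
      using ball_avg_cball_eq[of y x r f] by (cases "y \<in> ?B") simp_all
  qed
  also have "\<dots> = ennreal ((cmod (ball_avg m r f x))\<^sup>2) * emeasure m ?B"
    by (simp add: nn_integral_cmult_indicator)
  also have "\<dots> = ennreal (measure m ?B * (cmod (ball_avg m r f x))\<^sup>2)"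
    by (simp add: emeasure_eq_ennreal_measure ennreal_mult mult.commute)
  also have "\<dots> \<le> ennreal ((L2_norm m ?g)\<^sup>2)"
    by (rule ennreal_leI[OF cmod_ball_avg_power2_le[OF f r]])
  also have "\<dots> = (\<integral>\<^sup>+y. ennreal ((cmod (?g y))\<^sup>2) \<partial>m)"
    unfolding L2_norm_power2
    by (rule nn_integral_eq_integral[symmetric, OF L2_integrable_square[OF g]]) simp
  also have "\<dots> = (\<integral>\<^sup>+y. ennreal ((cmod (f y))\<^sup>2) * indicator ?B y \<partial>m)"
    by (intro nn_integral_cong) (simp add: indicator_def)
  finally show "(\<integral>\<^sup>+y. ennreal ((cmod (ball_avg m r f y))\<^sup>2) * indicator ?B y \<partial>m)
      \<le> (\<integral>\<^sup>+y. ennreal ((cmod (f y))\<^sup>2) * indicator ?B y \<partial>m)" .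
qed

text \<open>The Cauchy-Schwarz inequality on each ball of radius \<open>r\<close>, summed over all these balls.\<close>

lemma ball_avg_contraction:
  assumes f: "f \<in> L2 m" and r: "r > 0"
  shows "ball_avg m r f \<in> L2 m" "L2_norm m (ball_avg m r f) \<le> L2_norm m f"
proof -
  have meas [measurable]: "ball_avg m r f \<in> borel_measurable m" by (rule ball_avg_measurable[OF r])
  have f_nn: "(\<integral>\<^sup>+y. ennreal ((cmod (f y))\<^sup>2) \<partial>m) = ennreal (LINT y|m. (cmod (f y))\<^sup>2)"
    by (rule nn_integral_eq_integral[OF L2_integrable_square[OF f]]) simp
  have le: "(\<integral>\<^sup>+y. ennreal ((cmod (ball_avg m r f y))\<^sup>2) \<partial>m) \<le> ennreal (LINT y|m. (cmod (f y))\<^sup>2)"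
    using ball_avg_L2_nn_integral_le[OF f r] by (simp only: f_nn)
  have int: "integrable m (\<lambda>y. (cmod (ball_avg m r f y))\<^sup>2)"
  proof (rule integrableI_bounded)
    show "(\<integral>\<^sup>+y. ennreal (norm ((cmod (ball_avg m r f y))\<^sup>2)) \<partial>m) < \<infinity>"
      using le by (simp add: le_less_trans)
  qed measurable
  then show "ball_avg m r f \<in> L2 m" using meas by (simp add: L2_def)
  have "ennreal (LINT y|m. (cmod (ball_avg m r f y))\<^sup>2) \<le> ennreal (LINT y|m. (cmod (f y))\<^sup>2)"
    using le nn_integral_eq_integral[OF int] by simp
  then show "L2_norm m (ball_avg m r f) \<le> L2_norm m f"
    by (simp add: L2_norm_def ennreal_le_iff)
qed

lemma ball_avg_operator: "r > 0 \<Longrightarrow> L2_operator m (ball_avg m r)"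
  unfolding L2_operator_def
proof (intro conjI ballI exI[of _ 1])
  fix f g assume "f \<in> L2 m" "g \<in> L2 m"
  then show "ball_avg m r (\<lambda>x. f x - g x) = (\<lambda>x. ball_avg m r f x - ball_avg m r g x)"
    by (intro ext ball_avg_diff L2_set_integrable_cball)
qed (simp_all add: ball_avg_contraction)

lemma fluctuation_operator:
  assumes r: "r > 0" and B: "B \<in> sets m"
  shows "L2_operator m (fluctuation m r B)"
  unfolding L2_operator_def
proof (intro conjI ballI exI[of _ 2])
  have L2: "(\<lambda>x. f x - ball_avg m r f x) \<in> L2 m" if "f \<in> L2 m" for f
    using that r by (intro L2_diff ball_avg_contraction)
  show *: "fluctuation m r B f \<in> L2 m" if "f \<in> L2 m" for f
    unfolding fluctuation_def[abs_def] by (rule L2_indicator_mult[OF L2[OF that] B])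
  fix f assume f: "f \<in> L2 m"
  have "L2_norm m (fluctuation m r B f) \<le> L2_norm m (\<lambda>x. f x - ball_avg m r f x)"
  proof (rule L2_norm_mono[OF L2[OF f]])
    show "fluctuation m r B f \<in> borel_measurable m" using *[OF f] by (simp add: L2_def)
    show "cmod (fluctuation m r B f x) \<le> cmod (f x - ball_avg m r f x)" for x
      by (simp add: fluctuation_def indicator_def)
  qed
  also have "\<dots> \<le> L2_norm m (\<lambda>x. f x - 0) + L2_norm m (\<lambda>x. 0 - ball_avg m r f x)"
    by (rule L2_norm_triangle_diff[OF f L2_zero ball_avg_contraction(1)[OF f r]])
  also have "\<dots> \<le> 2 * L2_norm m f"
    using ball_avg_contraction(2)[OF f r] L2_norm_minus_commute[of m "\<lambda>x. 0" "ball_avg m r f"] by simp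
  finally show "L2_norm m (fluctuation m r B f) \<le> 2 * L2_norm m f" .
  fix g assume g: "g \<in> L2 m"
  show "fluctuation m r B (\<lambda>x. f x - g x) = (\<lambda>x. fluctuation m r B f x - fluctuation m r B g x)"
    by (simp add: fluctuation_def[abs_def] ball_avg_diff L2_set_integrable_cball f g algebra_simps)
qed

end

section \<open>The hierarchical Laplacian on test functions\<close>

locale weighted_ultrametric_space = homogeneous_ultrametric_measure_space m
  for m :: "'a::metric_space measure" +
  fixes C :: "'a set \<Rightarrow> real"
  assumes weights: "homogeneous_weights C"
begin

lemma weight_pos: "B \<in> balls \<Longrightarrow> C B > 0"
  and weight_eq: "A \<in> balls \<Longrightarrow> B \<in> balls \<Longrightarrow> diameter A = diameter B \<Longrightarrow> C A = C B"
  and weight_summable: "B \<in> balls \<Longrightarrow> C summable_on {T\<in>balls. B \<subseteq> T}"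
  using weights unfolding homogeneous_weights_def by blast+

lemma weight_cball_eq:
  assumes "\<rho> \<in> radii z"
  shows "C (cball x \<rho>) = C (cball z \<rho>)"
  by (rule weight_eq) (simp_all add: radii_cball[OF assms])

lemma weights_summable:
  assumes "a > 0"
  shows "(\<lambda>\<rho>. C (cball z \<rho>)) summable_on {\<rho>\<in>radii z. a \<le> \<rho>}"
proof -
  let ?R = "{\<rho>\<in>radii z. a \<le> \<rho>}"
  have inj: "inj_on (cball z) ?R"
    using bij_betw_radii[of z] by (auto simp: bij_betw_def inj_on_def)
  have "C summable_on {T\<in>balls. cball z a \<subseteq> T}"
    by (rule weight_summable[OF balls_cball[OF assms]])
  moreover have "cball z ` ?R \<subseteq> {T\<in>balls. cball z a \<subseteq> T}"
    using radii_cball(1) by (auto intro: subset_cball)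
  ultimately have "C summable_on cball z ` ?R" by (rule summable_on_subset_banach)
  then show ?thesis by (simp add: summable_on_reindex[OF inj] comp_def)
qed

lemma laplacian_eq_radii_sum:
  "laplacian_fun m C f x =
     (\<Sum>\<^sub>\<infinity>\<rho>\<in>radii z. of_real (C (cball z \<rho>)) * (f x - ball_avg m \<rho> f x))"
proof -
  have "laplacian_fun m C f x =
      (\<Sum>\<^sub>\<infinity>\<rho>\<in>radii x. of_real (C (cball x \<rho>)) * (f x - ball_avg m \<rho> f x))"
    unfolding laplacian_fun_def ball_avg_def
    by (rule infsum_reindex_bij_betw[OF bij_betw_radii, symmetric])
  also have "\<dots> = (\<Sum>\<^sub>\<infinity>\<rho>\<in>radii z. of_real (C (cball z \<rho>)) * (f x - ball_avg m \<rho> f x))"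
    unfolding radii_eq[of x z] by (intro infsum_cong) (simp only: weight_cball_eq[of _ z x])
  finally show ?thesis .
qed

text \<open>For a diameter \<open>r\<close> this is the number \<open>\<lambda>(B)\<close> of the balls \<open>B\<close> of diameter \<open>r\<close>; it does not depend on \<open>z\<close>.\<close>

definition tail_weight :: "'a \<Rightarrow> real \<Rightarrow> complex" where
  "tail_weight z r = (\<Sum>\<^sub>\<infinity>\<rho>\<in>{\<rho>\<in>radii z. r \<le> \<rho>}. of_real (C (cball z \<rho>)))"

lemma test_function_bounded:
  fixes u :: "'a \<Rightarrow> complex"
  assumes "u \<in> test_functions"
  obtains M where "M \<ge> 0" "\<And>x. cmod (u x) \<le> M"
proof -
  obtain e K where u: "e > 0" "const_on_cballs e u" "compact K" "\<And>x. x \<notin> K \<Longrightarrow> u x = 0"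
    using assms by (rule test_functionE) blast
  have "continuous_on K u"
    using const_on_cballs_continuous[OF u(2,1)] by (rule continuous_on_subset) simp
  from compact_imp_bounded[OF compact_continuous_image[OF this u(3)]]
  obtain M where M: "\<And>x. x \<in> K \<Longrightarrow> cmod (u x) \<le> M" by (auto simp: bounded_iff)
  show thesis
  proof
    show "max M 0 \<ge> 0" by simp
    show "cmod (u x) \<le> max M 0" for x
      using M[of x] u(4)[of x] by (cases "x \<in> K") auto
  qed
qed

lemma cmod_ball_avg_le:
  assumes u: "u \<in> test_functions" and M: "\<And>x. cmod (u x) \<le> M" and B: "cball x \<rho> \<in> balls"
  shows "cmod (ball_avg m \<rho> u x) \<le> M"
proof -
  let ?B = "cball x \<rho>"
  have \<mu>: "measure m ?B > 0" by (rule measure_ball_pos[OF B])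
  have int: "integrable m (\<lambda>y. indicator ?B y *\<^sub>R u y)"
    using L2_set_integrable_cball[OF test_functions_L2[OF u]] by (simp add: set_integrable_def)
  have "cmod (LINT y:?B|m. u y) \<le> (LINT y|m. cmod (indicator ?B y *\<^sub>R u y))"
    unfolding set_lebesgue_integral_def by (rule integral_norm_bound)
  also have "\<dots> \<le> (LINT y|m. indicator ?B y * M)"
  proof (rule integral_mono)
    show "integrable m (\<lambda>y. cmod (indicator ?B y *\<^sub>R u y))" using int by (rule integrable_norm)
    show "integrable m (\<lambda>y. indicator ?B y * M)"
      by (intro integrable_mult_left integrable_real_indicator) simp_all
    show "cmod (indicator ?B y *\<^sub>R u y) \<le> indicator ?B y * M" for y
      using M[of y] by (simp add: indicator_def)
  qed
  also have "\<dots> = measure m ?B * M" by simp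
  finally show ?thesis
    using \<mu> by (simp add: ball_avg_def norm_divide field_simps)
qed

lemma ball_avg_coarser_zero:
  assumes w: "w \<in> L2 m" and r: "0 < r" "r \<le> \<rho>" and avg: "ball_avg m r w = (\<lambda>x. 0)"
  shows "ball_avg m \<rho> w x = 0"
proof -
  have "(LINT y:cball x \<rho>|m. w y) = (LINT y:cball x \<rho>|m. ball_avg m r w y)"
    by (rule set_integral_ball_avg[OF r L2_set_integrable_cball[OF w], symmetric])
  also have "\<dots> = 0" unfolding avg by (simp add: set_lebesgue_integral_def)
  finally show ?thesis by (simp add: ball_avg_def)
qed

lemma laplacian_high_summable:
  assumes u: "u \<in> test_functions" and r: "r > 0"
  shows "(\<lambda>\<rho>. of_real (C (cball z \<rho>)) * ball_avg m \<rho> u x) summable_on {\<rho>\<in>radii z. r \<le> \<rho>}"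
proof (rule abs_summable_summable)
  obtain M where M: "M \<ge> 0" "\<And>x. cmod (u x) \<le> M" using test_function_bounded[OF u] by blast
  have Cpos: "C (cball z \<rho>) > 0" if "\<rho> \<in> radii z" for \<rho>
    by (rule weight_pos[OF radii_cball(1)[OF that]])
  show "(\<lambda>\<rho>. norm (of_real (C (cball z \<rho>)) * ball_avg m \<rho> u x)) summable_on {\<rho>\<in>radii z. r \<le> \<rho>}"
  proof (rule Infinite_Sum.abs_summable_on_comparison_test')
    show "(\<lambda>\<rho>. C (cball z \<rho>) * M) summable_on {\<rho>\<in>radii z. r \<le> \<rho>}"
      by (intro summable_on_cmult_left weights_summable r)
    fix \<rho> assume "\<rho> \<in> {\<rho>\<in>radii z. r \<le> \<rho>}"
    then have \<rho>: "\<rho> \<in> radii z" by simp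
    show "norm (of_real (C (cball z \<rho>)) * ball_avg m \<rho> u x) \<le> C (cball z \<rho>) * M"
      unfolding norm_mult
      using Cpos[OF \<rho>] cmod_ball_avg_le[OF u M(2) radii_cball(1)[OF \<rho>], of x]
      by (auto intro!: mult_mono)
  qed
qed

text \<open>On a ball of radius \<open>r\<close> the large balls contribute \<open>tail_weight z r * u\<close> minus a constant,
  and only finitely many small balls contribute, each with a term of mean zero.\<close>

lemma laplacian_local_form:
  assumes u: "u \<in> test_functions" and r: "r > 0"
  obtains e F t where "e > 0" "e \<le> r" "const_on_cballs e u" "finite F" "F \<subseteq> {\<rho>\<in>radii z. e \<le> \<rho> \<and> \<rho> < r}"
    "const_on_cballs r t" "ball_avg m r u = (\<lambda>x. 0) \<longrightarrow> t = (\<lambda>x. 0)"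
    "\<forall>x. (\<lambda>\<rho>. of_real (C (cball z \<rho>)) * (u x - ball_avg m \<rho> u x)) summable_on radii z"
    "\<forall>x. laplacian_fun m C u x = (\<Sum>\<rho>\<in>F. of_real (C (cball z \<rho>)) * (u x - ball_avg m \<rho> u x))
       + tail_weight z r * u x - t x"
proof -
  obtain e0 where e0: "e0 > 0" "const_on_cballs e0 u" using u by (rule test_functionE) blast
  define e where "e = min e0 r"
  have e: "e > 0" "e \<le> r" "const_on_cballs e u"
    using e0 r const_on_cballs_mono[OF e0(2)] by (auto simp: e_def)
  define Lo Hi F where "Lo = {\<rho>\<in>radii z. \<rho> < r}" and "Hi = {\<rho>\<in>radii z. r \<le> \<rho>}"
    and "F = {\<rho>\<in>radii z. e \<le> \<rho> \<and> \<rho> < r}"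
  define c where "c \<rho> = (of_real (C (cball z \<rho>)) :: complex)" for \<rho>
  define t where "t x = (\<Sum>\<^sub>\<infinity>\<rho>\<in>Hi. c \<rho> * ball_avg m \<rho> u x)" for x
  have F: "finite F"
    by (rule finite_subset[OF _ finite_radii[OF e(1), of z r]]) (auto simp: F_def)
  have zero: "c \<rho> * (u x - ball_avg m \<rho> u x) = 0" if "\<rho> \<in> Lo - F" for \<rho> x
  proof -
    have "\<rho> \<in> radii z" "\<rho> \<le> e" using that by (auto simp: Lo_def F_def)
    then show ?thesis using ball_avg_of_const[OF e(3)] radii_cball(1) by simp
  qed
  have lo_sum: "(\<Sum>\<^sub>\<infinity>\<rho>\<in>Lo. c \<rho> * (u x - ball_avg m \<rho> u x)) = (\<Sum>\<rho>\<in>F. c \<rho> * (u x - ball_avg m \<rho> u x))" for x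
  proof -
    have "(\<Sum>\<^sub>\<infinity>\<rho>\<in>Lo. c \<rho> * (u x - ball_avg m \<rho> u x)) = (\<Sum>\<^sub>\<infinity>\<rho>\<in>F. c \<rho> * (u x - ball_avg m \<rho> u x))"
      by (rule infsum_cong_neutral) (use zero in \<open>auto simp: Lo_def F_def\<close>)
    then show ?thesis using F by simp
  qed
  have lo_summable: "(\<lambda>\<rho>. c \<rho> * (u x - ball_avg m \<rho> u x)) summable_on Lo" for x
  proof -
    have "(\<lambda>\<rho>. c \<rho> * (u x - ball_avg m \<rho> u x)) summable_on F" using F by simp
    also have "?this \<longleftrightarrow> ?thesis"
      by (rule summable_on_cong_neutral) (use zero in \<open>auto simp: Lo_def F_def\<close>)
    finally show ?thesis .
  qed
  have avg_summable: "(\<lambda>\<rho>. c \<rho> * ball_avg m \<rho> u x) summable_on Hi" for x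
    unfolding c_def Hi_def by (rule laplacian_high_summable[OF u r])
  have c_summable: "c summable_on Hi"
    using summable_on_of_real[OF weights_summable[OF r, of z]] by (simp add: c_def[abs_def] Hi_def)
  have cu_summable: "(\<lambda>\<rho>. c \<rho> * u x) summable_on Hi" for x
    by (rule summable_on_cmult_left[OF c_summable])
  have minus_summable: "(\<lambda>\<rho>. (-1) * (c \<rho> * ball_avg m \<rho> u x)) summable_on Hi" for x
    by (rule summable_on_cmult_right[OF avg_summable])
  have hi_eq: "c \<rho> * (u x - ball_avg m \<rho> u x) = c \<rho> * u x + (-1) * (c \<rho> * ball_avg m \<rho> u x)" for \<rho> x
    by (simp add: algebra_simps)
  have hi_summable: "(\<lambda>\<rho>. c \<rho> * (u x - ball_avg m \<rho> u x)) summable_on Hi" for x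
    unfolding hi_eq by (rule summable_on_add[OF cu_summable minus_summable])
  have hi_sum: "(\<Sum>\<^sub>\<infinity>\<rho>\<in>Hi. c \<rho> * (u x - ball_avg m \<rho> u x)) = tail_weight z r * u x - t x" for x
  proof -
    have "(\<Sum>\<^sub>\<infinity>\<rho>\<in>Hi. c \<rho> * (u x - ball_avg m \<rho> u x))
        = (\<Sum>\<^sub>\<infinity>\<rho>\<in>Hi. c \<rho> * u x) + (\<Sum>\<^sub>\<infinity>\<rho>\<in>Hi. (-1) * (c \<rho> * ball_avg m \<rho> u x))"
      unfolding hi_eq by (rule infsum_add[OF cu_summable minus_summable])
    also have "(\<Sum>\<^sub>\<infinity>\<rho>\<in>Hi. c \<rho> * u x) = tail_weight z r * u x"
      unfolding infsum_cmult_left' by (simp add: tail_weight_def c_def Hi_def)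
    also have "(\<Sum>\<^sub>\<infinity>\<rho>\<in>Hi. (-1) * (c \<rho> * ball_avg m \<rho> u x)) = - t x"
      unfolding infsum_cmult_right' by (simp add: t_def)
    finally show ?thesis by simp
  qed
  have split: "radii z = Lo \<union> Hi" "Lo \<inter> Hi = {}" by (auto simp: Lo_def Hi_def)
  show thesis
  proof (rule that)
    show "F \<subseteq> {\<rho>\<in>radii z. e \<le> \<rho> \<and> \<rho> < r}" by (simp add: F_def)
    show "const_on_cballs r t"
      unfolding const_on_cballs_def
    proof (intro allI impI)
      fix x y :: 'a assume d: "dist x y \<le> r"
      show "t x = t y"
        unfolding t_def
      proof (rule infsum_cong)
        fix \<rho> assume "\<rho> \<in> Hi"
        then have "dist x y \<le> \<rho>" using d by (simp add: Hi_def)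
        then show "c \<rho> * ball_avg m \<rho> u x = c \<rho> * ball_avg m \<rho> u y"
          using const_on_cballsD[OF ball_avg_const_on_cballs] by metis
      qed
    qed
    show "ball_avg m r u = (\<lambda>x. 0) \<longrightarrow> t = (\<lambda>x. 0)"
    proof (intro impI ext)
      fix x
      assume avg: "ball_avg m r u = (\<lambda>x. 0)"
      have "ball_avg m \<rho> u x = 0" if "\<rho> \<in> Hi" for \<rho>
        using that by (intro ball_avg_coarser_zero[OF test_functions_L2[OF u] r _ avg]) (simp add: Hi_def)
      then have "t x = (\<Sum>\<^sub>\<infinity>\<rho>\<in>Hi. 0)"
        unfolding t_def by (intro infsum_cong) simp
      then show "t x = 0" by simp
    qed
    show "\<forall>x. (\<lambda>\<rho>. of_real (C (cball z \<rho>)) * (u x - ball_avg m \<rho> u x)) summable_on radii z"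
      unfolding split(1) c_def[symmetric]
      by (intro allI summable_on_Un_disjoint[OF lo_summable hi_summable split(2)])
    show "\<forall>x. laplacian_fun m C u x = (\<Sum>\<rho>\<in>F. of_real (C (cball z \<rho>)) * (u x - ball_avg m \<rho> u x))
        + tail_weight z r * u x - t x"
      unfolding laplacian_eq_radii_sum[of u _ z] split(1) c_def[symmetric]
      by (subst infsum_Un_disjoint[OF lo_summable hi_summable split(2)]) (simp add: lo_sum hi_sum)
  qed (use e F in auto)
qed

lemma laplacian_summable:
  assumes "u \<in> test_functions"
  shows "(\<lambda>\<rho>. of_real (C (cball z \<rho>)) * (u x - ball_avg m \<rho> u x)) summable_on radii z"
  using laplacian_local_form[OF assms zero_less_one, where z = z] by metis

lemma ball_avg_comb:
  assumes "set_integrable m (cball x r) f" "set_integrable m (cball x r) g"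
  shows "ball_avg m r (\<lambda>y. f y + c * g y) x = ball_avg m r f x + c * ball_avg m r g x"
  using set_integral_add(2)[OF assms(1) set_integrable_mult_right[OF assms(2), of c]]
  by (simp add: ball_avg_def add_divide_distrib)

lemma laplacian_comb:
  assumes u: "u \<in> test_functions" and v: "v \<in> test_functions"
  shows "laplacian_fun m C (\<lambda>x. u x + c * v x) x = laplacian_fun m C u x + c * laplacian_fun m C v x"
proof -
  let ?t = "\<lambda>u \<rho>. of_real (C (cball x \<rho>)) * (u x - ball_avg m \<rho> u x)"
  have "?t (\<lambda>x. u x + c * v x) \<rho> = ?t u \<rho> + c * ?t v \<rho>" for \<rho>
    unfolding ball_avg_comb[OF L2_set_integrable_cball[OF test_functions_L2[OF u]]
        L2_set_integrable_cball[OF test_functions_L2[OF v]]]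
    by (simp add: algebra_simps)
  then have "laplacian_fun m C (\<lambda>x. u x + c * v x) x = (\<Sum>\<^sub>\<infinity>\<rho>\<in>radii x. ?t u \<rho> + c * ?t v \<rho>)"
    unfolding laplacian_eq_radii_sum[of _ x x] by (simp only:)
  also have "\<dots> = (\<Sum>\<^sub>\<infinity>\<rho>\<in>radii x. ?t u \<rho>) + (\<Sum>\<^sub>\<infinity>\<rho>\<in>radii x. c * ?t v \<rho>)"
    by (intro infsum_add laplacian_summable u summable_on_cmult_right v)
  finally show ?thesis unfolding laplacian_eq_radii_sum[of _ x x] infsum_cmult_right' .
qed

lemma laplacian_const_on_cballs:
  assumes u: "u \<in> test_functions"
  obtains e where "e > 0" "const_on_cballs e (laplacian_fun m C u)"
proof -
  fix z :: 'a
  obtain e F t where *: "e > 0" "e \<le> (1::real)" "const_on_cballs e u" "finite F"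
    "F \<subseteq> {\<rho>\<in>radii z. e \<le> \<rho> \<and> \<rho> < 1}" "const_on_cballs 1 t"
    "ball_avg m 1 u = (\<lambda>x. 0) \<longrightarrow> t = (\<lambda>x. 0)"
    "\<forall>x. (\<lambda>\<rho>. of_real (C (cball z \<rho>)) * (u x - ball_avg m \<rho> u x)) summable_on radii z"
    "\<forall>x. laplacian_fun m C u x = (\<Sum>\<rho>\<in>F. of_real (C (cball z \<rho>)) * (u x - ball_avg m \<rho> u x))
       + tail_weight z 1 * u x - t x"
    by (rule laplacian_local_form[OF u zero_less_one, where z = z])
  show thesis
  proof (rule that[OF *(1)])
    show "const_on_cballs e (laplacian_fun m C u)"
      unfolding const_on_cballs_def
    proof (intro allI impI)
      fix x y :: 'a assume d: "dist x y \<le> e"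
      have "u x = u y" "t x = t y"
        using const_on_cballsD[OF *(3) d] const_on_cballsD[OF *(6), of x y] d *(2) by auto
      moreover have "ball_avg m \<rho> u x = ball_avg m \<rho> u y" if "\<rho> \<in> F" for \<rho>
        using const_on_cballsD[OF ball_avg_const_on_cballs, of x y \<rho>] that *(5) d by auto
      ultimately show "laplacian_fun m C u x = laplacian_fun m C u y"
        unfolding *(9)[rule_format] by (simp cong: sum.cong)
    qed
  qed
qed

lemma laplacian_set_integrable:
  "u \<in> test_functions \<Longrightarrow> r > 0 \<Longrightarrow> set_integrable m (cball x r) (laplacian_fun m C u)"
  by (metis laplacian_const_on_cballs const_on_cballs_set_integrable)

text \<open>The constant \<open>t\<close> is the same for every radius \<open>s\<close> such that no ball lies strictly between the radii
  \<open>s\<close> and \<open>r\<close>. This applies to a ball and its parent.\<close>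

lemma laplacian_integral:
  assumes u: "u \<in> test_functions" and r: "r > 0"
  obtains t where "const_on_cballs r t" "ball_avg m r u = (\<lambda>x. 0) \<longrightarrow> t = (\<lambda>x. 0)"
    "\<forall>y s. 0 < s \<longrightarrow> s \<le> r \<longrightarrow> (\<forall>\<rho>\<in>radii y. \<rho> < r \<longrightarrow> \<rho> \<le> s) \<longrightarrow>
       (LINT x:cball y s|m. laplacian_fun m C u x)
         = tail_weight z r * (LINT x:cball y s|m. u x) - of_real (measure m (cball y s)) * t y"
proof -
  obtain e F t where *: "e > 0" "e \<le> r" "const_on_cballs e u" "finite F"
    "F \<subseteq> {\<rho>\<in>radii z. e \<le> \<rho> \<and> \<rho> < r}" "const_on_cballs r t"
    "ball_avg m r u = (\<lambda>x. 0) \<longrightarrow> t = (\<lambda>x. 0)"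
    "\<forall>x. (\<lambda>\<rho>. of_real (C (cball z \<rho>)) * (u x - ball_avg m \<rho> u x)) summable_on radii z"
    "\<forall>x. laplacian_fun m C u x = (\<Sum>\<rho>\<in>F. of_real (C (cball z \<rho>)) * (u x - ball_avg m \<rho> u x))
       + tail_weight z r * u x - t x"
    by (rule laplacian_local_form[OF u r, where z = z])
  show thesis
  proof (rule that[OF *(6,7)], intro allI impI)
    fix y :: 'a and s assume s: "0 < s" "s \<le> r" and gap: "\<forall>\<rho>\<in>radii y. \<rho> < r \<longrightarrow> \<rho> \<le> s"
    let ?B = "cball y s" and ?c = "\<lambda>\<rho>. (of_real (C (cball z \<rho>)) :: complex)"
    have iu: "set_integrable m ?B u" by (rule L2_set_integrable_cball[OF test_functions_L2[OF u]])
    have F: "\<rho> > 0 \<and> \<rho> \<le> s" if "\<rho> \<in> F" for \<rho>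
      using *(1,5) that gap radii_eq[of z y] by force
    have iavg: "set_integrable m ?B (ball_avg m \<rho> u)" if "\<rho> \<in> F" for \<rho>
      by (rule const_on_cballs_set_integrable[OF ball_avg_const_on_cballs _ s(1)]) (use F[OF that] in simp)
    have it: "set_integrable m ?B t" by (rule const_on_cballs_set_integrable[OF *(6) r s(1)])
    have term_int: "set_integrable m ?B (\<lambda>x. ?c \<rho> * (u x - ball_avg m \<rho> u x))" if "\<rho> \<in> F" for \<rho>
      by (intro set_integrable_mult_right impI set_integral_diff(1) iu iavg that)
    have term_zero: "(LINT x:?B|m. ?c \<rho> * (u x - ball_avg m \<rho> u x)) = 0" if "\<rho> \<in> F" for \<rho>
      using set_integral_diff(2)[OF iu iavg[OF that]] set_integral_ball_avg[OF _ _ iu, of \<rho>] F[OF that]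
      by simp
    have sum_int: "set_integrable m ?B (\<lambda>x. \<Sum>\<rho>\<in>F. ?c \<rho> * (u x - ball_avg m \<rho> u x))"
      using term_int unfolding set_integrable_def by (simp add: scaleR_sum_right)
    have sum_zero: "(LINT x:?B|m. (\<Sum>\<rho>\<in>F. ?c \<rho> * (u x - ball_avg m \<rho> u x))) = 0"
    proof -
      have "(LINT x:?B|m. (\<Sum>\<rho>\<in>F. ?c \<rho> * (u x - ball_avg m \<rho> u x)))
          = (\<Sum>\<rho>\<in>F. LINT x:?B|m. ?c \<rho> * (u x - ball_avg m \<rho> u x))"
        using term_int unfolding set_lebesgue_integral_def set_integrable_def
        by (simp only: scaleR_sum_right Bochner_Integration.integral_sum)
      also have "\<dots> = 0" by (rule sum.neutral) (use term_zero in blast)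
      finally show ?thesis .
    qed
    have ilam: "set_integrable m ?B (\<lambda>x. tail_weight z r * u x)"
      by (intro set_integrable_mult_right impI iu)
    have t_int: "(LINT x:?B|m. t x) = of_real (measure m ?B) * t y"
    proof (rule set_integral_const_on)
      fix x assume "x \<in> ?B"
      then show "t x = t y" using const_on_cballsD[OF *(6), of x y] s(2) by (simp add: dist_commute)
    qed simp_all
    show "(LINT x:?B|m. laplacian_fun m C u x)
        = tail_weight z r * (LINT x:?B|m. u x) - of_real (measure m ?B) * t y"
      unfolding *(9)[rule_format]
      by (simp only: set_integral_diff(2)[OF set_integral_add(1)[OF sum_int ilam] it]
          set_integral_add(2)[OF sum_int ilam] sum_zero t_int set_integral_mult_right add_0)
  qed
qed

text \<open>A function with mean zero on all balls of radius \<open>r\<close> has mean zero on all larger balls too, so these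
  contribute only the multiple \<open>tail_weight z r * u\<close>.\<close>

lemma ball_avg_laplacian_zero:
  assumes u: "u \<in> test_functions" and r: "r > 0" and avg: "ball_avg m r u = (\<lambda>x. 0)"
  shows "ball_avg m r (laplacian_fun m C u) y = 0"
proof -
  obtain t where t: "const_on_cballs r t" "ball_avg m r u = (\<lambda>x. 0) \<longrightarrow> t = (\<lambda>x. 0)"
    "\<forall>z s. 0 < s \<longrightarrow> s \<le> r \<longrightarrow> (\<forall>\<rho>\<in>radii z. \<rho> < r \<longrightarrow> \<rho> \<le> s) \<longrightarrow>
       (LINT x:cball z s|m. laplacian_fun m C u x)
         = tail_weight y r * (LINT x:cball z s|m. u x) - of_real (measure m (cball z s)) * t z"
    by (rule laplacian_integral[OF u r, where z = y])
  have "(LINT x:cball y r|m. u x) = 0"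
    using fun_cong[OF avg, of y] measure_cball_pos[OF r, of y] by (simp add: ball_avg_def)
  then show ?thesis
    using t(3)[rule_format, of r y] t(2)[rule_format, OF avg] r by (simp add: ball_avg_def)
qed

text \<open>Smaller balls do not contribute, and the averages over larger balls are constant on balls of
  radius \<open>r\<close>.\<close>

lemma laplacian_of_const:
  assumes u: "const_on_cballs r u"
  shows "const_on_cballs r (laplacian_fun m C u)"
  unfolding const_on_cballs_def
proof (intro allI impI)
  fix x y :: 'a assume d: "dist x y \<le> r"
  show "laplacian_fun m C u x = laplacian_fun m C u y"
    unfolding laplacian_eq_radii_sum[of _ _ x]
  proof (rule infsum_cong)
    fix \<rho> assume \<rho>: "\<rho> \<in> radii x"
    have "ball_avg m \<rho> u x = ball_avg m \<rho> u y" if "r \<le> \<rho>"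
      using const_on_cballsD[OF ball_avg_const_on_cballs, of x y \<rho>] d that by simp
    moreover have "ball_avg m \<rho> u w = u w" if "\<rho> \<le> r" for w
      using ball_avg_of_const[OF u that] radii_cball(1)[OF \<rho>] by blast
    ultimately show "of_real (C (cball x \<rho>)) * (u x - ball_avg m \<rho> u x)
        = of_real (C (cball x \<rho>)) * (u y - ball_avg m \<rho> u y)"
      using const_on_cballsD[OF u d] by (cases "\<rho> \<le> r") auto
  qed
qed

lemma ball_avg_indicator_mult:
  assumes "\<rho> \<le> r"
  shows "ball_avg m \<rho> (\<lambda>y. indicator (cball b r) y * w y) x = indicator (cball b r) x * ball_avg m \<rho> w x"
proof (cases "x \<in> cball b r")
  case True
  have "(LINT y:cball x \<rho>|m. indicator (cball b r) y * w y) = (LINT y:cball x \<rho>|m. w y)"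
    by (rule set_lebesgue_integral_cong) (use cball_subset_cball[OF True assms] in auto)
  then show ?thesis using True by (simp add: ball_avg_def)
next
  case False
  have "y \<notin> cball b r" if "y \<in> cball x \<rho>" for y
  proof
    assume "y \<in> cball b r"
    moreover have "x \<in> cball y \<rho>" using that by (simp add: dist_commute)
    ultimately have "x \<in> cball b r" using cball_subset_cball[of y b r \<rho>] assms by blast
    with False show False ..
  qed
  then have "(LINT y:cball x \<rho>|m. indicator (cball b r) y * w y) = (LINT y:cball x \<rho>|m. 0)"
    by (intro set_lebesgue_integral_cong) auto
  then show ?thesis using False by (simp add: ball_avg_def set_lebesgue_integral_def)
qed

text \<open>A ball of radius at most \<open>r\<close> lies in \<open>cball b r\<close> or is disjoint from it; the averages of \<open>w\<close> and of its
  restriction over larger balls vanish.\<close>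

lemma laplacian_indicator_mult:
  assumes w: "w \<in> test_functions" and r: "r > 0" and avg: "ball_avg m r w = (\<lambda>x. 0)"
  shows "laplacian_fun m C (\<lambda>y. indicator (cball b r) y * w y) x
    = indicator (cball b r) x * laplacian_fun m C w x"
proof -
  let ?v = "\<lambda>y. indicator (cball b r) y * w y"
  have v: "?v \<in> L2 m" by (intro L2_indicator_mult test_functions_L2 w) simp
  have v_avg: "ball_avg m r ?v = (\<lambda>x. 0)"
    using avg by (intro ext) (simp add: ball_avg_indicator_mult)
  have "ball_avg m \<rho> ?v x = indicator (cball b r) x * ball_avg m \<rho> w x" for \<rho>
  proof (cases "\<rho> \<le> r")
    case False
    then show ?thesis
      using ball_avg_coarser_zero[OF v r _ v_avg] ball_avg_coarser_zero[OF test_functions_L2[OF w] r _ avg]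
      by simp
  qed (rule ball_avg_indicator_mult)
  then have "laplacian_fun m C ?v x =
      (\<Sum>\<^sub>\<infinity>\<rho>\<in>radii x. indicator (cball b r) x * (of_real (C (cball x \<rho>)) * (w x - ball_avg m \<rho> w x)))"
    unfolding laplacian_eq_radii_sum[of _ x x] by (simp add: algebra_simps)
  also have "\<dots> = indicator (cball b r) x * laplacian_fun m C w x"
    unfolding infsum_cmult_right' laplacian_eq_radii_sum[of _ x x] ..
  finally show ?thesis .
qed

end

section \<open>The horocycle, its potential and the reducing projections\<close>

lemma invariantD: "invariant_subspace A M \<Longrightarrow> (f, g) \<in> A \<Longrightarrow> f \<in> M \<Longrightarrow> g \<in> M"
  unfolding invariant_subspace_def by blast

lemma (in homogeneous_ultrametric_measure_space) horocycle_radius: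
  assumes "horocycle (\<H> :: 'a set set)"
  obtains r where "r > 0" "\<H> = range (\<lambda>x. cball x r)"
proof -
  obtain d where d: "\<H> = {B\<in>balls. diameter B = d}" "\<H> \<noteq> {}"
    using assms by (auto simp: horocycle_def)
  then obtain B :: "'a set" where "B \<in> balls" "diameter B = d" by blast
  then obtain x :: 'a and r where xr: "r > 0" "diameter (cball x r) = d"
    unfolding balls_def by blast
  have "\<H> = range (\<lambda>x. cball x r)"
  proof (intro subset_antisym subsetI)
    fix B assume "B \<in> \<H>"
    then have B: "B \<in> balls" "diameter B = d" using d by auto
    obtain y where y: "y \<in> B" using balls_nonempty[OF B(1)] by blast
    have "B = cball y r"
      using xr B y diameter_cball_eq[of y r x] balls_cball[OF xr(1), of y]
      by (intro ball_eqI[of B _ y]) auto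
    then show "B \<in> range (\<lambda>x. cball x r)" by blast
  next
    fix B assume "B \<in> range (\<lambda>x :: 'a. cball x r)"
    then obtain y where "B = cball y r" by blast
    then show "B \<in> \<H>"
      using d(1) xr diameter_cball_eq[of y r x] balls_cball[OF xr(1), of y] by simp
  qed
  with xr(1) that show thesis by blast
qed

text \<open>The radius \<open>r\<close> is positive even if the balls of the horocycle are singletons, which happens in a
  discrete space.\<close>

locale horocycle_space = weighted_ultrametric_space m C
  for m :: "'a::metric_space measure" and C +
  fixes \<H> :: "'a set set" and r :: real
  assumes r: "r > 0" and \<H>: "\<H> = range (\<lambda>x. cball x r)"
begin

lemma potential_eq: "potential \<H> \<sigma> x = \<sigma> (cball x r)"
proof -
  have "potential \<H> \<sigma> x = (\<Sum>\<^sub>\<infinity>B\<in>{cball x r}. \<sigma> B * indicator B x)"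
    unfolding potential_def
  proof (rule infsum_cong_neutral)
    fix B assume "B \<in> \<H> - {cball x r}"
    then obtain y where "B = cball y r" "cball y r \<noteq> cball x r" using \<H> by blast
    then have "x \<notin> B" using cball_eq[of x y r] by auto
    then show "\<sigma> B * indicator B x = 0" by simp
  qed (use \<H> in auto)
  then show ?thesis using r by simp
qed

lemma potential_const: "const_on_cballs r (\<lambda>x. complex_of_real (potential \<H> \<sigma> x))"
  unfolding const_on_cballs_def potential_eq by (metis cball_eq mem_cball)

definition schroedinger_fun :: "('a set \<Rightarrow> real) \<Rightarrow> ('a \<Rightarrow> complex) \<Rightarrow> 'a \<Rightarrow> complex" where
  "schroedinger_fun \<sigma> u x = laplacian_fun m C u x + of_real (potential \<H> \<sigma> x) * u x"

abbreviation "schroedinger_op \<sigma> \<equiv> hierarchical_schroedinger m C (potential \<H> \<sigma>)"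

lemma schroedinger_op_eq:
  "schroedinger_op \<sigma> = op_closure m {(u, schroedinger_fun \<sigma> u) | u. u \<in> test_functions}"
  by (simp add: hierarchical_schroedinger_def schroedinger_fun_def[abs_def])

text \<open>Makes every result about \<open>H\<close> apply to \<open>L\<close>.\<close>

lemma laplacian_op_eq: "hierarchical_laplacian m C = schroedinger_op (\<lambda>B. 0)"
  by (simp add: hierarchical_laplacian_def hierarchical_schroedinger_def potential_def)

lemma schroedinger_fun_comb:
  assumes "u \<in> test_functions" "v \<in> test_functions"
  shows "schroedinger_fun \<sigma> (\<lambda>x. u x + c * v x) = (\<lambda>x. schroedinger_fun \<sigma> u x + c * schroedinger_fun \<sigma> v x)"
  by (rule ext) (simp add: schroedinger_fun_def laplacian_comb[OF assms] algebra_simps)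

lemma schroedinger_op_comb:
  assumes "(f, g) \<in> schroedinger_op \<sigma>" "(f', g') \<in> schroedinger_op \<sigma>"
  shows "((\<lambda>x. f x + c * f' x), (\<lambda>x. g x + c * g' x)) \<in> schroedinger_op \<sigma>"
  using assms unfolding schroedinger_op_eq
proof (rule op_closure_comb[rotated])
  fix u v u' v'
  assume "(u, v) \<in> {(u, schroedinger_fun \<sigma> u) |u. u \<in> test_functions}"
    and "(u', v') \<in> {(u, schroedinger_fun \<sigma> u) |u. u \<in> test_functions}"
  then have u: "u \<in> test_functions" "v = schroedinger_fun \<sigma> u"
    and u': "u' \<in> test_functions" "v' = schroedinger_fun \<sigma> u'" by auto
  show "((\<lambda>x. u x + c * u' x), (\<lambda>x. v x + c * v' x)) \<in> {(u, schroedinger_fun \<sigma> u) |u. u \<in> test_functions}"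
    using test_functions_comb[OF u(1) u'(1)] schroedinger_fun_comb[OF u(1) u'(1), of \<sigma> c] u(2) u'(2)
    by auto
qed

lemma schroedinger_op_L2: "(f, g) \<in> schroedinger_op \<sigma> \<Longrightarrow> f \<in> L2 m \<and> g \<in> L2 m"
  unfolding schroedinger_op_eq by (rule op_closure_L2)

lemma zero_schroedinger_op: "((\<lambda>x. 0), (\<lambda>x. 0)) \<in> schroedinger_op \<sigma>"
proof -
  have "schroedinger_fun \<sigma> (\<lambda>x. 0 + (-1) * 0) = (\<lambda>x. schroedinger_fun \<sigma> (\<lambda>x. 0) x + (-1) * schroedinger_fun \<sigma> (\<lambda>x. 0) x)"
    by (rule schroedinger_fun_comb) simp_all
  then have "schroedinger_fun \<sigma> (\<lambda>x. 0) = (\<lambda>x. 0)" by simp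
  then have *: "((\<lambda>x. 0), (\<lambda>x. 0)) \<in> {(u, schroedinger_fun \<sigma> u) | u. u \<in> test_functions}" by auto
  show ?thesis
    unfolding schroedinger_op_eq op_closure_iff
  proof (intro conjI allI impI)
    fix \<epsilon> :: real assume "\<epsilon> > 0"
    with * show "\<exists>u v. (u, v) \<in> {(u, schroedinger_fun \<sigma> u) | u. u \<in> test_functions} \<and>
        u \<in> L2 m \<and> v \<in> L2 m \<and> L2_norm m (\<lambda>x. u x - 0) < \<epsilon> \<and> L2_norm m (\<lambda>x. v x - 0) < \<epsilon>"
      by (intro exI[of _ "\<lambda>x. 0"]) simp
  qed simp_all
qed

lemma ball_avg_test_function:
  assumes "u \<in> test_functions"
  shows "ball_avg m r u \<in> test_functions"
proof -
  obtain e K where u: "e > 0" "const_on_cballs e u" "compact K" "\<And>x. x \<notin> K \<Longrightarrow> u x = 0"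
    using assms by (rule test_functionE) blast
  let ?K = "\<Union> ((\<lambda>y. cball y r) ` K)"
  show ?thesis
  proof (rule test_functionI[OF r ball_avg_const_on_cballs])
    show "compact ?K"
      using finite_cballs_compact[OF u(3) r] compact_cball by (intro compact_Union) auto
    fix x assume x: "x \<notin> ?K"
    have "u y = 0" if "y \<in> cball x r" for y
    proof (rule u(4), rule notI)
      assume "y \<in> K"
      moreover have "x \<in> cball y r" using that by (simp add: dist_commute)
      ultimately show False using x by blast
    qed
    then have "(LINT y:cball x r|m. u y) = of_real (measure m (cball x r)) * 0"
      by (intro set_integral_const_on) simp_all
    then show "ball_avg m r u x = 0" by (simp add: ball_avg_def)
  qed
qed

lemma residual_test_function:
  assumes "u \<in> test_functions"
  shows "(\<lambda>x. u x - ball_avg m r u x) \<in> test_functions"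
  using test_functions_comb[OF assms ball_avg_test_function[OF assms], of "-1"] by simp

lemma ball_avg_residual:
  assumes "u \<in> L2 m"
  shows "ball_avg m r (\<lambda>x. u x - ball_avg m r u x) = (\<lambda>x. 0)"
proof
  fix x
  have "ball_avg m r (ball_avg m r u) x = ball_avg m r u x"
    by (rule ball_avg_of_const[OF ball_avg_const_on_cballs order_refl balls_cball[OF r]])
  then show "ball_avg m r (\<lambda>x. u x - ball_avg m r u x) x = 0"
    by (simp add: ball_avg_diff L2_set_integrable_cball assms ball_avg_contraction[OF assms r])
qed

lemma laplacian_decomposition:
  assumes u: "u \<in> test_functions"
  shows "laplacian_fun m C u x
    = laplacian_fun m C (ball_avg m r u) x + laplacian_fun m C (\<lambda>x. u x - ball_avg m r u x) x"
  using laplacian_comb[OF ball_avg_test_function[OF u] residual_test_function[OF u], of 1 x] by simp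

text \<open>Splitting \<open>u\<close> into \<open>P u\<close> and \<open>u - P u\<close>: the Laplacian preserves both the functions that are constant
  on balls of radius \<open>r\<close> and those with mean zero on them.\<close>

lemma ball_avg_laplacian:
  assumes u: "u \<in> test_functions"
  shows "ball_avg m r (laplacian_fun m C u) x = laplacian_fun m C (ball_avg m r u) x"
proof -
  let ?a = "ball_avg m r u" and ?w = "\<lambda>x. u x - ball_avg m r u x"
  note a = ball_avg_test_function[OF u] and w = residual_test_function[OF u]
  have "ball_avg m r (laplacian_fun m C u) x
      = ball_avg m r (\<lambda>x. laplacian_fun m C ?a x + 1 * laplacian_fun m C ?w x) x"
    using laplacian_decomposition[OF u] by (simp add: ball_avg_def)
  also have "\<dots> = ball_avg m r (laplacian_fun m C ?a) x + 1 * ball_avg m r (laplacian_fun m C ?w) x"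
    by (rule ball_avg_comb[OF laplacian_set_integrable[OF a r] laplacian_set_integrable[OF w r]])
  also have "ball_avg m r (laplacian_fun m C ?w) x = 0"
    by (rule ball_avg_laplacian_zero[OF w r ball_avg_residual[OF test_functions_L2[OF u]]])
  also have "ball_avg m r (laplacian_fun m C ?a) x = laplacian_fun m C ?a x"
    by (rule ball_avg_of_const[OF laplacian_of_const[OF ball_avg_const_on_cballs] order_refl balls_cball[OF r]])
  finally show ?thesis by simp
qed

lemma potential_mult_set_integral:
  fixes u :: "'a \<Rightarrow> complex"
  shows "(LINT y:cball x r|m. of_real (potential \<H> \<sigma> y) * u y)
    = of_real (potential \<H> \<sigma> x) * (LINT y:cball x r|m. u y)"
proof -
  have "(LINT y:cball x r|m. of_real (potential \<H> \<sigma> y) * u y)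
      = (LINT y:cball x r|m. of_real (potential \<H> \<sigma> x) * u y)"
    by (rule set_lebesgue_integral_cong)
      (use const_on_cballsD[OF potential_const, of x] in auto)
  then show ?thesis by simp
qed

lemma potential_mult_set_integrable:
  fixes u :: "'a \<Rightarrow> complex"
  assumes "set_integrable m (cball x r) u"
  shows "set_integrable m (cball x r) (\<lambda>y. of_real (potential \<H> \<sigma> y) * u y)"
proof -
  have "set_integrable m (cball x r) (\<lambda>y. of_real (potential \<H> \<sigma> x) * u y)"
    using assms by simp
  also have "?this \<longleftrightarrow> ?thesis"
    by (rule set_integrable_cong) (use const_on_cballsD[OF potential_const, of x] in auto)
  finally show ?thesis .
qed

lemma ball_avg_schroedinger:
  assumes u: "u \<in> test_functions"
  shows "ball_avg m r (schroedinger_fun \<sigma> u) = schroedinger_fun \<sigma> (ball_avg m r u)"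
proof
  fix x
  have iu: "set_integrable m (cball x r) u" by (rule L2_set_integrable_cball[OF test_functions_L2[OF u]])
  have "ball_avg m r (schroedinger_fun \<sigma> u) x
      = ball_avg m r (\<lambda>y. laplacian_fun m C u y + 1 * (of_real (potential \<H> \<sigma> y) * u y)) x"
    by (simp add: ball_avg_def schroedinger_fun_def)
  also have "\<dots> = ball_avg m r (laplacian_fun m C u) x
      + 1 * ball_avg m r (\<lambda>y. of_real (potential \<H> \<sigma> y) * u y) x"
    by (rule ball_avg_comb[OF laplacian_set_integrable[OF u r] potential_mult_set_integrable[OF iu]])
  also have "ball_avg m r (\<lambda>y. of_real (potential \<H> \<sigma> y) * u y) x
      = of_real (potential \<H> \<sigma> x) * ball_avg m r u x"
    by (simp add: ball_avg_def potential_mult_set_integral)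
  finally show "ball_avg m r (schroedinger_fun \<sigma> u) x = schroedinger_fun \<sigma> (ball_avg m r u) x"
    by (simp add: ball_avg_laplacian[OF u] schroedinger_fun_def[of \<sigma> "ball_avg m r u" x])
qed

lemma fluctuation_test_function:
  assumes u: "u \<in> test_functions"
  shows "fluctuation m r (cball b r) u \<in> test_functions"
proof -
  obtain e K where w: "e > 0" "const_on_cballs e (\<lambda>x. u x - ball_avg m r u x)"
    using residual_test_function[OF u] by (rule test_functionE) blast
  show ?thesis
  proof (rule test_functionI[OF _ _ compact_cball[of b r]])
    show "min e r > 0" using w r by simp
    show "const_on_cballs (min e r) (fluctuation m r (cball b r) u)"
      unfolding const_on_cballs_def
    proof (intro allI impI)
      fix x y :: 'a assume "dist x y \<le> min e r"
      then show "fluctuation m r (cball b r) u x = fluctuation m r (cball b r) u y"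
        using const_on_cballsD[OF w(2), of x y] const_on_cballsD[OF const_on_cballs_indicator, of x y r b]
        by (simp add: fluctuation_def)
    qed
  qed (simp add: fluctuation_def)
qed

lemma fluctuation_schroedinger:
  assumes u: "u \<in> test_functions"
  shows "fluctuation m r (cball b r) (schroedinger_fun \<sigma> u)
    = schroedinger_fun \<sigma> (fluctuation m r (cball b r) u)"
proof
  fix x
  let ?a = "ball_avg m r u" and ?w = "\<lambda>x. u x - ball_avg m r u x"
  have eq: "fluctuation m r (cball b r) u = (\<lambda>y. indicator (cball b r) y * ?w y)"
    by (simp add: fluctuation_def[abs_def])
  have "laplacian_fun m C (fluctuation m r (cball b r) u) x = indicator (cball b r) x * laplacian_fun m C ?w x"
    unfolding eq
    by (rule laplacian_indicator_mult[OF residual_test_function[OF u] r ball_avg_residual[OF test_functions_L2[OF u]]])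
  also have "laplacian_fun m C ?w x = laplacian_fun m C u x - laplacian_fun m C ?a x"
    using laplacian_decomposition[OF u, of x] by simp
  finally have L: "laplacian_fun m C (fluctuation m r (cball b r) u) x
      = indicator (cball b r) x * (laplacian_fun m C u x - laplacian_fun m C ?a x)" .
  show "fluctuation m r (cball b r) (schroedinger_fun \<sigma> u) x
      = schroedinger_fun \<sigma> (fluctuation m r (cball b r) u) x"
    unfolding fluctuation_def[of m r _ "schroedinger_fun \<sigma> u"] ball_avg_schroedinger[OF u]
      schroedinger_fun_def[of \<sigma> _ x] L fluctuation_def[of m r _ u x]
    by (simp add: algebra_simps)
qed

lemma ball_avg_schroedinger_op:
  assumes "(f, g) \<in> schroedinger_op \<sigma>"
  shows "(ball_avg m r f, ball_avg m r g) \<in> schroedinger_op \<sigma>"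
  using assms unfolding schroedinger_op_eq
  by (rule op_closure_commute[OF ball_avg_operator[OF r]])
    (auto simp: ball_avg_schroedinger ball_avg_test_function)

lemma fluctuation_schroedinger_op:
  assumes "(f, g) \<in> schroedinger_op \<sigma>" "B \<in> \<H>"
  shows "(fluctuation m r B f, fluctuation m r B g) \<in> schroedinger_op \<sigma>"
proof -
  obtain b where B: "B = cball b r" using assms(2) \<H> by blast
  show ?thesis
    using assms(1) unfolding schroedinger_op_eq B
    by (rule op_closure_commute[OF fluctuation_operator[OF r sets_cball]])
      (auto simp: fluctuation_schroedinger fluctuation_test_function)
qed

end

section \<open>Closability\<close>

context homogeneous_ultrametric_measure_space
begin

text \<open>The pairing of \<open>g\<close> with \<open>f_ball m T\<close>, written by integrals over balls so that it makes sense for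
  functions that are only locally integrable.\<close>

definition child_difference :: "'a set \<Rightarrow> ('a \<Rightarrow> complex) \<Rightarrow> complex" where
  "child_difference T g = (LINT y:T|m. g y) / of_real (measure m T)
     - (LINT y:parent_ball T|m. g y) / of_real (measure m (parent_ball T))"

lemma ball_mean_bound:
  assumes "g \<in> L2 m" "T \<in> balls"
  shows "cmod ((LINT y:T|m. g y) / of_real (measure m T)) \<le> L2_norm m g / sqrt (measure m T)"
proof -
  have \<mu>: "measure m T > 0" by (rule measure_ball_pos[OF assms(2)])
  have "cmod (LINT y:T|m. g y) \<le> L2_norm m g * sqrt (measure m T)"
    by (rule set_integral_norm_le_L2[OF assms(1) sets_ball[OF assms(2)]
          emeasure_compact_finite[OF balls_compact[OF assms(2)]]])
  then have "cmod ((LINT y:T|m. g y) / of_real (measure m T)) \<le> L2_norm m g * sqrt (measure m T) / measure m T"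
    using \<mu> by (simp add: norm_divide divide_right_mono)
  also have "\<dots> = L2_norm m g / sqrt (measure m T)"
    using \<mu> by (simp add: field_simps)
  finally show ?thesis .
qed

lemma ball_set_integrable:
  "g \<in> L2 m \<Longrightarrow> T \<in> balls \<Longrightarrow> set_integrable m T g"
  by (intro L2_set_integrable sets_ball emeasure_compact_finite balls_compact)

lemma child_difference_diff:
  assumes "T \<in> balls" "f \<in> L2 m" "g \<in> L2 m"
  shows "child_difference T (\<lambda>x. f x - g x) = child_difference T f - child_difference T g"
  using assms parent_ball(1)[OF assms(1)]
  by (simp add: child_difference_def ball_set_integrable diff_divide_distrib)

lemma child_difference_bounded:
  assumes "T \<in> balls"
  obtains \<kappa> where "\<kappa> \<ge> 0" "\<And>g. g \<in> L2 m \<Longrightarrow> cmod (child_difference T g) \<le> \<kappa> * L2_norm m g"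
proof
  let ?P = "parent_ball T"
  let ?\<kappa> = "1 / sqrt (measure m T) + 1 / sqrt (measure m ?P)"
  show "?\<kappa> \<ge> 0" by simp
  fix g assume g: "g \<in> L2 m"
  have "cmod (child_difference T g) \<le> L2_norm m g / sqrt (measure m T) + L2_norm m g / sqrt (measure m ?P)"
    unfolding child_difference_def
    by (rule order_trans[OF norm_triangle_ineq4])
      (intro add_mono ball_mean_bound g assms parent_ball(1))
  then show "cmod (child_difference T g) \<le> ?\<kappa> * L2_norm m g"
    by (simp add: algebra_simps)
qed

text \<open>Such a function is orthogonal to all test functions, which are dense.\<close>

lemma L2_zero_if_ball_integrals_zero:
  assumes g: "g \<in> L2 m" and zero: "\<And>T. T \<in> balls \<Longrightarrow> (LINT y:T|m. g y) = 0"
  shows "AE x in m. g x = 0"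
proof -
  have orth: "L2_inner m g u = 0" if test: "u \<in> test_functions" for u
  proof -
    obtain e K where u: "e > 0" "const_on_cballs e u" "compact K" "\<And>x. x \<notin> K \<Longrightarrow> u x = 0"
      using test by (rule test_functionE) blast
    let ?F = "(\<lambda>y. cball y e) ` K" and ?c = "\<lambda>T. u (SOME y. y \<in> T)"
    have balls: "T \<in> balls" if "T \<in> ?F" for T using that balls_cball[OF u(1)] by blast
    have "L2_inner m g u = (LINT x|m. (\<Sum>T\<in>?F. cnj (?c T) * (g x * cnj (indicator T x))))"
      unfolding L2_inner_def
    proof (rule Bochner_Integration.integral_cong[OF refl])
      fix x
      have "cnj (u x) = cnj (\<Sum>T\<in>?F. ?c T * indicator T x)"
        by (rule arg_cong[where f = cnj]) (rule const_on_cballs_decomposition[OF u])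
      also have "\<dots> = (\<Sum>T\<in>?F. cnj (?c T) * cnj (indicator T x))"
        by (simp only: cnj_sum complex_cnj_mult)
      finally have "cnj (u x) = (\<Sum>T\<in>?F. cnj (?c T) * cnj (indicator T x))" .
      then show "g x * cnj (u x) = (\<Sum>T\<in>?F. cnj (?c T) * (g x * cnj (indicator T x)))"
        by (simp only: sum_distrib_left mult.left_commute)
    qed
    also have "\<dots> = (\<Sum>T\<in>?F. LINT x|m. cnj (?c T) * (g x * cnj (indicator T x)))"
    proof (rule Bochner_Integration.integral_sum)
      fix T assume "T \<in> ?F"
      show "integrable m (\<lambda>x. cnj (?c T) * (g x * cnj (indicator T x)))"
        by (intro integrable_mult_right L2_integrable_inner g indicator_ball_L2 balls \<open>T \<in> ?F\<close>)
    qed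
    also have "\<dots> = (\<Sum>T\<in>?F. cnj (?c T) * L2_inner m g (indicator T))"
      by (simp add: L2_inner_def)
    also have "\<dots> = 0"
      by (rule sum.neutral) (simp add: L2_inner_indicator zero balls)
    finally show ?thesis .
  qed
  have "(L2_norm m g)\<^sup>2 \<le> L2_norm m g * \<epsilon>" if "\<epsilon> > 0" for \<epsilon>
  proof -
    obtain u where u: "u \<in> test_functions" "u \<in> L2 m" "L2_norm m (\<lambda>x. u x - g x) < \<epsilon>"
      using L2_closureE[OF test_functions_dense[OF g] \<open>\<epsilon> > 0\<close>] by blast
    have "L2_inner m (\<lambda>x. u x - g x) g = - of_real ((L2_norm m g)\<^sup>2)"
      using L2_inner_diff_left[OF u(2) g g] L2_inner_commute[of m u g] orth[OF u(1)]
      by (simp add: L2_inner_self)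
    then have "cmod (- of_real ((L2_norm m g)\<^sup>2)) \<le> L2_norm m (\<lambda>x. u x - g x) * L2_norm m g"
      using L2_Cauchy_Schwarz[OF L2_diff[OF u(2) g] g] by simp
    also have "\<dots> \<le> \<epsilon> * L2_norm m g" using u(3) by (intro mult_right_mono) auto
    finally show ?thesis by (simp add: norm_power mult.commute)
  qed
  then have le: "(L2_norm m g)\<^sup>2 \<le> L2_norm m g * \<epsilon>" if "\<epsilon> > 0" for \<epsilon> using that by blast
  have "L2_norm m g = 0"
  proof (rule ccontr)
    assume "L2_norm m g \<noteq> 0"
    then have pos: "L2_norm m g > 0" using L2_norm_nonneg[of m g] by linarith
    then show False using le[of "L2_norm m g / 2"] by (simp add: power2_eq_square)
  qed
  then show ?thesis using L2_norm_eq_0_iff[OF g] by simp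
qed

text \<open>If passing to the parent never changes the mean, then every mean is bounded by
  \<open>L2_norm m g / sqrt (measure m S)\<close> for arbitrarily large balls \<open>S\<close>.\<close>

lemma L2_zero_if_child_differences_zero:
  assumes g: "g \<in> L2 m" and zero: "\<And>T. T \<in> balls \<Longrightarrow> child_difference T g = 0"
  shows "AE x in m. g x = 0"
proof (rule L2_zero_if_ball_integrals_zero[OF g])
  fix T :: "'a set" assume T: "T \<in> balls"
  let ?a = "\<lambda>S. (LINT y:S|m. g y) / of_real (measure m S)"
  obtain x where x: "x \<in> T" using balls_nonempty[OF T] by blast
  obtain s where s: "s > 0" "T = cball x s" using T x by (rule ballE)
  have le: "cmod (?a T) \<le> L2_norm m g / sqrt N" if N: "N > 0" for N
  proof -
    obtain y where y: "max s N < dist x y" by (rule unbounded)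
    define S where "S = cball x (dist x y)"
    have S: "S \<in> balls" using s y by (auto simp: S_def intro!: balls_cball)
    have TS: "T \<subseteq> S" using y by (auto simp: s(2) S_def)
    have "dist x y \<le> diameter S"
      by (rule diameter_bounded_bound) (auto simp: S_def)
    then have "N < diameter S" using y by simp
    then have mS: "N < measure m S" using measure_ball_eq_diameter[OF S] N by simp
    have "?a T = ?a S"
      using T TS
    proof (induction rule: ball_descending_induct)
      case (step T)
      have "?a T = ?a (parent_ball T)"
        using zero[OF step.hyps(1)] by (simp add: child_difference_def)
      then show ?case using step.IH by simp
    qed (simp_all add: S)
    also have "cmod (?a S) \<le> L2_norm m g / sqrt (measure m S)"
      by (rule ball_mean_bound[OF g S])
    also have "\<dots> \<le> L2_norm m g / sqrt N"
      using mS N by (intro divide_left_mono) auto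
    finally show ?thesis .
  qed
  have "cmod (?a T) \<le> 0"
  proof (rule field_le_epsilon)
    fix \<epsilon> :: real assume e: "\<epsilon> > 0"
    \<comment> \<open>With this \<open>N\<close> the bound \<open>L2_norm m g / sqrt N\<close> is at most \<open>\<epsilon>\<close>; the \<open>+ 1\<close> keeps \<open>N\<close> positive.\<close>
    define N where "N = ((L2_norm m g + 1) / \<epsilon>)\<^sup>2"
    have pos: "(L2_norm m g + 1) / \<epsilon> > 0" using e by (simp add: add_nonneg_pos)
    then have "N > 0" "sqrt N = (L2_norm m g + 1) / \<epsilon>"
      by (simp_all only: N_def real_sqrt_abs abs_of_pos zero_less_power)
    then have "cmod (?a T) \<le> L2_norm m g / ((L2_norm m g + 1) / \<epsilon>)" using le[of N] by simp
    also have "\<dots> \<le> \<epsilon>"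
    proof -
      have "L2_norm m g / (L2_norm m g + 1) \<le> 1" by (simp add: add_nonneg_pos)
      then show ?thesis using e mult_right_mono[of "L2_norm m g / (L2_norm m g + 1)" 1 \<epsilon>] by simp
    qed
    finally show "cmod (?a T) \<le> 0 + \<epsilon>" by simp
  qed
  then show "(LINT y:T|m. g y) = 0" using measure_ball_pos[OF T] by simp
qed

end

context weighted_ultrametric_space
begin

text \<open>The function \<open>f_ball m T\<close> is an eigenfunction of the Laplacian; its eigenvalue \<open>\<nu>\<close> is the tail weight of
  the parent of \<open>T\<close>.\<close>

lemma child_difference_laplacian:
  assumes T: "T \<in> balls"
  obtains \<nu> where "\<And>u. u \<in> test_functions \<Longrightarrow>
    child_difference T (laplacian_fun m C u) = \<nu> * child_difference T u"
proof -
  let ?P = "parent_ball T"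
  note P = parent_ball[OF T]
  obtain x where x: "x \<in> T" using balls_nonempty[OF T] by blast
  obtain s where s: "s > 0" "T = cball x s" using T x by (rule ballE)
  define p where "p = diameter ?P"
  have P_eq: "?P = cball x p"
    unfolding p_def by (rule ball_eq_cball_diameter[OF P(1)]) (use x P(2) in blast)
  have sp: "s < p"
  proof (rule ccontr)
    assume "\<not> s < p"
    then have "cball x p \<subseteq> cball x s" by auto
    then have "?P \<subseteq> T" by (subst P_eq) (simp only: s(2))
    with P(2) show False by blast
  qed
  \<comment> \<open>A radius between \<open>s\<close> and \<open>p\<close> would give a ball between \<open>T\<close> and its parent.\<close>
  have gap: "\<rho> \<le> s" if \<rho>: "\<rho> \<in> radii x" "\<rho> < p" for \<rho>
  proof (rule ccontr)
    assume "\<not> \<rho> \<le> s"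
    then have sub: "T \<subseteq> cball x \<rho>" unfolding s(2) by auto
    have diam: "diameter (cball x \<rho>) = \<rho>" and B: "cball x \<rho> \<in> balls" by (rule radii_cball[OF \<rho>(1)])+
    show False
    proof (cases "T = cball x \<rho>")
      case True
      then have "\<rho> = diameter T" using diam by simp
      also have "\<dots> \<le> s" unfolding s(2) using s(1) by (intro diameter_cball_le) simp
      finally show False using \<open>\<not> \<rho> \<le> s\<close> by simp
    next
      case False
      then have "?P \<subseteq> cball x \<rho>" using sub by (intro P(3) B) blast
      then have "p \<le> \<rho>" unfolding p_def using diameter_subset[of ?P "cball x \<rho>"] diam by simp
      with \<rho>(2) show False by simp
    qed
  qed
  show thesis
  proof
    fix u :: "'a \<Rightarrow> complex" assume u: "u \<in> test_functions"
    have p: "p > 0" using s sp by simp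
    obtain t where t: "const_on_cballs p t" "ball_avg m p u = (\<lambda>x. 0) \<longrightarrow> t = (\<lambda>x. 0)"
      "\<forall>y s. 0 < s \<longrightarrow> s \<le> p \<longrightarrow> (\<forall>\<rho>\<in>radii y. \<rho> < p \<longrightarrow> \<rho> \<le> s) \<longrightarrow>
       (LINT x:cball y s|m. laplacian_fun m C u x)
         = tail_weight x p * (LINT x:cball y s|m. u x) - of_real (measure m (cball y s)) * t y"
      by (rule laplacian_integral[OF u p, where z = x])
    have IT: "(LINT x:T|m. laplacian_fun m C u x)
         = tail_weight x p * (LINT x:T|m. u x) - of_real (measure m T) * t x"
      unfolding s(2) using t(3)[rule_format, of s x] s(1) sp gap by simp
    have IP: "(LINT x:?P|m. laplacian_fun m C u x)
         = tail_weight x p * (LINT x:?P|m. u x) - of_real (measure m ?P) * t x"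
      unfolding P_eq using t(3)[rule_format, of p x] p by simp
    show "child_difference T (laplacian_fun m C u) = tail_weight x p * child_difference T u"
      unfolding child_difference_def IT IP
      using measure_ball_pos[OF T] measure_ball_pos[OF P(1)] by (simp add: field_simps)
  qed
qed

end

context horocycle_space
begin

lemma potential_mult_bounded_on_ball:
  assumes T: "T \<in> balls"
  obtains M where "M \<ge> 0" "\<And>u. u \<in> L2 m \<Longrightarrow>
    (\<lambda>x. indicator T x * (of_real (potential \<H> \<sigma> x) * u x)) \<in> L2 m \<and>
    L2_norm m (\<lambda>x. indicator T x * (of_real (potential \<H> \<sigma> x) * u x)) \<le> M * L2_norm m u"
proof -
  let ?V = "\<lambda>x. complex_of_real (potential \<H> \<sigma> x)"
  have V: "?V \<in> borel_measurable m" by (rule const_on_cballs_measurable[OF potential_const r])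
  have "continuous_on T ?V"
    using const_on_cballs_continuous[OF potential_const r] by (rule continuous_on_subset) simp
  from compact_imp_bounded[OF compact_continuous_image[OF this balls_compact[OF T]]]
  obtain M0 where "\<And>x. x \<in> T \<Longrightarrow> cmod (?V x) \<le> M0" unfolding bounded_iff by blast
  then have M: "cmod (?V x) \<le> max M0 0" if "x \<in> T" for x
    using that by (simp add: le_max_iff_disj)
  show thesis
  proof (rule that[of "max M0 0"])
    fix u assume u: "u \<in> L2 m"
    let ?w = "\<lambda>x. indicator T x * (?V x * u x)"
    have w: "?w \<in> borel_measurable m"
      by (intro borel_measurable_times borel_measurable_indicator sets_ball T V L2_measurable u)
    have le: "cmod (?w x) \<le> max M0 0 * cmod (u x)" for x
      using M[of x] by (cases "x \<in> T") (auto simp: norm_mult intro: mult_right_mono)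
    have "L2_norm m ?w \<le> L2_norm m (\<lambda>x. of_real (max M0 0) * u x)"
      by (rule L2_norm_mono[OF L2_scale[OF u] w]) (use le in \<open>simp add: norm_mult\<close>)
    then show "?w \<in> L2 m \<and> L2_norm m ?w \<le> max M0 0 * L2_norm m u"
      using L2_bound[OF u w le] by (simp add: L2_norm_scale)
  qed simp
qed

lemma child_difference_schroedinger_bounded:
  assumes T: "T \<in> balls"
  obtains \<kappa> where "\<kappa> \<ge> 0"
    "\<And>u. u \<in> test_functions \<Longrightarrow> cmod (child_difference T (schroedinger_fun \<sigma> u)) \<le> \<kappa> * L2_norm m u"
proof -
  let ?P = "parent_ball T"
  note P = parent_ball[OF T]
  obtain \<nu> where lam: "\<And>u. u \<in> test_functions \<Longrightarrow>
      child_difference T (laplacian_fun m C u) = \<nu> * child_difference T u"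
    using child_difference_laplacian[OF T] by blast
  obtain k where k: "k \<ge> 0" "\<And>g. g \<in> L2 m \<Longrightarrow> cmod (child_difference T g) \<le> k * L2_norm m g"
    using child_difference_bounded[OF T] by blast
  obtain M where M: "M \<ge> 0" "\<And>u. u \<in> L2 m \<Longrightarrow>
    (\<lambda>x. indicator ?P x * (of_real (potential \<H> \<sigma> x) * u x)) \<in> L2 m \<and>
    L2_norm m (\<lambda>x. indicator ?P x * (of_real (potential \<H> \<sigma> x) * u x)) \<le> M * L2_norm m u"
    using potential_mult_bounded_on_ball[OF P(1), of \<sigma>] by blast
  show thesis
  proof
    show "cmod \<nu> * k + k * M \<ge> 0" using k(1) M(1) by simp
    fix u :: "'a \<Rightarrow> complex" assume u: "u \<in> test_functions"
    let ?w = "\<lambda>x. indicator ?P x * (of_real (potential \<H> \<sigma> x) * u x)"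
    have uL2: "u \<in> L2 m" by (rule test_functions_L2[OF u])
    have integral: "(LINT x:S|m. schroedinger_fun \<sigma> u x)
        = (LINT x:S|m. laplacian_fun m C u x) + (LINT x:S|m. ?w x)" if S: "S \<in> balls" "S \<subseteq> ?P" for S
    proof -
      obtain x s where xs: "S = cball x s" "s > 0" using S(1) by (auto simp: balls_def)
      have "(LINT x:S|m. schroedinger_fun \<sigma> u x) = (LINT x:S|m. laplacian_fun m C u x + ?w x)"
        by (rule set_lebesgue_integral_cong) (use S sets_ball in \<open>auto simp: schroedinger_fun_def\<close>)
      also have "\<dots> = (LINT x:S|m. laplacian_fun m C u x) + (LINT x:S|m. ?w x)"
        using laplacian_set_integrable[OF u xs(2), of x] ball_set_integrable[OF _ S(1), of ?w] M(2)[OF uL2]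
        unfolding xs(1) by (intro set_integral_add(2)) auto
      finally show ?thesis .
    qed
    have "child_difference T (schroedinger_fun \<sigma> u)
        = child_difference T (laplacian_fun m C u) + child_difference T ?w"
      unfolding child_difference_def
      using integral[OF T] integral[OF P(1) order_refl] P(2) by (simp add: add_divide_distrib)
    also have "cmod \<dots> \<le> cmod (\<nu> * child_difference T u) + cmod (child_difference T ?w)"
      unfolding lam[OF u] by (rule norm_triangle_ineq)
    also have "\<dots> \<le> cmod \<nu> * (k * L2_norm m u) + k * (M * L2_norm m u)"
    proof (rule add_mono)
      show "cmod (\<nu> * child_difference T u) \<le> cmod \<nu> * (k * L2_norm m u)"
        unfolding norm_mult by (intro mult_left_mono k(2) uL2) simp
      have "cmod (child_difference T ?w) \<le> k * L2_norm m ?w" using k(2) M(2)[OF uL2] by blast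
      also have "\<dots> \<le> k * (M * L2_norm m u)" using M(2)[OF uL2] k(1) by (intro mult_left_mono) auto
      finally show "cmod (child_difference T ?w) \<le> k * (M * L2_norm m u)" .
    qed
    finally show "cmod (child_difference T (schroedinger_fun \<sigma> u)) \<le> (cmod \<nu> * k + k * M) * L2_norm m u"
      by (simp add: algebra_simps)
  qed
qed

text \<open>Closability. The functionals \<open>child_difference T\<close> applied to \<open>schroedinger_fun \<sigma> u\<close> are bounded by the norm
  of \<open>u\<close>, so they vanish on every limit of images of a null sequence.\<close>

lemma schroedinger_op_single_valued:
  assumes fg: "(f, g) \<in> schroedinger_op \<sigma>" and f: "AE x in m. f x = 0"
  shows "AE x in m. g x = 0"
proof (rule L2_zero_if_child_differences_zero)
  have L2: "f \<in> L2 m" "g \<in> L2 m" using schroedinger_op_L2[OF fg] by auto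
  show "g \<in> L2 m" by fact
  have f0: "L2_norm m f = 0" using L2_norm_eq_0_iff[OF L2(1)] f by simp
  fix T :: "'a set" assume T: "T \<in> balls"
  obtain k where k: "k \<ge> 0" "\<And>g. g \<in> L2 m \<Longrightarrow> cmod (child_difference T g) \<le> k * L2_norm m g"
    using child_difference_bounded[OF T] by blast
  obtain k' where k': "k' \<ge> 0"
    "\<And>u. u \<in> test_functions \<Longrightarrow> cmod (child_difference T (schroedinger_fun \<sigma> u)) \<le> k' * L2_norm m u"
    using child_difference_schroedinger_bounded[OF T, of \<sigma>] by blast
  have "cmod (child_difference T g) \<le> 0"
  proof (rule field_le_epsilon)
    fix \<epsilon> :: real assume e: "\<epsilon> > 0"
    define \<delta> where "\<delta> = \<epsilon> / (k + k' + 1)"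
    have \<delta>: "\<delta> > 0" "(k + k') * \<delta> \<le> \<epsilon>"
      using e k(1) k'(1) by (auto simp: \<delta>_def field_simps)
    obtain u v where uv: "(u, v) \<in> {(u, schroedinger_fun \<sigma> u) | u. u \<in> test_functions}"
      "u \<in> L2 m" "v \<in> L2 m" "L2_norm m (\<lambda>x. u x - f x) < \<delta>" "L2_norm m (\<lambda>x. v x - g x) < \<delta>"
      using op_closureE[OF fg[unfolded schroedinger_op_eq] \<delta>(1)] by blast
    have u: "u \<in> test_functions" "v = schroedinger_fun \<sigma> u" using uv(1) by auto
    have "L2_norm m u \<le> L2_norm m (\<lambda>x. u x - f x) + L2_norm m f"
      using L2_norm_triangle[OF L2_diff[OF uv(2) L2(1)] L2(1)] by simp
    then have nu: "L2_norm m u \<le> \<delta>" using uv(4) f0 by simp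
    have "child_difference T g = child_difference T v - child_difference T (\<lambda>x. v x - g x)"
      using child_difference_diff[OF T uv(3) L2(2)] by simp
    then have "cmod (child_difference T g) \<le> cmod (child_difference T v) + cmod (child_difference T (\<lambda>x. v x - g x))"
      by (simp add: norm_triangle_ineq4)
    also have "\<dots> \<le> k' * \<delta> + k * \<delta>"
    proof (rule add_mono)
      show "cmod (child_difference T v) \<le> k' * \<delta>"
        unfolding u(2) using k'(2)[OF u(1)] mult_left_mono[OF nu k'(1)] by simp
      show "cmod (child_difference T (\<lambda>x. v x - g x)) \<le> k * \<delta>"
        using k(2)[OF L2_diff[OF uv(3) L2(2)]] mult_left_mono[OF less_imp_le[OF uv(5)] k(1)] by simp
    qed
    finally show "cmod (child_difference T g) \<le> 0 + \<epsilon>" using \<delta>(2) by (simp add: algebra_simps)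
  qed
  then show "child_difference T g = 0" by simp
qed

section \<open>The subspaces as ranges of the projections\<close>

lemma horocycle_balls: "B \<in> \<H> \<Longrightarrow> B \<in> balls"
  using \<H> balls_cball[OF r] by blast

text \<open>Averages are constant on balls of positive measure.\<close>

lemma ball_avg_AE_zero:
  assumes f: "f \<in> L2 m" and zero: "AE x in m. ball_avg m r f x = 0"
  shows "ball_avg m r f = (\<lambda>x. 0)"
proof
  fix x
  have "(LINT y:cball x r|m. ball_avg m r f y) = (LINT y:cball x r|m. 0)"
    by (rule set_lebesgue_integral_cong_AE)
      (use zero ball_avg_measurable[OF r] in auto)
  then have "ball_avg m r (ball_avg m r f) x = 0"
    by (simp add: ball_avg_def[of m r "ball_avg m r f"] set_lebesgue_integral_def)
  then show "ball_avg m r f x = 0"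
    by (simp add: ball_avg_of_const[OF ball_avg_const_on_cballs order_refl balls_cball[OF r]])
qed

lemma ball_avg_AE_cong:
  assumes "f \<in> L2 m" "g \<in> L2 m" "AE x in m. f x = g x"
  shows "ball_avg m r f = ball_avg m r g"
proof
  fix x
  have "(LINT y:cball x r|m. f y) = (LINT y:cball x r|m. g y)"
    by (rule set_lebesgue_integral_cong_AE) (use assms in \<open>auto simp: L2_def\<close>)
  then show "ball_avg m r f x = ball_avg m r g x" by (simp add: ball_avg_def)
qed

lemma ball_avg_in_span:
  assumes u: "u \<in> test_functions"
  shows "ball_avg m r u \<in> complex_span {indicator B | B. B \<in> \<H>}"
proof -
  obtain e K where K: "e > 0" "const_on_cballs e (ball_avg m r u)" "compact K"
    "\<And>x. x \<notin> K \<Longrightarrow> ball_avg m r u x = 0"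
    using ball_avg_test_function[OF u] by (rule test_functionE) blast
  have "ball_avg m r u = (\<lambda>x. \<Sum>T\<in>(\<lambda>y. cball y r) ` K. ball_avg m r u (SOME y. y \<in> T) * indicator T x)"
    by (rule ext) (rule const_on_cballs_decomposition[OF r ball_avg_const_on_cballs K(3,4)])
  moreover have "(\<lambda>x. \<Sum>T\<in>(\<lambda>y. cball y r) ` K. ball_avg m r u (SOME y. y \<in> T) * indicator T x)
      \<in> complex_span {indicator B | B. B \<in> \<H>}"
    by (rule complex_span_sum, rule complex_span_base) (use \<H> in blast)
  ultimately show ?thesis by simp
qed

text \<open>The averages of approximating test functions are finite combinations of indicators of balls of the
  horocycle.\<close>

lemma L_plus_iff: "f \<in> L_plus m \<H> \<longleftrightarrow> f \<in> L2 m \<and> (AE x in m. f x = ball_avg m r f x)"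
proof
  assume "f \<in> L_plus m \<H>"
  then have f: "f \<in> L2_closure m (complex_span {indicator B | B. B \<in> \<H>})"
    by (simp add: L_plus_def closed_span_eq)
  have "AE x in m. f x = ball_avg m r f x"
  proof (rule L2_operator_fixed_closure[OF ball_avg_operator[OF r] f])
    fix u :: "'a \<Rightarrow> complex" assume "u \<in> complex_span {indicator B | B. B \<in> \<H>}"
    then have "const_on_cballs r u"
    proof (induction rule: complex_span_induct)
      case (base s)
      then show ?case using \<H> const_on_cballs_indicator by auto
    qed (auto simp: const_on_cballs_def)
    then have "u x = ball_avg m r u x" for x
      using ball_avg_of_const[OF _ order_refl balls_cball[OF r]] by metis
    then show "AE x in m. u x = ball_avg m r u x" by simp
  qed
  then show "f \<in> L2 m \<and> (AE x in m. f x = ball_avg m r f x)"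
    using f by (simp add: L2_closure_def)
next
  assume f: "f \<in> L2 m \<and> (AE x in m. f x = ball_avg m r f x)"
  then have "f \<in> L2_closure m test_functions" by (simp add: test_functions_dense)
  from L2_operator_closure[OF ball_avg_operator[OF r] this ball_avg_in_span]
  have "ball_avg m r f \<in> L2_closure m (complex_span {indicator B | B. B \<in> \<H>})" .
  then have "f \<in> L2_closure m (complex_span {indicator B | B. B \<in> \<H>})"
    by (rule L2_closure_AE_cong) (use f in auto)
  then show "f \<in> L_plus m \<H>" by (simp add: L_plus_def closed_span_eq)
qed

lemma indicator_L_plus:
  assumes "B \<in> \<H>"
  shows "indicator B \<in> L_plus m \<H>"
  unfolding L_plus_def closed_span_eq
  by (rule L2_closure_incl[OF complex_span_base indicator_ball_L2[OF horocycle_balls[OF assms]]])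
    (use assms in blast)

text \<open>Orthogonality to the indicator of a ball of the horocycle means that the average over it vanishes.\<close>

lemma L_minus_iff: "f \<in> L_minus m \<H> \<longleftrightarrow> f \<in> L2 m \<and> ball_avg m r f = (\<lambda>x. 0)"
proof
  assume f: "f \<in> L_minus m \<H>"
  have "ball_avg m r f x = 0" for x
  proof -
    have "cball x r \<in> \<H>" using \<H> by blast
    then have "L2_inner m f (indicator (cball x r)) = 0"
      using f indicator_L_plus by (simp add: L_minus_def orth_complement_def)
    then show ?thesis by (simp add: L2_inner_indicator ball_avg_def)
  qed
  then show "f \<in> L2 m \<and> ball_avg m r f = (\<lambda>x. 0)"
    using f by (auto simp: L_minus_def orth_complement_def)
next
  assume f: "f \<in> L2 m \<and> ball_avg m r f = (\<lambda>x. 0)"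
  have span: "u \<in> L2 m \<and> L2_inner m f u = 0" if "u \<in> complex_span {indicator B | B. B \<in> \<H>}" for u
    using that
  proof (induction rule: complex_span_induct)
    case zero
    show ?case by (simp add: L2_inner_def)
  next
    case (base s)
    then obtain x where s: "s = indicator (cball x r)" using \<H> by blast
    have "ball_avg m r f x = 0" using f by simp
    then have "(LINT y:cball x r|m. f y) = 0"
      using measure_cball_pos[OF r, of x] by (simp add: ball_avg_def)
    then show ?case
      unfolding s by (simp add: L2_inner_indicator indicator_ball_L2 balls_cball[OF r])
  next
    case (comb u v c)
    then show ?case using f by (simp add: L2_inner_comb_right L2_add L2_scale)
  qed
  have "L2_inner m f g = 0" if "g \<in> L_plus m \<H>" for g
  proof -
    have g: "g \<in> L2_closure m (complex_span {indicator B | B. B \<in> \<H>})"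
      using that by (simp add: L_plus_def closed_span_eq)
    then have gL2: "g \<in> L2 m" by (simp add: L2_closure_def)
    have "cmod (L2_inner m f g) \<le> 0 + \<epsilon>" if e: "\<epsilon> > 0" for \<epsilon>
    proof -
      define \<delta> where "\<delta> = \<epsilon> / (L2_norm m f + 1)"
      have pos: "L2_norm m f + 1 > 0" by (rule add_nonneg_pos) simp_all
      then have \<delta>: "\<delta> > 0" "(L2_norm m f + 1) * \<delta> = \<epsilon>" using e by (simp_all add: \<delta>_def)
      obtain u where u: "u \<in> complex_span {indicator B | B. B \<in> \<H>}" "u \<in> L2 m"
        "L2_norm m (\<lambda>x. u x - g x) < \<delta>" using L2_closureE[OF g \<delta>(1)] by blast
      have "L2_inner m f (\<lambda>x. u x + (-1) * g x) = - L2_inner m f g"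
        using L2_inner_comb_right[of f m u g "-1"] f u(2) gL2 span[OF u(1)] by simp
      then have "cmod (L2_inner m f g) = cmod (L2_inner m f (\<lambda>x. u x - g x))" by simp
      also have "\<dots> \<le> L2_norm m f * L2_norm m (\<lambda>x. u x - g x)"
        using f u(2) gL2 by (intro L2_Cauchy_Schwarz L2_diff) auto
      also have "\<dots> \<le> (L2_norm m f + 1) * \<delta>" using u(3) pos by (intro mult_mono) auto
      finally show ?thesis using \<delta>(2) by simp
    qed
    then have "cmod (L2_inner m f g) \<le> 0" by (rule field_le_epsilon)
    then show ?thesis by simp
  qed
  then show "f \<in> L_minus m \<H>" using f by (simp add: L_minus_def orth_complement_def)
qed

lemma ball_avg_fluctuation:
  assumes f: "f \<in> L2 m" and B: "B \<in> \<H>"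
  shows "ball_avg m r (fluctuation m r B f) = (\<lambda>x. 0)"
proof -
  obtain b where b: "B = cball b r" using B \<H> by blast
  show ?thesis
    unfolding fluctuation_def[abs_def] b
    by (rule ext) (simp add: ball_avg_indicator_mult ball_avg_residual[OF f])
qed

lemma fluctuation_idempotent:
  assumes "f \<in> L2 m" "B \<in> \<H>"
  shows "fluctuation m r B (fluctuation m r B f) x = fluctuation m r B f x"
  unfolding fluctuation_def[of m r B "fluctuation m r B f"] ball_avg_fluctuation[OF assms]
  by (simp add: fluctuation_def indicator_def)

lemma set_integral_indicator_subset:
  assumes "T \<in> balls" "S \<in> balls" "T \<subseteq> S"
  shows "(LINT y:S|m. indicator T y) = complex_of_real (measure m T)"
proof -
  have "(LINT y:S|m. indicator T y) = (LINT y:T|m. (1 :: complex))"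
    unfolding set_lebesgue_integral_def
    by (rule Bochner_Integration.integral_cong) (use assms(3) in \<open>auto simp: indicator_def\<close>)
  also have "\<dots> = of_real (measure m T) * 1"
    by (rule set_integral_const_on)
      (use sets_ball[OF assms(1)] emeasure_compact_finite[OF balls_compact[OF assms(1)]] in auto)
  finally show ?thesis by simp
qed

text \<open>A telescoping sum of the functions \<open>f_ball m S\<close> along the chain of parents from \<open>T\<close> up to \<open>B\<close>.\<close>

lemma mean_difference_in_span:
  assumes B: "B \<in> balls" and T: "T \<in> balls" "T \<subseteq> B"
  shows "(\<lambda>x. indicator T x / of_real (measure m T) - indicator B x / of_real (measure m B))
    \<in> complex_span {f_ball m T | T. T \<in> balls \<and> T \<subset> B}"
  using T
proof (induction rule: ball_descending_induct)
  case base
  then show ?case by (simp add: complex_span_zero)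
next
  case (step T)
  have "f_ball m T \<in> complex_span {f_ball m T | T. T \<in> balls \<and> T \<subset> B}"
    by (rule complex_span_base) (use step.hyps in blast)
  from complex_span_comb[OF this step.IH, of 1]
  show ?case by (simp add: f_ball_def)
qed (rule B)

text \<open>The fluctuation is a combination \<open>\<Sum>\<^sub>T c\<^sub>T 1\<^sub>T\<close> over small balls \<open>T\<close> in \<open>B\<close>. Its integral
  \<open>\<Sum>\<^sub>T c\<^sub>T m(T)\<close> is zero, so \<open>1\<^sub>T\<close> may be replaced by \<open>m(T) (1\<^sub>T / m(T) - 1\<^sub>B / m(B))\<close>.\<close>

lemma fluctuation_in_span:
  assumes u: "u \<in> test_functions" and B: "B \<in> \<H>"
  shows "fluctuation m r B u \<in> complex_span {f_ball m T | T. T \<in> balls \<and> T \<subset> B}"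
proof -
  obtain b where b: "B = cball b r" using B \<H> by blast
  let ?w = "fluctuation m r B u"
  note BB = horocycle_balls[OF B]
  have w: "?w \<in> test_functions" unfolding b by (rule fluctuation_test_function[OF u])
  obtain e0 K where e0: "e0 > 0" "const_on_cballs e0 ?w"
    using w by (rule test_functionE) blast
  define e where "e = min e0 r"
  have e: "e > 0" "e \<le> r" "const_on_cballs e ?w"
    using e0 r const_on_cballs_mono[OF e0(2)] by (auto simp: e_def)
  let ?F = "(\<lambda>y. cball y e) ` B" and ?c = "\<lambda>T. ?w (SOME y. y \<in> T)"
  have T: "T \<in> balls" "T \<subseteq> B" if TF: "T \<in> ?F" for T
  proof -
    obtain y where y: "y \<in> B" "T = cball y e" using TF by blast
    then show "T \<in> balls" "T \<subseteq> B"
      using balls_cball[OF e(1), of y] cball_subset_cball[of y b r e] e(2) b by simp_all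
  qed
  have dec: "?w x = (\<Sum>T\<in>?F. ?c T * indicator T x)" for x
    by (rule const_on_cballs_decomposition[OF e(1,3) balls_compact[OF BB]]) (simp add: fluctuation_def)
  have fin: "finite ?F" by (rule finite_cballs_compact[OF balls_compact[OF BB] e(1)])
  have "(\<Sum>T\<in>?F. ?c T * of_real (measure m T)) = (\<Sum>T\<in>?F. ?c T * (LINT y:B|m. indicator T y))"
    by (rule sum.cong) (simp_all add: set_integral_indicator_subset[OF T(1) BB T(2)])
  also have "\<dots> = (\<Sum>T\<in>?F. LINT y:B|m. ?c T * indicator T y)"
    by (simp only: set_integral_mult_right)
  also have "\<dots> = (LINT y:B|m. ?w y)"
  proof -
    have int: "set_integrable m B (\<lambda>y. ?c T * indicator T y)" if "T \<in> ?F" for T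
      by (rule ball_set_integrable[OF L2_scale[OF indicator_ball_L2[OF T(1)[OF that]]] BB])
    have "(LINT y:B|m. ?w y) = (LINT y:B|m. \<Sum>T\<in>?F. ?c T * indicator T y)"
      by (rule set_lebesgue_integral_cong[OF sets_ball[OF BB]]) (use dec in blast)
    also have "\<dots> = (\<Sum>T\<in>?F. LINT y:B|m. ?c T * indicator T y)"
      using int unfolding set_lebesgue_integral_def set_integrable_def
      by (simp only: scaleR_sum_right Bochner_Integration.integral_sum)
    finally show ?thesis ..
  qed
  also have "\<dots> = 0"
    using fun_cong[OF ball_avg_fluctuation[OF test_functions_L2[OF u] B], of b] measure_ball_pos[OF BB]
    by (simp add: ball_avg_def b)
  finally have mean: "(\<Sum>T\<in>?F. ?c T * of_real (measure m T)) = 0" .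
  have alg: "(c * \<mu>) * (t / \<mu> - s) = c * t - (c * \<mu>) * s" if "\<mu> \<noteq> 0" for c \<mu> t s :: complex
    using that by (simp add: field_simps)
  have "?w = (\<lambda>x. \<Sum>T\<in>?F. (?c T * of_real (measure m T)) *
      (indicator T x / of_real (measure m T) - indicator B x / of_real (measure m B)))"
  proof
    fix x
    have "(\<Sum>T\<in>?F. (?c T * of_real (measure m T)) *
        (indicator T x / of_real (measure m T) - indicator B x / of_real (measure m B)))
        = (\<Sum>T\<in>?F. ?c T * indicator T x -
            (?c T * of_real (measure m T)) * (indicator B x / of_real (measure m B)))"
    proof (rule sum.cong[OF refl])
      fix T assume "T \<in> ?F"
      from measure_ball_pos[OF T(1)[OF this]] have "complex_of_real (measure m T) \<noteq> 0" by simp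
      then show "(?c T * of_real (measure m T)) *
        (indicator T x / of_real (measure m T) - indicator B x / of_real (measure m B))
        = ?c T * indicator T x - (?c T * of_real (measure m T)) * (indicator B x / of_real (measure m B))"
        by (rule alg)
    qed
    also have "\<dots> = (\<Sum>T\<in>?F. ?c T * indicator T x)
        - (\<Sum>T\<in>?F. ?c T * of_real (measure m T)) * (indicator B x / of_real (measure m B))"
      by (simp only: sum_subtractf sum_distrib_right)
    also have "\<dots> = ?w x" by (simp only: mean dec[symmetric] mult_zero_left diff_zero)
    finally show "?w x = (\<Sum>T\<in>?F. (?c T * of_real (measure m T)) *
      (indicator T x / of_real (measure m T) - indicator B x / of_real (measure m B)))" ..
  qed
  moreover have "(\<lambda>x. \<Sum>T\<in>?F. (?c T * of_real (measure m T)) *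
      (indicator T x / of_real (measure m T) - indicator B x / of_real (measure m B)))
    \<in> complex_span {f_ball m T | T. T \<in> balls \<and> T \<subset> B}"
    by (rule complex_span_sum) (rule mean_difference_in_span[OF BB T])
  ultimately show ?thesis by (simp only:)
qed

lemma f_ball_fluctuation:
  assumes B: "B \<in> \<H>" and T: "T \<in> balls" "T \<subset> B"
  shows "f_ball m T \<in> L2 m" "x \<notin> B \<Longrightarrow> f_ball m T x = 0" "ball_avg m r (f_ball m T) = (\<lambda>x. 0)"
proof -
  note BB = horocycle_balls[OF B] and P = parent_ball[OF T(1)]
  have PB: "parent_ball T \<subseteq> B" by (rule P(3)[OF BB T(2)])
  have eq: "f_ball m T = (\<lambda>x. inverse (of_real (measure m T)) * indicator T x
      - inverse (of_real (measure m (parent_ball T))) * indicator (parent_ball T) x)"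
    by (rule ext) (simp add: f_ball_def field_simps)
  have L2: "(\<lambda>x. inverse (of_real (measure m T)) * indicator T x) \<in> L2 m"
    "(\<lambda>x. inverse (of_real (measure m (parent_ball T))) * indicator (parent_ball T) x) \<in> L2 m"
    by (intro L2_scale indicator_ball_L2 T P(1))+
  show "f_ball m T \<in> L2 m" unfolding eq by (rule L2_diff[OF L2])
  show zero: "f_ball m T x = 0" if "x \<notin> B" for x
    using that PB P(2) by (auto simp: f_ball_def indicator_def)
  show "ball_avg m r (f_ball m T) = (\<lambda>x. 0)"
  proof
    fix x
    have "(LINT y:cball x r|m. f_ball m T y) = 0"
    proof (cases "cball x r = B")
      case True
      have "(LINT y:B|m. f_ball m T y) = inverse (of_real (measure m T)) * of_real (measure m T)
          - inverse (of_real (measure m (parent_ball T))) * of_real (measure m (parent_ball T))"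
        unfolding eq
        by (subst set_integral_diff(2)[OF ball_set_integrable[OF L2(1) BB] ball_set_integrable[OF L2(2) BB]])
          (simp add: set_integral_indicator_subset BB T(1) P(1) PB psubset_imp_subset[OF T(2)])
      also have "\<dots> = 0"
        using measure_ball_pos[OF T(1)] measure_ball_pos[OF P(1)] by simp
      finally show ?thesis by (simp only: True)
    next
      case False
      obtain b where b: "B = cball b r" using B \<H> by blast
      then have "cball x r \<inter> B = {}" using cball_disjoint False by simp
      then have "(LINT y:cball x r|m. f_ball m T y) = of_real (measure m (cball x r)) * 0"
        by (intro set_integral_const_on zero) auto
      then show ?thesis by simp
    qed
    then show "ball_avg m r (f_ball m T) x = 0" by (simp add: ball_avg_def)
  qed
qed

lemma L_ball_iff:
  assumes B: "B \<in> \<H>"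
  shows "f \<in> L_ball m B \<longleftrightarrow> f \<in> L2 m \<and> (AE x in m. f x = fluctuation m r B f x)"
proof
  let ?S = "{f_ball m T | T. T \<in> balls \<and> T \<subset> B}"
  have K: "L2_operator m (fluctuation m r B)"
    by (rule fluctuation_operator[OF r sets_ball[OF horocycle_balls[OF B]]])
  {
    assume "f \<in> L_ball m B"
    then have f: "f \<in> L2_closure m (complex_span ?S)"
      by (simp add: L_ball_def closed_span_eq)
    have "AE x in m. f x = fluctuation m r B f x"
    proof (rule L2_operator_fixed_closure[OF K f])
      fix u :: "'a \<Rightarrow> complex" assume "u \<in> complex_span ?S"
      then have "u \<in> L2 m \<and> (\<forall>x. x \<notin> B \<longrightarrow> u x = 0) \<and> ball_avg m r u = (\<lambda>x. 0)"
      proof (induction rule: complex_span_induct)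
        case zero
        show ?case by (auto simp: ball_avg_def set_lebesgue_integral_def)
      next
        case (base s)
        then show ?case using f_ball_fluctuation[OF B] by auto
      next
        case (comb u v c)
        then have "ball_avg m r (\<lambda>x. u x + c * v x) = (\<lambda>x. 0)"
          by (intro ext) (simp add: ball_avg_comb L2_set_integrable_cball)
        then show ?case using comb by (simp add: L2_add L2_scale)
      qed
      then show "AE x in m. u x = fluctuation m r B u x"
        by (intro AE_I2) (auto simp: fluctuation_def indicator_def)
    qed
    then show "f \<in> L2 m \<and> (AE x in m. f x = fluctuation m r B f x)"
      using f by (simp add: L2_closure_def)
  }
  assume f: "f \<in> L2 m \<and> (AE x in m. f x = fluctuation m r B f x)"
  then have "f \<in> L2_closure m test_functions" by (simp add: test_functions_dense)
  from L2_operator_closure[OF K this fluctuation_in_span[OF _ B]]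
  have "fluctuation m r B f \<in> L2_closure m (complex_span ?S)" .
  then have "f \<in> L2_closure m (complex_span ?S)"
    by (rule L2_closure_AE_cong) (use f in auto)
  then show "f \<in> L_ball m B" by (simp add: L_ball_def closed_span_eq)
qed

section \<open>Reduction of the operator\<close>

lemma fluctuation_L_ball:
  assumes "f \<in> L2 m" "B \<in> \<H>"
  shows "fluctuation m r B f \<in> L_ball m B"
  unfolding L_ball_iff[OF assms(2)]
  using L2_operator_L2[OF fluctuation_operator[OF r sets_ball[OF horocycle_balls[OF assms(2)]]] assms(1)]
    fluctuation_idempotent[OF assms]
  by simp

lemma ball_avg_L_plus: "f \<in> L2 m \<Longrightarrow> ball_avg m r f \<in> L_plus m \<H>"
  unfolding L_plus_iff
  by (simp add: ball_avg_contraction[OF _ r]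
      ball_avg_of_const[OF ball_avg_const_on_cballs order_refl balls_cball[OF r]])

lemma residual_L_minus: "f \<in> L2 m \<Longrightarrow> (\<lambda>x. f x - ball_avg m r f x) \<in> L_minus m \<H>"
  unfolding L_minus_iff by (simp add: L2_diff ball_avg_contraction[OF _ r] ball_avg_residual)

lemma L_ball_subset_L_minus:
  assumes B: "B \<in> \<H>"
  shows "L_ball m B \<subseteq> L_minus m \<H>"
proof
  fix f assume "f \<in> L_ball m B"
  then have f: "f \<in> L2 m" "AE x in m. f x = fluctuation m r B f x" using L_ball_iff[OF B] by auto
  have "fluctuation m r B f \<in> L2 m"
    by (rule L2_operator_L2[OF fluctuation_operator[OF r sets_ball[OF horocycle_balls[OF B]]] f(1)])
  from ball_avg_AE_cong[OF f(1) this f(2)] show "f \<in> L_minus m \<H>"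
    using f(1) by (simp add: L_minus_iff ball_avg_fluctuation[OF f(1) B])
qed

lemma L_ball_orthogonal:
  assumes B: "B \<in> \<H>" "B' \<in> \<H>" "B \<noteq> B'" and f: "f \<in> L_ball m B" and g: "g \<in> L_ball m B'"
  shows "L2_inner m f g = 0"
proof -
  have fae: "f \<in> L2 m" "AE x in m. f x = fluctuation m r B f x" using f L_ball_iff[OF B(1)] by auto
  have gae: "g \<in> L2 m" "AE x in m. g x = fluctuation m r B' g x" using g L_ball_iff[OF B(2)] by auto
  obtain b b' where "B = cball b r" "B' = cball b' r" using B(1,2) \<H> by blast
  then have disj: "B \<inter> B' = {}" using cball_disjoint B(3) by simp
  have "AE x in m. f x * cnj (g x) = 0"
    using fae(2) gae(2)
  proof eventually_elim
    case (elim x)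
    show ?case
    proof (cases "x \<in> B")
      case True
      then have "x \<notin> B'" using disj by blast
      then have "g x = 0" using elim(2) by (simp add: fluctuation_def)
      then show ?thesis by simp
    next
      case False
      then have "f x = 0" using elim(1) by (simp add: fluctuation_def)
      then show ?thesis by simp
    qed
  qed
  then show ?thesis unfolding L2_inner_def by (rule integral_eq_zero_AE)
qed

text \<open>With \<open>f' = K f\<close> and \<open>g' = K g\<close> for a projection \<open>K\<close> that commutes with the operator, this is the
  invariance of the range of \<open>K\<close>.\<close>

lemma schroedinger_op_fixed:
  assumes "(f, g) \<in> schroedinger_op \<sigma>" "(f', g') \<in> schroedinger_op \<sigma>" "AE x in m. f x = f' x"
  shows "AE x in m. g x = g' x"
proof -
  have "((\<lambda>x. f x + (-1) * f' x), (\<lambda>x. g x + (-1) * g' x)) \<in> schroedinger_op \<sigma>"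
    by (rule schroedinger_op_comb[OF assms(1,2)])
  from schroedinger_op_single_valued[OF this] show ?thesis using assms(3) by simp
qed

lemma invariant_L_plus: "invariant_subspace (schroedinger_op \<sigma>) (L_plus m \<H>)"
  unfolding invariant_subspace_def
proof (clarify)
  fix f g assume fg: "(f, g) \<in> schroedinger_op \<sigma>" and f: "f \<in> L_plus m \<H>"
  then show "g \<in> L_plus m \<H>"
    using schroedinger_op_fixed[OF fg ball_avg_schroedinger_op[OF fg]] schroedinger_op_L2[OF fg]
    by (simp add: L_plus_iff)
qed

lemma invariant_L_minus: "invariant_subspace (schroedinger_op \<sigma>) (L_minus m \<H>)"
  unfolding invariant_subspace_def
proof (clarify)
  fix f g assume fg: "(f, g) \<in> schroedinger_op \<sigma>" and f: "f \<in> L_minus m \<H>"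
  have "AE x in m. ball_avg m r g x = 0"
    by (rule schroedinger_op_single_valued[OF ball_avg_schroedinger_op[OF fg]])
      (use f in \<open>simp add: L_minus_iff\<close>)
  then show "g \<in> L_minus m \<H>"
    using schroedinger_op_L2[OF fg] ball_avg_AE_zero[of g] by (simp add: L_minus_iff)
qed

lemma invariant_L_ball:
  assumes B: "B \<in> \<H>"
  shows "invariant_subspace (schroedinger_op \<sigma>) (L_ball m B)"
  unfolding invariant_subspace_def
proof (clarify)
  fix f g assume fg: "(f, g) \<in> schroedinger_op \<sigma>" and f: "f \<in> L_ball m B"
  then show "g \<in> L_ball m B"
    using schroedinger_op_fixed[OF fg fluctuation_schroedinger_op[OF fg B]] schroedinger_op_L2[OF fg]
    by (simp add: L_ball_iff[OF B])
qed

lemma schroedinger_op_sum: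
  assumes "\<And>i. i \<in> F \<Longrightarrow> (u i, v i) \<in> schroedinger_op \<sigma>"
  shows "((\<lambda>x. \<Sum>i\<in>F. u i x), (\<lambda>x. \<Sum>i\<in>F. v i x)) \<in> schroedinger_op \<sigma>"
  using assms
proof (induction F rule: infinite_finite_induct)
  case (insert i F)
  have "((\<lambda>x. u i x + 1 * (\<Sum>i\<in>F. u i x)), (\<lambda>x. v i x + 1 * (\<Sum>i\<in>F. v i x))) \<in> schroedinger_op \<sigma>"
    by (rule schroedinger_op_comb) (use insert in auto)
  then show ?case by (simp only: sum.insert[OF insert.hyps] mult_1)
qed (simp_all add: zero_schroedinger_op)

text \<open>The partial sums of the pairs lie in the operator, and the operator is closed.\<close>

lemma schroedinger_op_has_sum:
  assumes uv: "\<And>i. i \<in> I \<Longrightarrow> (u i, v i) \<in> schroedinger_op \<sigma>"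
    and f: "L2_has_sum m u I f" and g: "L2_has_sum m v I g"
  shows "(f, g) \<in> schroedinger_op \<sigma>"
  unfolding schroedinger_op_eq
proof (rule op_closure_closed)
  show "f \<in> L2 m" "g \<in> L2 m" using f g by (auto simp: L2_has_sum_def L2_tendsto_def)
  fix \<epsilon> :: real assume e: "\<epsilon> > 0"
  have "\<forall>\<^sub>F F in finite_subsets_at_top I.
      L2_norm m (\<lambda>x. (\<Sum>i\<in>F. u i x) - f x) < \<epsilon> \<and> L2_norm m (\<lambda>x. (\<Sum>i\<in>F. v i x) - g x) < \<epsilon>"
    using L2_tendsto_approx[OF f[unfolded L2_has_sum_def] e] L2_tendsto_approx[OF g[unfolded L2_has_sum_def] e]
    by eventually_elim simp
  then obtain F where F: "finite F" "F \<subseteq> I" "L2_norm m (\<lambda>x. (\<Sum>i\<in>F. u i x) - f x) < \<epsilon>"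
      "L2_norm m (\<lambda>x. (\<Sum>i\<in>F. v i x) - g x) < \<epsilon>"
    unfolding eventually_finite_subsets_at_top by blast
  have "((\<lambda>x. \<Sum>i\<in>F. u i x), (\<lambda>x. \<Sum>i\<in>F. v i x)) \<in> schroedinger_op \<sigma>"
    by (rule schroedinger_op_sum) (use uv F(2) in blast)
  with F(3,4) show "\<exists>u v. (u, v) \<in> op_closure m {(u, schroedinger_fun \<sigma> u) |u. u \<in> test_functions} \<and>
      L2_norm m (\<lambda>x. u x - f x) < \<epsilon> \<and> L2_norm m (\<lambda>x. v x - g x) < \<epsilon>"
    unfolding schroedinger_op_eq by blast
qed

text \<open>The sum of the two subspaces is indexed by the subspaces themselves, so they must be different.\<close>

lemma L_plus_not_L_minus: "L_plus m \<H> \<noteq> L_minus m \<H>"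
proof
  assume eq: "L_plus m \<H> = L_minus m \<H>"
  fix x :: 'a
  have B: "cball x r \<in> \<H>" using \<H> by blast
  have "ball_avg m r (indicator (cball x r)) = (\<lambda>x. 0)"
    using indicator_L_plus[OF B] unfolding eq L_minus_iff by simp
  moreover have "ball_avg m r (indicator (cball x r)) x = indicator (cball x r) x"
    by (rule ball_avg_of_const[OF const_on_cballs_indicator order_refl balls_cball[OF r]])
  ultimately show False using r by simp
qed

definition plus_minus_part :: "('a \<Rightarrow> complex) \<Rightarrow> ('a \<Rightarrow> complex) set \<Rightarrow> 'a \<Rightarrow> complex" where
  "plus_minus_part f M = (if M = L_plus m \<H> then ball_avg m r f else (\<lambda>x. f x - ball_avg m r f x))"

lemma plus_minus_part_has_sum:
  assumes "f \<in> L2 m"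
  shows "L2_has_sum m (plus_minus_part f) {L_plus m \<H>, L_minus m \<H>} f"
proof -
  have "(\<Sum>M\<in>{L_plus m \<H>, L_minus m \<H>}. plus_minus_part f M x) = f x" for x
    using L_plus_not_L_minus by (simp add: plus_minus_part_def)
  then show ?thesis
    using assms by (simp add: L2_has_sum_finite_iff)
qed

lemma plus_minus_part_mem:
  assumes "f \<in> L2 m" "M \<in> {L_plus m \<H>, L_minus m \<H>}"
  shows "plus_minus_part f M \<in> M"
  using assms L_plus_not_L_minus ball_avg_L_plus residual_L_minus
  by (auto simp: plus_minus_part_def)

lemma plus_minus_part_op:
  assumes "(f, g) \<in> schroedinger_op \<sigma>"
  shows "(plus_minus_part f M, plus_minus_part g M) \<in> schroedinger_op \<sigma>"
  using ball_avg_schroedinger_op[OF assms]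
    schroedinger_op_comb[OF assms ball_avg_schroedinger_op[OF assms], of "-1"]
  by (simp add: plus_minus_part_def)

lemma L_plus_orthogonal_L_minus:
  assumes "f \<in> L_plus m \<H>" "g \<in> L_minus m \<H>"
  shows "L2_inner m f g = 0" "L2_inner m g f = 0"
proof -
  show "L2_inner m g f = 0" using assms by (simp add: L_minus_def orth_complement_def)
  then show "L2_inner m f g = 0" using L2_inner_commute[of m f g] by simp
qed

lemma L2_direct_sum_plus_minus:
  "L2_direct_sum m (L2 m) {L_plus m \<H>, L_minus m \<H>} (\<lambda>M. M)"
  unfolding L2_direct_sum_def
proof (intro conjI)
  show "\<forall>M\<in>{L_plus m \<H>, L_minus m \<H>}. \<forall>N\<in>{L_plus m \<H>, L_minus m \<H>}. M \<noteq> N \<longrightarrow>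
      (\<forall>f\<in>M. \<forall>g\<in>N. L2_inner m f g = 0)"
    using L_plus_orthogonal_L_minus by auto
  show "L2 m = {f. \<exists>u. (\<forall>M\<in>{L_plus m \<H>, L_minus m \<H>}. u M \<in> M) \<and>
      L2_has_sum m u {L_plus m \<H>, L_minus m \<H>} f}"
  proof (intro subset_antisym subsetI)
    fix f assume f: "f \<in> L2 m"
    show "f \<in> {f. \<exists>u. (\<forall>M\<in>{L_plus m \<H>, L_minus m \<H>}. u M \<in> M) \<and>
        L2_has_sum m u {L_plus m \<H>, L_minus m \<H>} f}"
      by (intro CollectI exI[of _ "plus_minus_part f"] conjI ballI plus_minus_part_mem
          plus_minus_part_has_sum f)
  qed (auto simp: L2_has_sum_def L2_tendsto_def)
qed

lemma op_direct_sum_plus_minus: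
  "op_direct_sum m (L2 m) (schroedinger_op \<sigma>) {L_plus m \<H>, L_minus m \<H>} (\<lambda>M. M)
     (\<lambda>M. op_restrict (schroedinger_op \<sigma>) M)"
  unfolding op_direct_sum_def
proof (intro conjI L2_direct_sum_plus_minus)
  show "\<forall>M\<in>{L_plus m \<H>, L_minus m \<H>}. op_restrict (schroedinger_op \<sigma>) M \<subseteq> M \<times> M"
    using invariantD[OF invariant_L_plus] invariantD[OF invariant_L_minus]
    by (auto simp: op_restrict_def)
  show "schroedinger_op \<sigma> = {(f, g). \<exists>u v.
      (\<forall>M\<in>{L_plus m \<H>, L_minus m \<H>}. (u M, v M) \<in> op_restrict (schroedinger_op \<sigma>) M) \<and>
      L2_has_sum m u {L_plus m \<H>, L_minus m \<H>} f \<and> L2_has_sum m v {L_plus m \<H>, L_minus m \<H>} g}"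
    (is "_ = ?R")
  proof (intro subset_antisym subrelI)
    fix f g assume fg: "(f, g) \<in> schroedinger_op \<sigma>"
    then have L2: "f \<in> L2 m" "g \<in> L2 m" using schroedinger_op_L2 by auto
    have "\<forall>M\<in>{L_plus m \<H>, L_minus m \<H>}.
        (plus_minus_part f M, plus_minus_part g M) \<in> op_restrict (schroedinger_op \<sigma>) M"
      using plus_minus_part_op[OF fg] plus_minus_part_mem[OF L2(1)] by (simp add: op_restrict_def)
    with plus_minus_part_has_sum[OF L2(1)] plus_minus_part_has_sum[OF L2(2)]
    show "(f, g) \<in> ?R" by blast
  next
    fix f g assume "(f, g) \<in> ?R"
    then obtain u v where uv: "\<forall>M\<in>{L_plus m \<H>, L_minus m \<H>}. (u M, v M) \<in> op_restrict (schroedinger_op \<sigma>) M"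
      "L2_has_sum m u {L_plus m \<H>, L_minus m \<H>} f" "L2_has_sum m v {L_plus m \<H>, L_minus m \<H>} g"
      by blast
    show "(f, g) \<in> schroedinger_op \<sigma>"
      by (rule schroedinger_op_has_sum[OF _ uv(2,3)]) (use uv(1) in \<open>auto simp: op_restrict_def\<close>)
  qed
qed

text \<open>Both potentials are constant on \<open>B\<close>, so on functions vanishing outside \<open>B\<close> the two operators differ by a
  scalar. The projection onto \<open>L_ball m B\<close> keeps the approximating functions supported in \<open>B\<close>.\<close>

lemma schroedinger_op_shift:
  assumes B: "B \<in> \<H>" and fg: "(f, g) \<in> schroedinger_op \<sigma>" and f: "f \<in> L_ball m B"
  shows "(f, \<lambda>x. g x + of_real (\<tau> B - \<sigma> B) * f x) \<in> schroedinger_op \<tau>"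
proof -
  obtain b where b: "B = cball b r" using B \<H> by blast
  let ?K = "fluctuation m r B" and ?c = "complex_of_real (\<tau> B - \<sigma> B)"
  let ?A = "{(u, schroedinger_fun \<sigma> u) | u. u \<in> test_functions \<and> (\<forall>x. x \<notin> B \<longrightarrow> u x = 0)}"
  have K: "L2_operator m ?K"
    by (rule fluctuation_operator[OF r sets_ball[OF horocycle_balls[OF B]]])
  \<comment> \<open>The core \<open>?A\<close> is cut down to functions supported in \<open>B\<close>, where the potential is \<open>\<sigma> B\<close>.\<close>
  have Kfg: "(?K f, ?K g) \<in> op_closure m ?A"
    using fg unfolding schroedinger_op_eq
  proof (rule op_closure_commute[OF K])
    fix u v assume "(u, v) \<in> {(u, schroedinger_fun \<sigma> u) |u. u \<in> test_functions}"
    then have u: "u \<in> test_functions" "v = schroedinger_fun \<sigma> u" by auto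
    have "?K v = schroedinger_fun \<sigma> (?K u)" unfolding u(2) b by (rule fluctuation_schroedinger[OF u(1)])
    moreover have "?K u \<in> test_functions" unfolding b by (rule fluctuation_test_function[OF u(1)])
    moreover have "\<forall>x. x \<notin> B \<longrightarrow> ?K u x = 0" by (simp add: fluctuation_def)
    ultimately show "(?K u, ?K v) \<in> ?A" by blast
  qed
  have "(?K f, \<lambda>x. ?K g x + ?c * ?K f x) \<in> op_closure m {(u, schroedinger_fun \<tau> u) | u. u \<in> test_functions}"
    using Kfg
  proof (rule op_closure_add_scalar)
    fix u v assume "(u, v) \<in> ?A"
    then have u: "u \<in> test_functions" "\<And>x. x \<notin> B \<Longrightarrow> u x = 0" "v = schroedinger_fun \<sigma> u" by auto
    have "v x + ?c * u x = schroedinger_fun \<tau> u x" for x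
    proof (cases "x \<in> B")
      case True
      then have "cball x r = B" using cball_eq[of x b r] b by simp
      then show ?thesis by (simp add: u(3) schroedinger_fun_def potential_eq algebra_simps)
    next
      case False
      then show ?thesis by (simp add: u(2,3) schroedinger_fun_def)
    qed
    with u(1) show "(u, \<lambda>x. v x + ?c * u x) \<in> {(u, schroedinger_fun \<tau> u) | u. u \<in> test_functions}"
      by auto
  qed
  then have shifted: "(?K f, \<lambda>x. ?K g x + ?c * ?K f x) \<in> schroedinger_op \<tau>"
    by (simp only: schroedinger_op_eq)
  have fK: "f \<in> L2 m" "AE x in m. f x = ?K f x" using f L_ball_iff[OF B] by auto
  have gK: "g \<in> L2 m" "AE x in m. g x = ?K g x"
    using invariantD[OF invariant_L_ball[OF B] fg f] L_ball_iff[OF B] by auto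
  show ?thesis
    using shifted unfolding schroedinger_op_eq
  proof (rule op_closure_AE_cong)
    show "AE x in m. ?K f x = f x" using fK(2) by eventually_elim simp
    show "AE x in m. ?K g x + ?c * ?K f x = g x + ?c * f x" using fK(2) gK(2) by eventually_elim simp
  qed (use L2_add[OF gK(1) L2_scale[OF fK(1)]] fK(1) in \<open>auto simp: L2_def\<close>)
qed

lemma op_restrict_L_ball:
  assumes B: "B \<in> \<H>"
  shows "op_restrict (schroedinger_op \<sigma>) (L_ball m B)
    = op_add_scalar (op_restrict (hierarchical_laplacian m C) (L_ball m B)) (of_real (\<sigma> B))"
  unfolding laplacian_op_eq
proof (intro subset_antisym subrelI)
  fix f g assume "(f, g) \<in> op_restrict (schroedinger_op \<sigma>) (L_ball m B)"
  then have fg: "(f, g) \<in> schroedinger_op \<sigma>" and f: "f \<in> L_ball m B" by (auto simp: op_restrict_def)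
  let ?h = "\<lambda>x. g x + of_real (0 - \<sigma> B) * f x"
  have h: "(f, ?h) \<in> op_restrict (schroedinger_op (\<lambda>B. 0)) (L_ball m B)"
    using schroedinger_op_shift[OF B fg f, of "\<lambda>B. 0"] f by (simp add: op_restrict_def)
  have "g = (\<lambda>x. ?h x + of_real (\<sigma> B) * f x)" by (simp add: algebra_simps)
  then have "(f, g) = (f, \<lambda>x. ?h x + of_real (\<sigma> B) * f x)" by (rule arg_cong[where f = "Pair f"])
  then show "(f, g) \<in> op_add_scalar (op_restrict (schroedinger_op (\<lambda>B. 0)) (L_ball m B)) (of_real (\<sigma> B))"
    unfolding op_add_scalar_def by (intro CollectI exI[of _ f] exI[of _ ?h] conjI h)
next
  fix f g assume "(f, g) \<in> op_add_scalar (op_restrict (schroedinger_op (\<lambda>B. 0)) (L_ball m B)) (of_real (\<sigma> B))"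
  then obtain h where h: "g = (\<lambda>x. h x + of_real (\<sigma> B) * f x)"
      "(f, h) \<in> schroedinger_op (\<lambda>B. 0)" "f \<in> L_ball m B"
    unfolding op_add_scalar_def op_restrict_def by blast
  show "(f, g) \<in> op_restrict (schroedinger_op \<sigma>) (L_ball m B)"
    using schroedinger_op_shift[OF B h(2,3), of \<sigma>] h(1,3) by (simp add: op_restrict_def)
qed

lemma fluctuation_has_sum:
  assumes f: "f \<in> L_minus m \<H>"
  shows "L2_has_sum m (\<lambda>B. fluctuation m r B f) \<H> f"
  unfolding L2_has_sum_def
proof (rule L2_tendstoI)
  have fL2: "f \<in> L2 m" and avg: "ball_avg m r f = (\<lambda>x. 0)" using f by (auto simp: L_minus_iff)
  show "f \<in> L2 m" by fact
  have mem: "(\<lambda>x. \<Sum>B\<in>F. fluctuation m r B f x) \<in> L2 m" if "F \<subseteq> \<H>" for F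
    by (rule L2_sum)
      (use that fluctuation_L_ball[OF fL2] L_ball_iff in blast)
  have sum_in: "(\<Sum>B\<in>F. fluctuation m r B f x) = f x" if F: "finite F" "F \<subseteq> \<H>" "cball x r \<in> F" for F x
  proof -
    have "(\<Sum>B\<in>F. fluctuation m r B f x) = (\<Sum>B\<in>F. if B = cball x r then f x else 0)"
    proof (rule sum.cong[OF refl])
      fix B assume "B \<in> F"
      then obtain b where b: "B = cball b r" using F(2) \<H> by blast
      have "x \<in> B \<longleftrightarrow> B = cball x r" using cball_eq[of x b r] r b by auto
      then show "fluctuation m r B f x = (if B = cball x r then f x else 0)"
        by (simp add: fluctuation_def avg indicator_def)
    qed
    also have "\<dots> = f x" using F(1,3) by simp
    finally show ?thesis .
  qed
  have sum_out: "(\<Sum>B\<in>F. fluctuation m r B f x) = 0" if F: "F \<subseteq> \<H>" "cball x r \<notin> F" for F x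
  proof (rule sum.neutral, rule ballI)
    fix B assume B: "B \<in> F"
    then obtain b where b: "B = cball b r" using F(1) \<H> by blast
    have "x \<notin> B" using cball_eq[of x b r] b B F(2) by auto
    then show "fluctuation m r B f x = 0" by (simp add: fluctuation_def)
  qed
  fix \<epsilon> :: real assume "\<epsilon> > 0"
  \<comment> \<open>A test function \<open>u\<close> near \<open>f\<close> vanishes off finitely many balls, so \<open>f\<close> is small there.\<close>
  then obtain u where u: "u \<in> test_functions" "u \<in> L2 m" "L2_norm m (\<lambda>x. u x - f x) < \<epsilon>"
    using L2_closureE[OF test_functions_dense[OF fL2]] by blast
  obtain e K where K: "e > 0" "const_on_cballs e u" "compact K" "\<And>x. x \<notin> K \<Longrightarrow> u x = 0"
    using u(1) by (rule test_functionE) blast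
  let ?F0 = "(\<lambda>y. cball y r) ` K"
  show "\<forall>\<^sub>F F in finite_subsets_at_top \<H>. (\<lambda>x. \<Sum>B\<in>F. fluctuation m r B f x) \<in> L2 m \<and>
      L2_norm m (\<lambda>x. (\<Sum>B\<in>F. fluctuation m r B f x) - f x) < \<epsilon>"
    unfolding eventually_finite_subsets_at_top
  proof (intro exI[of _ ?F0] conjI allI impI)
    show "finite ?F0" by (rule finite_cballs_compact[OF K(3) r])
    show "?F0 \<subseteq> \<H>" using \<H> by blast
    fix F assume F: "finite F \<and> ?F0 \<subseteq> F \<and> F \<subseteq> \<H>"
    then show L2: "(\<lambda>x. \<Sum>B\<in>F. fluctuation m r B f x) \<in> L2 m" using mem by blast
    have "cmod ((\<Sum>B\<in>F. fluctuation m r B f x) - f x) \<le> cmod (u x - f x)" for x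
    proof (cases "cball x r \<in> F")
      case True
      then show ?thesis using F sum_in by simp
    next
      case False
      then have "x \<notin> K" using F by blast
      then show ?thesis using F False K(4) sum_out by simp
    qed
    then have "L2_norm m (\<lambda>x. (\<Sum>B\<in>F. fluctuation m r B f x) - f x) \<le> L2_norm m (\<lambda>x. u x - f x)"
      using L2_diff[OF L2 fL2] by (intro L2_norm_mono L2_diff u(2) fL2) (auto simp: L2_def)
    then show "L2_norm m (\<lambda>x. (\<Sum>B\<in>F. fluctuation m r B f x) - f x) < \<epsilon>" using u(3) by simp
  qed
qed

lemma L2_has_sum_L_minus:
  assumes u: "\<And>B. B \<in> \<H> \<Longrightarrow> u B \<in> L_minus m \<H>" and f: "L2_has_sum m u \<H> f"
  shows "f \<in> L_minus m \<H>"
proof -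
  have fL2: "f \<in> L2 m" using f by (simp add: L2_has_sum_def L2_tendsto_def)
  note Pf = ball_avg_contraction(1)[OF fL2 r]
  have "L2_norm m (ball_avg m r f) \<le> 0 + \<epsilon>" if e: "\<epsilon> > 0" for \<epsilon>
  proof -
    obtain F where F: "finite F" "F \<subseteq> \<H>" "L2_norm m (\<lambda>x. (\<Sum>B\<in>F. u B x) - f x) < \<epsilon>"
      using L2_tendsto_approx[OF f[unfolded L2_has_sum_def] e]
      unfolding eventually_finite_subsets_at_top by blast
    have sum: "(\<lambda>x. \<Sum>B\<in>F. u B x) \<in> L2 m \<and> ball_avg m r (\<lambda>x. \<Sum>B\<in>F. u B x) = (\<lambda>x. 0)"
      using F(1,2)
    proof (induction F)
      case empty
      show ?case by (auto simp: ball_avg_def set_lebesgue_integral_def)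
    next
      case (insert B F)
      then have uB: "u B \<in> L2 m" "ball_avg m r (u B) = (\<lambda>x. 0)"
        and IH: "(\<lambda>x. \<Sum>B\<in>F. u B x) \<in> L2 m" "ball_avg m r (\<lambda>x. \<Sum>B\<in>F. u B x) = (\<lambda>x. 0)"
        using u L_minus_iff by auto
      have "ball_avg m r (\<lambda>x. u B x + 1 * (\<Sum>B\<in>F. u B x)) x = 0" for x
        by (subst ball_avg_comb) (simp_all add: L2_set_integrable_cball uB IH)
      then have "ball_avg m r (\<lambda>x. u B x + (\<Sum>B\<in>F. u B x)) = (\<lambda>x. 0)" by (intro ext) simp
      with L2_add[OF uB(1) IH(1)] show ?case by (simp only: sum.insert[OF insert.hyps] simp_thms)
    qed
    have "ball_avg m r (\<lambda>x. (\<Sum>B\<in>F. u B x) - f x) = (\<lambda>x. 0 - ball_avg m r f x)"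
      by (rule ext) (simp add: ball_avg_diff L2_set_integrable_cball fL2 sum)
    then have "L2_norm m (ball_avg m r f) = L2_norm m (ball_avg m r (\<lambda>x. (\<Sum>B\<in>F. u B x) - f x))"
      using L2_norm_minus_commute[of m "\<lambda>x. 0" "ball_avg m r f"] by simp
    also have "\<dots> \<le> L2_norm m (\<lambda>x. (\<Sum>B\<in>F. u B x) - f x)"
      by (intro ball_avg_contraction(2)[OF _ r] L2_diff fL2) (use sum in blast)
    finally show ?thesis using F(3) by simp
  qed
  then have "L2_norm m (ball_avg m r f) \<le> 0" by (rule field_le_epsilon)
  then have "L2_norm m (ball_avg m r f) = 0" using L2_norm_nonneg[of m "ball_avg m r f"] by linarith
  then have "AE x in m. ball_avg m r f x = 0" using L2_norm_eq_0_iff[OF Pf] by simp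
  from ball_avg_AE_zero[OF fL2 this] show ?thesis using fL2 by (simp add: L_minus_iff)
qed

lemma L2_direct_sum_L_minus: "L2_direct_sum m (L_minus m \<H>) \<H> (L_ball m)"
  unfolding L2_direct_sum_def
proof (intro conjI)
  show "\<forall>B\<in>\<H>. \<forall>B'\<in>\<H>. B \<noteq> B' \<longrightarrow> (\<forall>f\<in>L_ball m B. \<forall>g\<in>L_ball m B'. L2_inner m f g = 0)"
    using L_ball_orthogonal by blast
  show "L_minus m \<H> = {f. \<exists>u. (\<forall>B\<in>\<H>. u B \<in> L_ball m B) \<and> L2_has_sum m u \<H> f}"
  proof (intro subset_antisym subsetI)
    fix f assume f: "f \<in> L_minus m \<H>"
    then have "f \<in> L2 m" by (simp add: L_minus_iff)
    then have "\<forall>B\<in>\<H>. fluctuation m r B f \<in> L_ball m B" using fluctuation_L_ball by blast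
    with fluctuation_has_sum[OF f]
    show "f \<in> {f. \<exists>u. (\<forall>B\<in>\<H>. u B \<in> L_ball m B) \<and> L2_has_sum m u \<H> f}"
      by (intro CollectI exI[of _ "\<lambda>B. fluctuation m r B f"] conjI)
  next
    fix f assume "f \<in> {f. \<exists>u. (\<forall>B\<in>\<H>. u B \<in> L_ball m B) \<and> L2_has_sum m u \<H> f}"
    then obtain u where u: "\<forall>B\<in>\<H>. u B \<in> L_ball m B" "L2_has_sum m u \<H> f" by blast
    show "f \<in> L_minus m \<H>"
      by (rule L2_has_sum_L_minus[OF _ u(2)]) (use u(1) L_ball_subset_L_minus in blast)
  qed
qed

lemma op_direct_sum_L_minus:
  "op_direct_sum m (L_minus m \<H>) (op_restrict (schroedinger_op \<sigma>) (L_minus m \<H>)) \<H> (L_ball m)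
     (\<lambda>B. op_restrict (schroedinger_op \<sigma>) (L_ball m B))"
  unfolding op_direct_sum_def
proof (intro conjI L2_direct_sum_L_minus)
  show "\<forall>B\<in>\<H>. op_restrict (schroedinger_op \<sigma>) (L_ball m B) \<subseteq> L_ball m B \<times> L_ball m B"
    using invariantD[OF invariant_L_ball] by (auto simp: op_restrict_def)
  show "op_restrict (schroedinger_op \<sigma>) (L_minus m \<H>) = {(f, g). \<exists>u v.
      (\<forall>B\<in>\<H>. (u B, v B) \<in> op_restrict (schroedinger_op \<sigma>) (L_ball m B)) \<and>
      L2_has_sum m u \<H> f \<and> L2_has_sum m v \<H> g}" (is "_ = ?R")
  proof (intro subset_antisym subrelI)
    fix f g assume "(f, g) \<in> op_restrict (schroedinger_op \<sigma>) (L_minus m \<H>)"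
    then have fg: "(f, g) \<in> schroedinger_op \<sigma>" and f: "f \<in> L_minus m \<H>" by (auto simp: op_restrict_def)
    have g: "g \<in> L_minus m \<H>" by (rule invariantD[OF invariant_L_minus fg f])
    have fL2: "f \<in> L2 m" using f by (simp add: L_minus_iff)
    have "\<forall>B\<in>\<H>. (fluctuation m r B f, fluctuation m r B g) \<in> op_restrict (schroedinger_op \<sigma>) (L_ball m B)"
      using fluctuation_schroedinger_op[OF fg] fluctuation_L_ball[OF fL2] by (simp add: op_restrict_def)
    with fluctuation_has_sum[OF f] fluctuation_has_sum[OF g] show "(f, g) \<in> ?R"
      by (intro CollectI case_prodI exI[of _ "\<lambda>B. fluctuation m r B f"]
          exI[of _ "\<lambda>B. fluctuation m r B g"] conjI)
  next
    fix f g assume "(f, g) \<in> ?R"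
    then obtain u v where uv: "\<forall>B\<in>\<H>. (u B, v B) \<in> op_restrict (schroedinger_op \<sigma>) (L_ball m B)"
      "L2_has_sum m u \<H> f" "L2_has_sum m v \<H> g"
      by blast
    have "(f, g) \<in> schroedinger_op \<sigma>"
      by (rule schroedinger_op_has_sum[OF _ uv(2,3)]) (use uv(1) in \<open>auto simp: op_restrict_def\<close>)
    moreover have "f \<in> L_minus m \<H>"
      by (rule L2_has_sum_L_minus[OF _ uv(2)])
        (use uv(1) L_ball_subset_L_minus in \<open>auto simp: op_restrict_def\<close>)
    ultimately show "(f, g) \<in> op_restrict (schroedinger_op \<sigma>) (L_minus m \<H>)"
      by (simp add: op_restrict_def)
  qed
qed

end

lemma op_direct_sum_cong:
  assumes "\<And>i. i \<in> I \<Longrightarrow> B i = B' i"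
  shows "op_direct_sum m M A I N B \<longleftrightarrow> op_direct_sum m M A I N B'"
  unfolding op_direct_sum_def using assms by simp

theorem lemma3p3:
  fixes m :: "'a::metric_space measure"
    and C :: "'a set \<Rightarrow> real"
    and \<H> :: "'a set set"
    and \<sigma> :: "'a set \<Rightarrow> real"
    and L H :: "'a operator"
  assumes "homogeneous_ultrametric_measure_space m"
    and "homogeneous_weights C"
    and "horocycle \<H>"
    and "L = hierarchical_laplacian m C"
    and "H = hierarchical_schroedinger m C (potential \<H> \<sigma>)"
  shows "(\<forall>M \<in> {L_plus m \<H>, L_minus m \<H>} \<union> L_ball m ` \<H>.
            invariant_subspace H M \<and> invariant_subspace L M) \<and>
         op_direct_sum m (L2 m) H
           {L_plus m \<H>, L_minus m \<H>} (\<lambda>M. M) (\<lambda>M. op_restrict H M) \<and>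
         (\<forall>B\<in>\<H>. op_restrict H (L_ball m B)
            = op_add_scalar (op_restrict L (L_ball m B)) (of_real (\<sigma> B))) \<and>
         op_direct_sum m (L_minus m \<H>) (op_restrict H (L_minus m \<H>))
           \<H> (L_ball m) (\<lambda>B. op_add_scalar (op_restrict L (L_ball m B)) (of_real (\<sigma> B)))"
proof -
  interpret homogeneous_ultrametric_measure_space m by fact
  obtain r where r: "r > 0" "\<H> = range (\<lambda>x. cball x r)"
    using assms(3) by (rule horocycle_radius)
  interpret horocycle_space m C \<H> r
    by unfold_locales (use assms(2) r in auto)
  have shift: "op_restrict H (L_ball m B) = op_add_scalar (op_restrict L (L_ball m B)) (of_real (\<sigma> B))"
    if "B \<in> \<H>" for B
    unfolding assms(4,5) by (rule op_restrict_L_ball[OF that])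
  show ?thesis
  proof (intro conjI)
    show "\<forall>M \<in> {L_plus m \<H>, L_minus m \<H>} \<union> L_ball m ` \<H>. invariant_subspace H M \<and> invariant_subspace L M"
      unfolding assms(4,5) laplacian_op_eq
      using invariant_L_plus invariant_L_minus invariant_L_ball by auto
    show "op_direct_sum m (L2 m) H {L_plus m \<H>, L_minus m \<H>} (\<lambda>M. M) (\<lambda>M. op_restrict H M)"
      unfolding assms(5) by (rule op_direct_sum_plus_minus)
    show "\<forall>B\<in>\<H>. op_restrict H (L_ball m B)
        = op_add_scalar (op_restrict L (L_ball m B)) (of_real (\<sigma> B))"
      using shift by blast
    have "op_direct_sum m (L_minus m \<H>) (op_restrict H (L_minus m \<H>)) \<H> (L_ball m)
        (\<lambda>B. op_restrict H (L_ball m B))"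
      unfolding assms(5) by (rule op_direct_sum_L_minus)
    also have "?this \<longleftrightarrow> op_direct_sum m (L_minus m \<H>) (op_restrict H (L_minus m \<H>)) \<H> (L_ball m)
        (\<lambda>B. op_add_scalar (op_restrict L (L_ball m B)) (of_real (\<sigma> B)))"
      by (rule op_direct_sum_cong[OF shift])
    finally show "op_direct_sum m (L_minus m \<H>) (op_restrict H (L_minus m \<H>))
        \<H> (L_ball m) (\<lambda>B. op_add_scalar (op_restrict L (L_ball m B)) (of_real (\<sigma> B)))" .
  qed
qed

end
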